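(* Let $G$ be a simple graph on $n\geq 3$ vertices with chromatic number $\kappa(G)=2$ and Euler characteristic $\chi$. Then \[ a(G)\leq 4\,\frac{n-\chi}{n}. \]
   Context: $a(G)$ is the second smallest eigenvalue of the Laplacian $L=D-A$ ($A$ adjacency matrix, $D$ diagonal degree matrix). Surfaces: orientable $S_h$ with Euler characteristic $2-2h$, non-orientable $N_k$ with Euler characteristic $2-k$. The Euler characteristic of a graph is the Euler characteristic of the surface of minimum genus (in the orientable or the non-orientable setting, either one) in which the graph embeds. *)

theory Defs
  imports "HOL-Analysis.Analysis" "HOL-Computational_Algebra.Polynomial"
begin

text \<open>A graph is an adjacency relation on a finite type of vertices; it is simple if the relation
  is symmetric and irreflexive.\<close>

definition chromatic_number :: "('n \<Rightarrow> 'n \<Rightarrow> bool) \<Rightarrow> nat" where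
  "chromatic_number adj =
    (LEAST k. \<exists>c :: 'n \<Rightarrow> nat. (\<forall>v. c v < k) \<and> (\<forall>u v. adj u v \<longrightarrow> c u \<noteq> c v))"


subsection \<open>Algebraic connectivity\<close>

definition adjacency_matrix :: "('n::finite \<Rightarrow> 'n \<Rightarrow> bool) \<Rightarrow> real^'n^'n" where
  "adjacency_matrix adj = (\<chi> i j. if adj i j then 1 else 0)"

definition degree_matrix :: "('n::finite \<Rightarrow> 'n \<Rightarrow> bool) \<Rightarrow> real^'n^'n" where
  "degree_matrix adj = (\<chi> i j. if i = j then real (card {v. adj i v}) else 0)"

definition laplacian :: "('n::finite \<Rightarrow> 'n \<Rightarrow> bool) \<Rightarrow> real^'n^'n" where
  "laplacian adj = degree_matrix adj - adjacency_matrix adj"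

definition characteristic_poly :: "real^'n^'n \<Rightarrow> real poly" where
  "characteristic_poly M = det (mat [:0, 1:] - (\<chi> i j. [:M $ i $ j:]))"

text \<open>Eigenvalues in increasing order, repeated according to multiplicity; the first one has
  index 0.\<close>

definition sorted_eigenvalues :: "real^'n^'n \<Rightarrow> real list" where
  "sorted_eigenvalues M = sorted_list_of_multiset (proots (characteristic_poly M))"

definition algebraic_connectivity :: "('n::finite \<Rightarrow> 'n \<Rightarrow> bool) \<Rightarrow> real" where
  "algebraic_connectivity adj = sorted_eigenvalues (laplacian adj) ! 1"


subsection \<open>Closed surfaces\<close>

text \<open>The closed unit disc is regarded as a polygon with \<open>L\<close> sides; side \<open>i < L\<close> is the boundary
  arc traced out by \<open>side_point L i s\<close> for \<open>s\<close> running from 0 to 1.\<close>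

definition side_point :: "nat \<Rightarrow> nat \<Rightarrow> real \<Rightarrow> complex" where
  "side_point L i s = cis (2 * pi * (real i + s) / real L)"

text \<open>An edge word lists, for each side in turn, its letter and its direction; \<open>(x, False)\<close>
  stands for the inverse of \<open>(x, True)\<close>. Sides with the same letter are glued along their
  directions. The transitive closure is needed because several corners may become one point.\<close>

definition side_gluing :: "(nat \<times> bool) list \<Rightarrow> (complex \<times> complex) set" where
  "side_gluing w =
    {(side_point (length w) i s,
      side_point (length w) j (if snd (w ! i) = snd (w ! j) then s else 1 - s)) | i j s.
        i < length w \<and> j < length w \<and> fst (w ! i) = fst (w ! j) \<and> 0 \<le> s \<and> s \<le> 1}"

definition gluing_rel :: "(nat \<times> bool) list \<Rightarrow> (complex \<times> complex) set" where
  "gluing_rel w = (side_gluing w)\<^sup>* \<inter> (cball 0 1 \<times> cball 0 1)"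

definition polygon_surface :: "(nat \<times> bool) list \<Rightarrow> complex set topology" where
  "polygon_surface w =
    topology (\<lambda>U. U \<subseteq> cball 0 1 // gluing_rel w \<and> openin (top_of_set (cball 0 1)) (\<Union>U))"

text \<open>\<open>S\<^sub>0\<close> is given by the word \<open>a a\<inverse>\<close>, \<open>S\<^sub>h\<close> for \<open>h \<ge> 1\<close> by the product of the commutators
  \<open>a\<^sub>i b\<^sub>i a\<^sub>i\<inverse> b\<^sub>i\<inverse>\<close> and \<open>N\<^sub>k\<close> for \<open>k \<ge> 1\<close> by the product of the squares \<open>a\<^sub>i a\<^sub>i\<close>.\<close>

definition orientable_surface :: "nat \<Rightarrow> complex set topology" where
  "orientable_surface h =
    polygon_surface
      (if h = 0 then [(0, True), (0, False)]
       else concat (map (\<lambda>i. [(2 * i, True), (2 * i + 1, True), (2 * i, False), (2 * i + 1, False)])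
                        [0..<h]))"

definition nonorientable_surface :: "nat \<Rightarrow> complex set topology" where
  "nonorientable_surface k = polygon_surface (concat (map (\<lambda>i. [(i, True), (i, True)]) [0..<k]))"


subsection \<open>Embeddings and the Euler characteristic of a graph\<close>

text \<open>The graph as a topological space: vertices are the standard unit vectors, edges are
  straight segments between them.\<close>

definition graph_realization :: "('n::finite \<Rightarrow> 'n \<Rightarrow> bool) \<Rightarrow> (real^'n) set" where
  "graph_realization adj =
    range (\<lambda>v. axis v 1) \<union> (\<Union>(u, v) \<in> {(u, v). adj u v}. closed_segment (axis u 1) (axis v 1))"

definition embeds_in :: "('n::finite \<Rightarrow> 'n \<Rightarrow> bool) \<Rightarrow> 'a topology \<Rightarrow> bool" where
  "embeds_in adj X \<longleftrightarrow> (\<exists>f. embedding_map (top_of_set (graph_realization adj)) X f)"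

definition has_orientable_genus :: "('n::finite \<Rightarrow> 'n \<Rightarrow> bool) \<Rightarrow> nat \<Rightarrow> bool" where
  "has_orientable_genus adj h \<longleftrightarrow>
    embeds_in adj (orientable_surface h) \<and> (\<forall>h' < h. \<not> embeds_in adj (orientable_surface h'))"

definition has_nonorientable_genus :: "('n::finite \<Rightarrow> 'n \<Rightarrow> bool) \<Rightarrow> nat \<Rightarrow> bool" where
  "has_nonorientable_genus adj k \<longleftrightarrow>
    k \<ge> 1 \<and> embeds_in adj (nonorientable_surface k) \<and>
    (\<forall>k'. 1 \<le> k' \<and> k' < k \<longrightarrow> \<not> embeds_in adj (nonorientable_surface k'))"

text \<open>A relation and not a function, since the orientable and the nonorientable setting may give
  different values, and both are admitted.\<close>

definition has_euler_characteristic :: "('n::finite \<Rightarrow> 'n \<Rightarrow> bool) \<Rightarrow> int \<Rightarrow> bool" where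
  "has_euler_characteristic adj x \<longleftrightarrow>
    (\<exists>h. has_orientable_genus adj h \<and> x = 2 - 2 * int h) \<or>
    (\<exists>k. has_nonorientable_genus adj k \<and> x = 2 - int k)"


subsection \<open>The quotient topology is well defined\<close>

lemma sym_side_gluing: "sym (side_gluing w)"
proof (rule symI)
  fix x y assume "(x, y) \<in> side_gluing w"
  then obtain i j s where ij: "i < length w" "j < length w" "fst (w ! i) = fst (w ! j)"
      "0 \<le> s" "s \<le> 1"
    and x: "x = side_point (length w) i s"
    and y: "y = side_point (length w) j (if snd (w ! i) = snd (w ! j) then s else 1 - s)"
    unfolding side_gluing_def by auto
  define t where "t = (if snd (w ! i) = snd (w ! j) then s else 1 - s)"
  have "y = side_point (length w) j t" "0 \<le> t" "t \<le> 1"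
    "x = side_point (length w) i (if snd (w ! j) = snd (w ! i) then t else 1 - t)"
    using ij x y by (auto simp: t_def)
  then show "(y, x) \<in> side_gluing w"
    using ij unfolding side_gluing_def mem_Collect_eq by metis
qed

lemma equiv_gluing_rel: "equiv (cball 0 1) (gluing_rel w)"
proof (rule equivI)
  show "refl_on (cball 0 1) (gluing_rel w)"
    by (auto simp: refl_on_def gluing_rel_def)
  show "sym (gluing_rel w)"
    using sym_rtrancl[OF sym_side_gluing[of w]] by (auto simp: gluing_rel_def sym_def)
  show "trans (gluing_rel w)"
    by (auto simp: gluing_rel_def trans_def intro: rtrancl_trans)
qed (auto simp: gluing_rel_def)

lemma istopology_polygon_surface:
  "istopology (\<lambda>U. U \<subseteq> cball 0 1 // gluing_rel w \<and> openin (top_of_set (cball 0 1)) (\<Union>U))"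
  (is "istopology ?P")
  unfolding istopology_def
proof (intro conjI allI impI)
  fix U V assume U: "?P U" and V: "?P V"
  then show "U \<inter> V \<subseteq> cball 0 1 // gluing_rel w" by blast
  have "\<Union>(U \<inter> V) = \<Union>U \<inter> \<Union>V"
    using U V quotient_disj[OF equiv_gluing_rel[of w]] by blast
  then show "openin (top_of_set (cball 0 1)) (\<Union>(U \<inter> V))"
    using U V openin_Int by metis
next
  fix K assume K: "\<forall>U\<in>K. ?P U"
  then show "\<Union>K \<subseteq> cball 0 1 // gluing_rel w" by blast
  have "openin (top_of_set (cball 0 1)) (\<Union>(Union ` K))"
    using K by (intro openin_Union) blast
  moreover have "\<Union>(\<Union>K) = \<Union>(Union ` K)" by blast
  ultimately show "openin (top_of_set (cball 0 1)) (\<Union>(\<Union>K))" by metis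
qed

lemma openin_polygon_surface:
  "openin (polygon_surface w) U \<longleftrightarrow>
    U \<subseteq> cball 0 1 // gluing_rel w \<and> openin (top_of_set (cball 0 1)) (\<Union>U)"
  unfolding polygon_surface_def by (simp add: topology_inverse'[OF istopology_polygon_surface])

lemma topspace_polygon_surface: "topspace (polygon_surface w) = cball 0 1 // gluing_rel w"
proof -
  have "openin (polygon_surface w) (cball 0 1 // gluing_rel w)"
    by (simp add: openin_polygon_surface Union_quotient[OF equiv_gluing_rel])
  then have "cball 0 1 // gluing_rel w \<subseteq> topspace (polygon_surface w)"
    by (rule openin_subset)
  moreover have "topspace (polygon_surface w) \<subseteq> cball 0 1 // gluing_rel w"
    using openin_topspace[of "polygon_surface w"] unfolding openin_polygon_surface by (rule conjunct1)
  ultimately show ?thesis by (rule equalityI[rotated])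
qed

lemma quotient_map_polygon_surface:
  "quotient_map (top_of_set (cball 0 1)) (polygon_surface w) (\<lambda>z. gluing_rel w `` {z})"
proof -
  have *: "{z \<in> cball 0 1. gluing_rel w `` {z} \<in> U} = \<Union>U"
    if U: "U \<subseteq> cball 0 1 // gluing_rel w" for U
  proof (intro set_eqI iffI)
    fix z assume "z \<in> {z \<in> cball 0 1. gluing_rel w `` {z} \<in> U}"
    then show "z \<in> \<Union>U"
      using equiv_class_self[OF equiv_gluing_rel] by blast
  next
    fix z assume "z \<in> \<Union>U"
    then obtain C where C: "C \<in> U" "z \<in> C" by blast
    then obtain y where y: "y \<in> cball 0 1" "C = gluing_rel w `` {y}"
      using U by (auto elim!: quotientE)
    then have "(y, z) \<in> gluing_rel w" using C by blast
    then have "C = gluing_rel w `` {z}" "z \<in> cball 0 1"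
      using y equiv_class_eq[OF equiv_gluing_rel] by (auto simp: gluing_rel_def)
    then show "z \<in> {z \<in> cball 0 1. gluing_rel w `` {z} \<in> U}" using C by simp
  qed
  show ?thesis
    unfolding quotient_map_def topspace_polygon_surface openin_polygon_surface
    using * by (auto simp: quotient_def)
qed

end

theory Submission
  imports Defs
begin

text \<open>
  The test vector \<open>axis u 1 - axis v 1\<close>, for two vertices \<open>u\<close>, \<open>v\<close> of small degree in the larger colour
  class, gives \<open>a(G) \<le> 2 m / n\<close> for a bipartite graph with \<open>m\<close> edges. It remains to show
  \<open>m \<le> 2 (n - \<chi>)\<close> when \<open>G\<close> is connected; a disconnected graph has \<open>a(G) \<le> 0\<close>.

  An embedding may be wild, so the faces are studied through circle-valued maps, in the spirit of
  Borsuk and Eilenberg. Let \<open>K\<close> be the preimage of the graph in the polygon. Every circle-valued map on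
  the graph extends to the surface minus finitely many poles, a pole can be moved inside its face,
  and the total degree of the poles is even. Comparing the \<open>m - n + 1\<close> maps that wind once along a
  non-tree edge with the \<open>2 - \<chi>\<close> winding numbers along the sides of the polygon and the degrees of
  the poles gives \<open>m - n + 1 \<le> (2 - \<chi>) + (f - 1)\<close> for \<open>f\<close> faces. The parity of the degree shows that
  the boundary of a face is not a forest, hence contains at least four edges, if \<open>f \<ge> 2\<close>, and that
  no edge borders three faces. So \<open>4 f \<le> 2 m\<close>, and the bound on \<open>m\<close> follows.
\<close>

subsection \<open>Circle-valued maps with poles\<close>

text \<open>The counting inequality is the half n - m + f >= chi of Euler's formula. It stays true
  when faces are not discs, so nothing about the shape of a face has to be known. The parity of the
  degree is the invariant that suits all surfaces at once: carrying a pole around an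
  orientation-reversing loop changes its sign, so only its degree modulo 2 is attached to a face.
  The parity argument needs a second face in which to put the partner of an odd pole, hence the
  restriction to f >= 2. The number four comes from bipartiteness: without odd cycles the shortest
  cycle has four edges, and on a forest every circle-valued map has a real logarithm. With g = 2 -
  chi, substituting f <= m / 2 gives m <= 2 (n + g - 2). If f <= 1, the inequality reads m <= n + g
  - 1, and n >= 3 makes this enough.\<close>

lemma circle_log_contractible:
  fixes f :: "'a::real_normed_vector \<Rightarrow> complex"
  assumes "continuous_on S f" "contractible S" "f ` S \<subseteq> sphere 0 1"
  obtains l :: "'a \<Rightarrow> real" where "continuous_on S l" "\<And>x. x \<in> S \<Longrightarrow> f x = cis (l x)"
proof -
  have nz: "f x \<noteq> 0" if "x \<in> S" for x using assms(3) that by auto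
  obtain g where g: "continuous_on S g" "\<And>x. x \<in> S \<Longrightarrow> f x = exp (g x)"
    using continuous_logarithm_on_contractible[OF assms(1,2) nz] by blast
  show thesis
  proof
    show "continuous_on S (\<lambda>x. Im (g x))" using g(1) by (intro continuous_intros)
    fix x assume x: "x \<in> S"
    have "norm (exp (g x)) = 1" using assms(3) x g(2)[OF x] by auto
    then have "Re (g x) = 0" by simp
    then show "f x = cis (Im (g x))" using g(2)[OF x] by (simp add: exp_eq_polar)
  qed
qed

lemma cis_eq_iff: "cis a = cis b \<longleftrightarrow> (\<exists>k::int. a - b = 2 * pi * k)"
proof -
  have "cis a = cis b \<longleftrightarrow> exp (\<i> * of_real a) = exp (\<i> * of_real b)" by (simp add: cis_conv_exp)
  also have "\<dots> \<longleftrightarrow> (\<exists>k::int. a - b = 2 * pi * k)"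
    unfolding exp_eq by (auto simp: complex_eq_iff algebra_simps)
  finally show ?thesis .
qed

text \<open>The difference takes values in the integer multiples of 2 pi, which are at least 2 pi
  apart, so connectedness makes it constant. Winding numbers, being increments of a logarithm, are
  therefore independent of the logarithm.\<close>

lemma circle_log_diff_constant:
  fixes l l' :: "'a::topological_space \<Rightarrow> real"
  assumes "connected S" "continuous_on S l" "continuous_on S l'"
    and "\<And>x. x \<in> S \<Longrightarrow> cis (l x) = cis (l' x)" and "x \<in> S" "y \<in> S"
  shows "l x - l' x = l y - l' y"
proof -
  let ?h = "\<lambda>x. l x - l' x"
  have "?h constant_on S"
  proof (rule continuous_discrete_range_constant[OF assms(1)])
    show "continuous_on S ?h" by (intro continuous_intros assms)
    fix x assume x: "x \<in> S"
    obtain k :: int where k: "?h x = 2 * pi * k" using assms(4)[OF x] cis_eq_iff by blast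
    show "\<exists>e>0. \<forall>y. y \<in> S \<and> ?h y \<noteq> ?h x \<longrightarrow> e \<le> norm (?h y - ?h x)"
    proof (intro exI[of _ "2*pi"] conjI allI impI)
      fix y assume y: "y \<in> S \<and> ?h y \<noteq> ?h x"
      obtain k' :: int where k': "?h y = 2 * pi * k'" using assms(4) y cis_eq_iff by blast
      have "k \<noteq> k'" using y k k' by auto
      then have "1 \<le> \<bar>real_of_int (k' - k)\<bar>" by linarith
      moreover have "?h y - ?h x = 2 * pi * real_of_int (k' - k)"
        using k k' by (simp add: algebra_simps)
      ultimately show "2*pi \<le> norm (?h y - ?h x)"
        by (simp add: abs_mult)
    qed simp
  qed
  then show ?thesis using assms(5,6) unfolding constant_on_def by auto
qed

text \<open>A continuous map from a compact set to a Hausdorff space is closed, hence a quotient map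
  onto its image; continuity of \<open>k\<close> can be tested upstairs.\<close>

lemma continuous_on_compact_image:
  fixes u :: "'a::t2_space \<Rightarrow> 'b::t2_space" and k :: "'b \<Rightarrow> 'c::topological_space"
  assumes P: "compact P" and u: "continuous_on P u" and k: "continuous_on P (\<lambda>p. k (u p))"
  shows "continuous_on (u ` P) k"
  unfolding continuous_on_closed_invariant
proof (intro allI impI)
  fix B :: "'c set" assume B: "closed B"
  obtain A where A: "closed A" "A \<inter> P = (\<lambda>p. k (u p)) -` B \<inter> P"
    using k B unfolding continuous_on_closed_invariant by meson
  have "compact (A \<inter> P)" using A(1) P by (rule closed_Int_compact)
  then have "compact (u ` (A \<inter> P))"
    using u by (meson compact_continuous_image continuous_on_subset inf_le2)
  moreover have "u ` (A \<inter> P) \<inter> u ` P = k -` B \<inter> u ` P" unfolding A(2) by auto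
  ultimately show "\<exists>A. closed A \<and> A \<inter> u ` P = k -` B \<inter> u ` P"
    using compact_imp_closed by blast
qed

lemma continuous_on_sgn_diff:
  fixes p :: complex
  assumes "p \<notin> S" shows "continuous_on S (\<lambda>z. sgn (z - p))"
  using assms by (intro continuous_intros) auto

lemma continuous_on_powi:
  fixes f :: "'a::topological_space \<Rightarrow> complex"
  assumes "continuous_on S f" "\<And>x. x \<in> S \<Longrightarrow> f x \<noteq> 0"
  shows "continuous_on S (\<lambda>x. f x powi k)"
  using assms by (intro continuous_intros) auto

text \<open>The angular part of the rational function with divisor \<open>d\<close>: the factor of
  \<open>p\<close> winds \<open>d p\<close> times around \<open>p\<close>.\<close>

definition pole_prod :: "(complex \<Rightarrow> int) \<Rightarrow> complex \<Rightarrow> complex" where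
  "pole_prod d z = (\<Prod>p | d p \<noteq> 0. sgn (z - p) powi d p)"

lemma pole_prod_superset:
  assumes "finite P" "{p. d p \<noteq> 0} \<subseteq> P"
  shows "pole_prod d z = (\<Prod>p\<in>P. sgn (z - p) powi d p)"
  unfolding pole_prod_def using assms by (intro prod.mono_neutral_left) auto

lemma norm_pole_prod: "d z = 0 \<Longrightarrow> norm (pole_prod d z) = 1"
  unfolding pole_prod_def prod_norm[symmetric]
  by (rule prod.neutral) (auto simp: norm_power_int norm_sgn)

lemma pole_prod_add:
  assumes "finite {p. d p \<noteq> 0}" "finite {p. d' p \<noteq> 0}" "d z = 0" "d' z = 0"
  shows "pole_prod (\<lambda>p. d p + d' p) z = pole_prod d z * pole_prod d' z"
proof -
  let ?P = "{p. d p \<noteq> 0} \<union> {p. d' p \<noteq> 0}"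
  have "pole_prod (\<lambda>p. d p + d' p) z = (\<Prod>p\<in>?P. sgn (z - p) powi (d p + d' p))"
    using assms by (intro pole_prod_superset) auto
  also have "\<dots> = (\<Prod>p\<in>?P. sgn (z - p) powi d p * sgn (z - p) powi d' p)"
  proof (rule prod.cong)
    fix p assume "p \<in> ?P"
    then have "z \<noteq> p" using assms by auto
    then show "sgn (z - p) powi (d p + d' p) = sgn (z - p) powi d p * sgn (z - p) powi d' p"
      by (subst power_int_add) (auto simp: sgn_zero_iff)
  qed simp
  also have "\<dots> = pole_prod d z * pole_prod d' z"
    using assms by (simp add: prod.distrib pole_prod_superset[of ?P])
  finally show ?thesis .
qed

lemma pole_prod_scale:
  assumes "finite {p. d p \<noteq> 0}"
  shows "pole_prod (\<lambda>p. k * d p) z = pole_prod d z powi k"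
proof -
  have "pole_prod (\<lambda>p. k * d p) z = (\<Prod>p | d p \<noteq> 0. sgn (z - p) powi (k * d p))"
    using assms by (intro pole_prod_superset) auto
  also have "\<dots> = (\<Prod>p | d p \<noteq> 0. (sgn (z - p) powi d p) powi k)"
    by (intro prod.cong refl) (simp add: power_int_mult[symmetric] mult.commute)
  also have "\<dots> = (\<Prod>p | d p \<noteq> 0. sgn (z - p) powi d p) powi k"
    using assms by (induction rule: finite_induct) (auto simp: power_int_mult_distrib)
  finally show ?thesis unfolding pole_prod_def .
qed

lemma continuous_on_pole_prod:
  assumes "\<And>p. d p \<noteq> 0 \<Longrightarrow> p \<notin> S"
  shows "continuous_on S (pole_prod d)"
  unfolding pole_prod_def using assms
  by (intro continuous_on_prod continuous_on_powi continuous_on_sgn_diff) (auto simp: sgn_zero_iff)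

definition point_pole :: "complex \<Rightarrow> complex \<Rightarrow> int" where
  "point_pole p z = (if z = p then 1 else 0)"

lemma pole_prod_point: "pole_prod (point_pole p) z = sgn (z - p)"
  by (simp add: pole_prod_def point_pole_def)

lemma finite_support_point_pole: "finite {z. k * point_pole p z \<noteq> 0}" 
  by (rule finite_subset[of _ "{p}"]) (auto simp: point_pole_def)

definition glued_on :: "(nat \<times> bool) list \<Rightarrow> complex set \<Rightarrow> (complex \<Rightarrow> 'a) \<Rightarrow> bool" where
  "glued_on w S f \<longleftrightarrow> (\<forall>(x, y) \<in> side_gluing w. x \<in> S \<longrightarrow> y \<in> S \<longrightarrow> f x = f y)"

text \<open>Stated for single gluing steps; chains in \<open>(side_gluing w)\<^sup>*\<close> follow
  by induction.\<close>

definition saturated :: "(nat \<times> bool) list \<Rightarrow> complex set \<Rightarrow> bool" where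
  "saturated w S \<longleftrightarrow> (\<forall>(x, y) \<in> side_gluing w. x \<in> S \<longrightarrow> y \<in> S)"

text \<open>\<open>f\<close> represents a circle-valued map on the surface minus the support of the divisor \<open>d\<close>; only
  its values on the boundary of the polygon and on \<open>K\<close> matter. Since \<open>sgn 0 = 0\<close>, \<open>pole_prod d\<close> is
  unimodular only off the support of \<open>d\<close>.\<close>

definition pole_map ::
  "(nat \<times> bool) list \<Rightarrow> complex set \<Rightarrow> (complex \<Rightarrow> int) \<Rightarrow> (complex \<Rightarrow> complex) \<Rightarrow> bool" where
  "pole_map w K d f \<longleftrightarrow>
    finite {p. d p \<noteq> 0} \<and> {p. d p \<noteq> 0} \<subseteq> ball 0 1 - K \<and> glued_on w (sphere 0 1) f \<and>
    (\<exists>c. continuous_on (cball 0 1) c \<and> c ` cball 0 1 \<subseteq> sphere 0 1 \<and>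
      (\<forall>z \<in> sphere 0 1 \<union> K. f z = c z * pole_prod d z))"

lemma pole_mapI:
  assumes "finite {p. d p \<noteq> 0}" "{p. d p \<noteq> 0} \<subseteq> ball 0 1 - K" "glued_on w (sphere 0 1) f"
    "continuous_on (cball 0 1) c" "c ` cball 0 1 \<subseteq> sphere 0 1"
    "\<And>z. z \<in> sphere 0 1 \<union> K \<Longrightarrow> f z = c z * pole_prod d z"
  shows "pole_map w K d f"
  using assms unfolding pole_map_def by blast

lemma pole_mapE:
  assumes "pole_map w K d f"
  obtains c where "finite {p. d p \<noteq> 0}" "\<And>p. d p \<noteq> 0 \<Longrightarrow> p \<in> ball 0 1 \<and> p \<notin> K"
    "glued_on w (sphere 0 1) f"
    "continuous_on (cball 0 1) c" "\<And>z. z \<in> cball 0 1 \<Longrightarrow> norm (c z) = 1"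
    "\<And>z. z \<in> sphere 0 1 \<union> K \<Longrightarrow> f z = c z * pole_prod d z"
  using assms unfolding pole_map_def by (auto simp: subset_iff image_subset_iff)

lemma pole_map_subset: "pole_map w K d f \<Longrightarrow> K' \<subseteq> K \<Longrightarrow> pole_map w K' d f"
  unfolding pole_map_def by blast

lemma pole_map_const_1: "pole_map w K (\<lambda>_. 0) (\<lambda>_. 1)"
  by (rule pole_mapI[where c="\<lambda>_. 1"]) (auto simp: glued_on_def pole_prod_def)

text \<open>Multiplication of maps adds divisors, so trading poles and finding relations between
  maps become integer linear algebra.\<close>

lemma pole_map_mult:
  assumes "pole_map w K d f" "pole_map w K d' f'"
  shows "pole_map w K (\<lambda>p. d p + d' p) (\<lambda>z. f z * f' z)"
proof -
  obtain c where c: "finite {p. d p \<noteq> 0}" "\<And>p. d p \<noteq> 0 \<Longrightarrow> p \<in> ball 0 1 \<and> p \<notin> K"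
    "glued_on w (sphere 0 1) f" "continuous_on (cball 0 1) c"
    "\<And>z. z \<in> cball 0 1 \<Longrightarrow> norm (c z) = 1"
    "\<And>z. z \<in> sphere 0 1 \<union> K \<Longrightarrow> f z = c z * pole_prod d z"
    using assms(1) by (rule pole_mapE) (rule that)
  obtain c' where c': "finite {p. d' p \<noteq> 0}" "\<And>p. d' p \<noteq> 0 \<Longrightarrow> p \<in> ball 0 1 \<and> p \<notin> K"
    "glued_on w (sphere 0 1) f'" "continuous_on (cball 0 1) c'"
    "\<And>z. z \<in> cball 0 1 \<Longrightarrow> norm (c' z) = 1"
    "\<And>z. z \<in> sphere 0 1 \<union> K \<Longrightarrow> f' z = c' z * pole_prod d' z"
    using assms(2) by (rule pole_mapE) (rule that)
  show ?thesis
  proof (rule pole_mapI)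
    show "finite {p. d p + d' p \<noteq> 0}"
      by (rule finite_subset[OF _ finite_UnI[OF c(1) c'(1)]]) auto
    have "p \<in> ball 0 1 - K" if "d p + d' p \<noteq> 0" for p
      using that c(2)[of p] c'(2)[of p] by (cases "d p = 0") auto
    then show "{p. d p + d' p \<noteq> 0} \<subseteq> ball 0 1 - K" by blast
    show "glued_on w (sphere 0 1) (\<lambda>z. f z * f' z)"
      using c(3) c'(3) unfolding glued_on_def by fastforce
    show "continuous_on (cball 0 1) (\<lambda>z. c z * c' z)"
      using c(4) c'(4) by (intro continuous_intros)
    show "(\<lambda>z. c z * c' z) ` cball 0 1 \<subseteq> sphere 0 1"
      using c(5) c'(5) by (auto simp: norm_mult)
    fix z assume z: "z \<in> sphere 0 1 \<union> K"
    have "d z = 0" "d' z = 0" using z c(2)[of z] c'(2)[of z] by force+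
    then show "f z * f' z = c z * c' z * pole_prod (\<lambda>p. d p + d' p) z"
      using c(6)[OF z] c'(6)[OF z] pole_prod_add[OF c(1) c'(1)] by simp
  qed
qed

lemma pole_map_powi:
  assumes "pole_map w K d f"
  shows "pole_map w K (\<lambda>p. k * d p) (\<lambda>z. f z powi k)"
proof -
  obtain c where c: "finite {p. d p \<noteq> 0}" "\<And>p. d p \<noteq> 0 \<Longrightarrow> p \<in> ball 0 1 \<and> p \<notin> K"
    "glued_on w (sphere 0 1) f" "continuous_on (cball 0 1) c"
    "\<And>z. z \<in> cball 0 1 \<Longrightarrow> norm (c z) = 1"
    "\<And>z. z \<in> sphere 0 1 \<union> K \<Longrightarrow> f z = c z * pole_prod d z"
    using assms(1) by (rule pole_mapE) (rule that)
  show ?thesis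
  proof (rule pole_mapI)
    show "finite {p. k * d p \<noteq> 0}" by (rule finite_subset[OF _ c(1)]) auto
    show "{p. k * d p \<noteq> 0} \<subseteq> ball 0 1 - K" using c(2) by auto
    show "glued_on w (sphere 0 1) (\<lambda>z. f z powi k)"
      using c(3) unfolding glued_on_def by fastforce
    show "continuous_on (cball 0 1) (\<lambda>z. c z powi k)"
      using c(4,5) by (intro continuous_on_powi) force+
    show "(\<lambda>z. c z powi k) ` cball 0 1 \<subseteq> sphere 0 1"
      using c(5) by (auto simp: norm_power_int)
    fix z assume z: "z \<in> sphere 0 1 \<union> K"
    show "f z powi k = c z powi k * pole_prod (\<lambda>p. k * d p) z"
      using c(6)[OF z] pole_prod_scale[OF c(1)] by (simp add: power_int_mult_distrib)
  qed
qed

lemma pole_map_prod: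
  assumes "finite J" "\<And>j. j \<in> J \<Longrightarrow> pole_map w K (d j) (f j)"
  shows "pole_map w K (\<lambda>p. \<Sum>j\<in>J. d j p) (\<lambda>z. \<Prod>j\<in>J. f j z)"
  using assms
proof (induction J rule: finite_induct)
  case empty
  then show ?case by (simp add: pole_map_const_1)
next
  case (insert j J)
  then show ?case using pole_map_mult[of w K "d j" "f j"] by simp
qed

lemma pole_map_norm:
  assumes "pole_map w K d f" "K \<subseteq> cball 0 1" "z \<in> sphere 0 1 \<union> K"
  shows "norm (f z) = 1"
proof -
  obtain c where c: "finite {p. d p \<noteq> 0}" "\<And>p. d p \<noteq> 0 \<Longrightarrow> p \<in> ball 0 1 \<and> p \<notin> K"
    "glued_on w (sphere 0 1) f" "continuous_on (cball 0 1) c"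
    "\<And>z. z \<in> cball 0 1 \<Longrightarrow> norm (c z) = 1"
    "\<And>z. z \<in> sphere 0 1 \<union> K \<Longrightarrow> f z = c z * pole_prod d z"
    using assms(1) by (rule pole_mapE) (rule that)
  have "d z = 0" using assms c(2)[of z] by force
  moreover have "z \<in> cball 0 1" using assms by auto
  ultimately show ?thesis using c(5,6) assms(3) norm_pole_prod by (simp add: norm_mult)
qed

lemma pole_map_continuous:
  assumes "pole_map w K d f" "K \<subseteq> cball 0 1"
  shows "continuous_on (sphere 0 1 \<union> K) f"
proof -
  obtain c where c: "finite {p. d p \<noteq> 0}" "\<And>p. d p \<noteq> 0 \<Longrightarrow> p \<in> ball 0 1 \<and> p \<notin> K"
    "glued_on w (sphere 0 1) f" "continuous_on (cball 0 1) c"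
    "\<And>z. z \<in> cball 0 1 \<Longrightarrow> norm (c z) = 1"
    "\<And>z. z \<in> sphere 0 1 \<union> K \<Longrightarrow> f z = c z * pole_prod d z"
    using assms(1) by (rule pole_mapE) (rule that)
  have "continuous_on (sphere 0 1 \<union> K) (\<lambda>z. c z * pole_prod d z)"
  proof (intro continuous_intros continuous_on_pole_prod)
    show "continuous_on (sphere 0 1 \<union> K) c"
      using assms(2) by (intro continuous_on_subset[OF c(4)]) auto
    show "p \<notin> sphere 0 1 \<union> K" if "d p \<noteq> 0" for p using c(2)[OF that] by auto
  qed
  then show ?thesis using c(6) continuous_on_cong by (metis (no_types, lifting))
qed

text \<open>On the unit circle \<open>sgn (z - p) = z * sgn (1 - p / z)\<close>, and \<open>1 - p / z\<close> stays in the right half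
  plane, so the winding number is that of \<open>z\<close>.\<close>

lemma sgn_diff_log_on_circle:
  assumes "norm p < 1"
  obtains l :: "real \<Rightarrow> real" where "continuous_on {0..1} l"
    "\<And>t. t \<in> {0..1} \<Longrightarrow> sgn (cis (2*pi*t) - p) = cis (l t)" "l 1 - l 0 = 2 * pi"
proof
  let ?q = "\<lambda>t. 1 - p * cis (- (2*pi*t))"
  let ?l = "\<lambda>t. 2*pi*t + Im (Ln (?q t))"
  have q: "Re (?q t) > 0" for t
  proof -
    have "Re (p * cis (-(2*pi*t))) \<le> norm (p * cis (-(2*pi*t)))" by (rule complex_Re_le_cmod)
    also have "\<dots> < 1" using assms by (simp add: norm_mult)
    finally show ?thesis by simp
  qed
  then have qn: "?q t \<notin> \<real>\<^sub>\<le>\<^sub>0" for t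
    using complex_nonpos_Reals_iff[of "?q t"] by (metis less_le_not_le)
  have "continuous_on {0..1} (\<lambda>t. Ln (?q t))"
    using qn by (intro continuous_intros continuous_on_Ln' continuous_on_cis) auto
  then show "continuous_on {0..1} ?l"
    by (intro continuous_on_add continuous_on_Im) (auto intro!: continuous_intros)
  show "?l 1 - ?l 0 = 2 * pi" 
  proof -
    have "?q 1 = ?q 0" by (simp add: cis.code)
    then show ?thesis by (simp only:)
  qed
  fix t :: real
  have nz: "?q t \<noteq> 0" using q[of t] by (metis less_irrefl zero_complex.simps(1))
  have "cis (2*pi*t) - p = cis (2*pi*t) * ?q t"
    by (simp add: algebra_simps cis_mult)
  then have "sgn (cis (2*pi*t) - p) = cis (2*pi*t) * sgn (?q t)"
    by (simp add: sgn_mult)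
  also have "sgn (?q t) = cis (Im (Ln (?q t)))"
    using nz by (metis Arg_eq_Im_Ln cis_Arg)
  finally show "sgn (cis (2*pi*t) - p) = cis (?l t)" by (simp add: cis_mult)
qed

lemma cis_sum: "finite P \<Longrightarrow> cis (\<Sum>p\<in>P. h p) = (\<Prod>p\<in>P. cis (h p))"
  by (induction P rule: finite_induct) (auto simp: cis_mult[symmetric])

lemma pole_prod_log_on_circle:
  assumes "finite {p. d p \<noteq> 0}" "\<And>p. d p \<noteq> 0 \<Longrightarrow> norm p < 1"
  obtains l :: "real \<Rightarrow> real" where "continuous_on {0..1} l"
    "\<And>t. t \<in> {0..1} \<Longrightarrow> pole_prod d (cis (2*pi*t)) = cis (l t)"
    "l 1 - l 0 = 2 * pi * (\<Sum>p | d p \<noteq> 0. d p)"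
proof -
  have "\<exists>l. continuous_on {0..1} l \<and> (\<forall>t\<in>{0..1}. sgn (cis (2*pi*t) - p) = cis (l t)) \<and>
        l 1 - l 0 = 2 * pi" if "d p \<noteq> 0" for p
    using sgn_diff_log_on_circle[OF assms(2)[OF that]] by metis
  then obtain l where l: "\<And>p. d p \<noteq> 0 \<Longrightarrow> continuous_on {0..1} (l p)"
    "\<And>p t. d p \<noteq> 0 \<Longrightarrow> t\<in>{0..1} \<Longrightarrow> sgn (cis (2*pi*t) - p) = cis (l p t)"
    "\<And>p. d p \<noteq> 0 \<Longrightarrow> l p 1 - l p 0 = 2 * pi" by metis
  show thesis
  proof
    let ?l = "\<lambda>t. \<Sum>p | d p \<noteq> 0. of_int (d p) * l p t"
    show "continuous_on {0..1} ?l" using l(1) by (intro continuous_intros) auto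
    show "pole_prod d (cis (2*pi*t)) = cis (?l t)" if "t \<in> {0..1}" for t
      unfolding cis_sum[OF assms(1)] pole_prod_def using l(2)[OF _ that]
      by (intro prod.cong) (auto simp: cis_power_int)
    have "?l 1 - ?l 0 = (\<Sum>p | d p \<noteq> 0. of_int (d p) * (l p 1 - l p 0))"
      by (simp add: sum_subtractf algebra_simps)
    also have "\<dots> = (\<Sum>p | d p \<noteq> 0. of_int (d p) * (2 * pi))" using l(3) by (intro sum.cong) auto
    finally show "?l 1 - ?l 0 = 2 * pi * (\<Sum>p | d p \<noteq> 0. d p)"
      by (simp add: sum_distrib_left algebra_simps)
  qed
qed

text \<open>Argument principle: \<open>c\<close> has a logarithm on the whole disc and contributes
  no winding along the boundary, while each pole contributes its degree.\<close>

lemma pole_map_log_on_circle: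
  assumes "pole_map w K d f"
  obtains l :: "real \<Rightarrow> real" where "continuous_on {0..1} l"
    "\<And>t. t \<in> {0..1} \<Longrightarrow> f (cis (2*pi*t)) = cis (l t)"
    "l 1 - l 0 = 2 * pi * (\<Sum>p | d p \<noteq> 0. d p)"
proof -
  obtain c where c: "finite {p. d p \<noteq> 0}" "\<And>p. d p \<noteq> 0 \<Longrightarrow> p \<in> ball 0 1 \<and> p \<notin> K"
    "glued_on w (sphere 0 1) f" "continuous_on (cball 0 1) c"
    "\<And>z. z \<in> cball 0 1 \<Longrightarrow> norm (c z) = 1"
    "\<And>z. z \<in> sphere 0 1 \<union> K \<Longrightarrow> f z = c z * pole_prod d z"
    using assms by (rule pole_mapE) (rule that)
  obtain l where l: "continuous_on {0..1} l"
    "\<And>t. t \<in> {0..1} \<Longrightarrow> pole_prod d (cis (2*pi*t)) = cis (l t)"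
    "l 1 - l 0 = 2 * pi * (\<Sum>p | d p \<noteq> 0. d p)"
    using pole_prod_log_on_circle[of d] c(1,2) by (metis mem_ball_0)
  obtain m where m: "continuous_on (cball 0 1) m" "\<And>z. z \<in> cball 0 1 \<Longrightarrow> c z = cis (m z)"
    using circle_log_contractible[OF c(4) convex_imp_contractible[OF convex_cball]] c(5)
    by (metis image_subsetI mem_sphere_0)
  show thesis
  proof
    let ?l = "\<lambda>t. m (cis (2*pi*t)) + l t"
    have "continuous_on {0..1} (\<lambda>t. m (cis (2*pi*t)))"
      by (rule continuous_on_compose2[OF m(1)]) (auto intro!: continuous_intros continuous_on_cis)
    then show "continuous_on {0..1} ?l" using l(1) by (intro continuous_intros)
    show "f (cis (2*pi*t)) = cis (?l t)" if "t \<in> {0..1}" for t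
      using l(2)[OF that] m(2)[of "cis (2*pi*t)"] c(6)[of "cis (2*pi*t)"] by (simp add: cis_mult)
    show "?l 1 - ?l 0 = 2 * pi * (\<Sum>p | d p \<noteq> 0. d p)" using l(3) by (simp add: cis.code)
  qed
qed

section \<open>Trading one pole for another\<close>

lemma real_Tietze_closed:
  fixes l :: "complex \<Rightarrow> real"
  assumes "closed S" "continuous_on S l"
  obtains g :: "complex \<Rightarrow> real" where "continuous_on UNIV g" "\<And>z. z \<in> S \<Longrightarrow> g z = l z"
  using Tietze_unbounded[of S l UNIV] assms by auto

text \<open>The quotient (z - p) / (z - p') is a nonpositive real only on the segment from
  \<open>p\<close> to \<open>p'\<close>, so the principal logarithm is continuous off it. Its
  imaginary part is extended to the plane so that it can enter the pole-free factor of a pole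
  map.\<close>

lemma sgn_quotient_log_off_segment:
  fixes p p' :: complex
  assumes "closed S" "S \<inter> closed_segment p p' = {}"
  obtains l :: "complex \<Rightarrow> real" where "continuous_on UNIV l"
    "\<And>z. z \<in> S \<Longrightarrow> sgn (z - p) = cis (l z) * sgn (z - p')"
proof -
  let ?q = "\<lambda>z. (z - p) / (z - p')"
  have ne: "z \<noteq> p" "z \<noteq> p'" if "z \<in> S" for z using assms that by auto
  have q: "?q z \<notin> \<real>\<^sub>\<le>\<^sub>0" if z: "z \<in> S" for z
  proof
    assume "?q z \<in> \<real>\<^sub>\<le>\<^sub>0"
    then obtain t' where t': "?q z = of_real t'" "t' \<le> 0" by (elim nonpos_Reals_cases)
    define t where "t = - t'"
    have t: "?q z = - of_real t" "t \<ge> 0" using t' by (auto simp: t_def)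
    have "z - p = - of_real t * (z - p')" using t(1) ne[OF z] by (simp add: field_simps)
    then have "z * of_real (1 + t) = p + of_real t * p'" by (simp add: algebra_simps)
    moreover have "1 + t \<noteq> 0" using t(2) by simp
    then have nz: "of_real (1 + t) \<noteq> (0::complex)" using of_real_eq_0_iff by blast
    ultimately have "z = (p + of_real t * p') / of_real (1 + t)"
      using nonzero_mult_div_cancel_right[OF nz, of z] by simp
    moreover have "1 - t / (1 + t) = 1 / (1 + t)" using t(2) by (simp add: field_simps)
    ultimately have "z = (1 - t / (1 + t)) *\<^sub>R p + (t / (1 + t)) *\<^sub>R p'"
      by (simp add: scaleR_conv_of_real add_divide_distrib)
    moreover have "0 \<le> t / (1 + t)" "t / (1 + t) \<le> 1" using t(2) by auto
    ultimately have "z \<in> closed_segment p p'" unfolding in_segment by blast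
    then show False using assms z by blast
  qed
  have "continuous_on S (\<lambda>z. Ln (?q z))"
    using q ne by (intro continuous_intros continuous_on_Ln') auto
  then have "continuous_on S (\<lambda>z. Im (Ln (?q z)))" by (rule continuous_on_Im)
  then obtain l where l: "continuous_on UNIV l" "\<And>z. z \<in> S \<Longrightarrow> l z = Im (Ln (?q z))"
    using real_Tietze_closed[OF assms(1)] by blast
  show thesis
  proof
    fix z assume z: "z \<in> S"
    have nz: "?q z \<noteq> 0" using ne[OF z] by simp
    have "cis (l z) = sgn (?q z)" using nz l(2)[OF z] by (metis Arg_eq_Im_Ln cis_Arg)
    also have "\<dots> = sgn (z - p) / sgn (z - p')" by (simp add: sgn_divide)
    finally show "sgn (z - p) = cis (l z) * sgn (z - p')"
      using ne[OF z] by (simp add: sgn_zero_iff)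
  qed (rule l)
qed

text \<open>A pole at \<open>p\<close> can be traded for a pole at \<open>q\<close> without changing the map on \<open>K\<close>. The sign is
  not determined because \<open>q\<close> may be reached along an orientation-reversing path.\<close>

definition linked :: "(nat \<times> bool) list \<Rightarrow> complex set \<Rightarrow> complex \<Rightarrow> complex \<Rightarrow> bool" where
  "linked w K p q \<longleftrightarrow> p \<in> ball 0 1 - K \<and> q \<in> ball 0 1 - K \<and>
    (\<exists>e f. (e = 1 \<or> e = -1) \<and> pole_map w K (\<lambda>z. point_pole p z + e * point_pole q z) f \<and>
      (\<forall>z\<in>K. f z = 1))"

lemma linked_refl: "p \<in> ball 0 1 - K \<Longrightarrow> linked w K p p"
  \<comment> \<open>With \<open>e = -1\<close> the two poles cancel and the constant 1
    serves.\<close>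
  unfolding linked_def using pole_map_const_1[of w K]
  by (auto intro!: exI[of _ "-1::int"] exI[of _ "\<lambda>_. 1::complex"])

lemma linked_sym:
  assumes "linked w K p q" shows "linked w K q p"
proof -
  obtain e f where ef: "e = 1 \<or> e = -1" "pole_map w K (\<lambda>z. point_pole p z + e * point_pole q z) f"
    "\<forall>z\<in>K. f z = 1" using assms unfolding linked_def by blast
  \<comment> \<open>Since \<open>e * e = 1\<close>, the power \<open>e\<close> of the map exchanges
    the two coefficients.\<close>
  have "(\<lambda>z. e * (point_pole p z + e * point_pole q z)) = (\<lambda>z. point_pole q z + e * point_pole p z)"
    using ef(1) by auto
  then have "pole_map w K (\<lambda>z. point_pole q z + e * point_pole p z) (\<lambda>z. f z powi e)"
    using pole_map_powi[OF ef(2), of e] by simp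
  moreover have "\<forall>z\<in>K. f z powi e = 1" using ef(3) by simp
  ultimately show ?thesis using assms ef(1) unfolding linked_def by blast
qed

lemma linked_trans:
  assumes "linked w K p q" "linked w K q r" shows "linked w K p r"
proof -
  obtain e f where ef: "e = 1 \<or> e = -1" "pole_map w K (\<lambda>z. point_pole p z + e * point_pole q z) f"
    "\<forall>z\<in>K. f z = 1" using assms(1) unfolding linked_def by blast
  obtain e' f' where ef': "e' = 1 \<or> e' = -1"
    "pole_map w K (\<lambda>z. point_pole q z + e' * point_pole r z) f'"
    "\<forall>z\<in>K. f' z = 1" using assms(2) unfolding linked_def by blast
  \<comment> \<open>The exponent \<open>- e\<close> is chosen to cancel the pole at
    \<open>q\<close>.\<close>
  have "(\<lambda>z. (point_pole p z + e * point_pole q z) + (-e) * (point_pole q z + e' * point_pole r z))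
    = (\<lambda>z. point_pole p z + (-e*e') * point_pole r z)"
    by (auto simp: algebra_simps)
  then have "pole_map w K (\<lambda>z. point_pole p z + (-e*e') * point_pole r z) (\<lambda>z. f z * f' z powi (-e))"
    using pole_map_mult[OF ef(2) pole_map_powi[OF ef'(2), of "-e"]] by simp
  moreover have "\<forall>z\<in>K. f z * f' z powi (-e) = 1" using ef(3) ef'(3) by simp
  moreover have "-e*e' = 1 \<or> -e*e' = -1" using ef(1) ef'(1) by auto
  ultimately show ?thesis using assms unfolding linked_def by blast
qed

lemma linked_mono: "linked w K p q \<Longrightarrow> K' \<subseteq> K \<Longrightarrow> linked w K' p q"
  unfolding linked_def using pole_map_subset[of w K _ _ K'] by blast

lemma pole_prod_two:
  assumes "z \<noteq> p" "z \<noteq> q"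
  shows "pole_prod (\<lambda>z. point_pole p z + e * point_pole q z) z = sgn (z - p) * sgn (z - q) powi e"
proof -
  have "finite {z. point_pole p z \<noteq> 0}" using finite_support_point_pole[of 1 p] by simp
  then show ?thesis
    using assms pole_prod_add[of "point_pole p" "\<lambda>z. e * point_pole q z" z]
      finite_support_point_pole pole_prod_scale[of "point_pole q" e z]
      finite_support_point_pole[of 1 q]
    by (simp add: pole_prod_point point_pole_def)
qed

text \<open>The segment from \<open>p\<close> to \<open>q\<close> stays in \<open>N\<close>, away
  from \<open>K\<close> and from the boundary circle, so the quotient of the two pole factors has a
  logarithm on both. Dividing by it leaves the constant map 1, whose gluing is trivial.\<close>

lemma linked_convex:
  assumes "open N" "convex N" "N \<subseteq> ball 0 1 - K" "p \<in> N" "q \<in> N" "K \<subseteq> cball 0 1"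
  shows "linked w K p q"
proof -
  have seg: "closed_segment p q \<subseteq> N" using assms by (simp add: closed_segment_subset)
  obtain l where l: "continuous_on UNIV l"
    "\<And>z. z \<in> -N \<Longrightarrow> sgn (z - p) = cis (l z) * sgn (z - q)"
    using sgn_quotient_log_off_segment[of "-N" p q] assms(1) seg by blast
  have "pole_map w K (\<lambda>z. point_pole p z + (-1) * point_pole q z) (\<lambda>_. 1)"
  proof (rule pole_mapI)
    show "finite {z. point_pole p z + - 1 * point_pole q z \<noteq> 0}"
      by (rule finite_subset[of _ "{p,q}"]) (auto simp: point_pole_def)
    show "{z. point_pole p z + - 1 * point_pole q z \<noteq> 0} \<subseteq> ball 0 1 - K"
      using assms by (auto simp: point_pole_def split: if_splits)
    show "glued_on w (sphere 0 1) (\<lambda>_. 1::complex)" by (simp add: glued_on_def)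
    show "continuous_on (cball 0 1) (\<lambda>z. cis (- l z))"
      using continuous_on_subset[OF l(1)] by (intro continuous_intros continuous_on_cis) auto
    show "(\<lambda>z. cis (- l z)) ` cball 0 1 \<subseteq> sphere 0 1" by auto
    fix z assume z: "z \<in> sphere 0 1 \<union> K"
    then have zN: "z \<in> -N" using assms(3) by force
    have ne: "z \<noteq> p" "z \<noteq> q" using zN assms by auto
    have "cis (- l z) * (sgn (z - p) * sgn (z - q) powi (-1)) = 1"
      using l(2)[OF zN] ne by (simp add: sgn_zero_iff power_int_minus cis_mult mult.assoc[symmetric])
    then show "1 = cis (- l z) * pole_prod (\<lambda>z. point_pole p z + - 1 * point_pole q z) z"
      unfolding pole_prod_two[OF ne] by simp
  qed
  then show ?thesis using assms unfolding linked_def by (auto intro!: exI[of _ "-1::int"])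
qed

subsection \<open>Moving poles across sides\<close>

lemma norm_side_point [simp]: "norm (side_point L i s) = 1"
  by (simp add: side_point_def)

lemma continuous_on_side_point: "continuous_on S (side_point L i)"
  unfolding side_point_def divide_inverse by (intro continuous_intros continuous_on_cis)

lemma compact_side: "compact (side_point L i ` {0..1})"
  by (intro compact_continuous_image continuous_on_side_point) auto

lemma sphere_eq_side_point:
  assumes "norm z = 1" "L > 0"
  obtains i s where "i < L" "0 \<le> s" "s \<le> 1" "z = side_point L i s"
proof -
  define t where "t = Arg2pi z / (2*pi) * L"
  have A: "0 \<le> Arg2pi z" "Arg2pi z < 2 * pi" using Arg2pi_ge_0 Arg2pi_lt_2pi by auto
  then have t: "0 \<le> t" "t < L" using assms(2) by (auto simp: t_def field_simps)
  show thesis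
  proof
    have "nat \<lfloor>t\<rfloor> < L" using t by linarith
    then show "nat \<lfloor>t\<rfloor> < L" .
    show "0 \<le> t - real (nat \<lfloor>t\<rfloor>)" "t - real (nat \<lfloor>t\<rfloor>) \<le> 1" using t by linarith+
    have "z = exp (\<i> * of_real (Arg2pi z))" using Arg2pi_eq[of z] assms(1) by simp
    then have "z = cis (Arg2pi z)" by (simp add: cis_conv_exp)
    moreover have "2 * pi * t / L = Arg2pi z" using assms(2) by (simp add: t_def)
    ultimately show "z = side_point L (nat \<lfloor>t\<rfloor>) (t - real (nat \<lfloor>t\<rfloor>))"
      by (simp add: side_point_def)
  qed
qed

text \<open>The parameters \<open>i + s\<close> and \<open>j + t\<close> lie between 0 and
  \<open>L\<close> and differ by a multiple of \<open>L\<close>; hence they agree or are the two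
  ends of the range. Only corners have several descriptions.\<close>

lemma side_point_eqD:
  assumes "side_point L i s = side_point L j t" "i < L" "j < L" "0 \<le> s" "s \<le> 1" "0 \<le> t" "t \<le> 1"
  shows "(i = j \<and> s = t) \<or> (s \<in> {0,1} \<and> t \<in> {0,1})"
proof -
  obtain k :: int where k: "2 * pi * (real i + s) / real L - 2 * pi * (real j + t) / real L = 2 * pi * k"
    using assms(1) unfolding side_point_def cis_eq_iff by blast
  have L: "real L > 0" using assms by simp
  have "2 * pi * ((real i + s) - (real j + t)) / L = 2 * pi * k"
    unfolding k[symmetric] by (simp add: diff_divide_distrib right_diff_distrib)
  then have "2 * pi * ((real i + s) - (real j + t)) = 2 * pi * (k * L)"
    using L by (simp add: divide_eq_eq)
  then have e: "(real i + s) - (real j + t) = real_of_int k * real L" by simp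
  have "Suc i \<le> L" "Suc j \<le> L" using assms by auto
  then have b: "real i \<le> real L - 1" "real j \<le> real L - 1" by linarith+
  then have "\<bar>real_of_int k * L\<bar> \<le> L" using e assms by linarith
  then have "\<bar>real_of_int k\<bar> \<le> 1" using L by (simp add: abs_mult)
  then consider "k = 0" | "k = 1" | "k = -1" by linarith
  then show ?thesis
  proof cases
    case 1
    then have e': "real_of_int (int i - int j) = t - s" using e by simp
    then have "\<bar>int i - int j\<bar> \<le> 1" using assms by linarith
    then consider "int i - int j = 0" | "int i - int j = 1" | "int i - int j = -1" by linarith
    then show ?thesis using e' assms by cases auto
  next
    case 2
    then have "s = 1 \<and> t = 0" using e b assms by simp
    then show ?thesis by simp
  next
    case 3
    then have "t = 1 \<and> s = 0" using e b assms by simp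
    then show ?thesis by simp
  qed
qed

lemma side_point_notin_other_side:
  assumes "i < L" "0 < s" "s < 1"
  shows "side_point L i s \<notin> (\<Union>k\<in>{..<L} - {i}. side_point L k ` {0..1})"
proof
  assume "side_point L i s \<in> (\<Union>k\<in>{..<L} - {i}. side_point L k ` {0..1})"
  then obtain k t where "k \<in> {..<L} - {i}" "t \<in> {0..1}" "side_point L i s = side_point L k t"
    by blast
  then show False using side_point_eqD[of L i s k t] assms by auto
qed

lemma side_gluing_on_sphere: "(x, y) \<in> side_gluing w \<Longrightarrow> norm x = 1 \<and> norm y = 1"
  unfolding side_gluing_def by auto

text \<open>Sides of equal direction correspond under a rotation and sides of opposite direction
  under a reflection; the angle of \<open>a\<close> is found by comparing the arguments of the two
  side points.\<close>

lemma side_isometry: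
  obtains a :: complex and A :: "complex \<Rightarrow> complex" where "norm a = 1"
    "(\<forall>z. A z = a * z) \<or> (\<forall>z. A z = a * cnj z)"
    "\<And>s. A (side_point L j (if b then s else 1 - s)) = side_point L i s"
proof (cases b)
  case True
  let ?a = "cis (2 * pi * (real i - real j) / L)"
  show ?thesis
  proof (rule that[of ?a "\<lambda>z. ?a * z"])
    show "?a * side_point L j (if b then s else 1 - s) = side_point L i s" for s
      using True by (simp add: side_point_def cis_mult add_divide_distrib[symmetric] algebra_simps)
  qed auto
next
  case False
  let ?a = "cis (2 * pi * (real i + real j + 1) / L)"
  show ?thesis
  proof (rule that[of ?a "\<lambda>z. ?a * cnj z"])
    show "?a * cnj (side_point L j (if b then s else 1 - s)) = side_point L i s" for s
      using False
      by (simp add: side_point_def cis_cnj cis_mult diff_divide_distrib[symmetric] algebra_simps)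
  qed auto
qed

lemma interior_parameter_near:
  assumes "0 \<le> s" "s \<le> (1::real)" "0 < d"
  obtains s' where "0 < s'" "s' < 1" "\<bar>s' - s\<bar> < d"
proof -
  let ?e = "min d 1 / 4"
  have "?e > 0" "?e < d" "?e \<le> 1/4" using assms by auto
  then consider "s \<le> 1/2" | "s > 1/2" by linarith
  then show thesis
  proof cases
    case 1
    then show thesis using that[of "s + ?e"] assms \<open>?e > 0\<close> \<open>?e < d\<close> \<open>?e \<le> 1/4\<close> by simp
  next
    case 2
    then show thesis using that[of "s - ?e"] assms \<open>?e > 0\<close> \<open>?e < d\<close> \<open>?e \<le> 1/4\<close> by simp
  qed
qed

text \<open>Glued sides correspond under an isometry of the disc, so the pole can be carried across a
  side by multiplying a bump supported near one side by its transport to the partner side.\<close>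

lemma linked_across_side:
  assumes two: "\<And>i j k. \<lbrakk>i < length w; j < length w; k < length w; i \<noteq> j;
      fst (w ! i) = fst (w ! j); fst (w ! k) = fst (w ! i)\<rbrakk> \<Longrightarrow> k = i \<or> k = j"
    and K: "closed K" "K \<subseteq> cball 0 1"
    and xy: "(x, y) \<in> side_gluing w" "x \<notin> K" "y \<notin> K" and r: "r > 0"
  obtains p q where "p \<in> ball x r \<inter> ball 0 1" "q \<in> ball y r \<inter> ball 0 1" "linked w K p q"
proof -
  let ?L = "length w"
  obtain i j s where ij: "i < ?L" "j < ?L" "fst (w ! i) = fst (w ! j)" "0 \<le> s" "s \<le> 1"
    and x: "x = side_point ?L i s"
    and y: "y = side_point ?L j (if snd (w ! i) = snd (w ! j) then s else 1 - s)"
    using xy(1) unfolding side_gluing_def by auto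
  let ?t = "\<lambda>s. if snd (w ! i) = snd (w ! j) then s else 1 - s"
  have nx: "norm x = 1" and ny: "norm y = 1" using x y by auto
  show thesis
  proof (cases "i = j")
    \<comment> \<open>A side paired with itself gives \<open>x = y\<close>, so nothing has to be
      crossed.\<close>
    case True
    then have eq: "x = y" using x y by simp
    have "open (ball x r \<inter> - K)" "x \<in> ball x r \<inter> - K" using K xy r by auto
    then obtain e where e: "e > 0" "ball x e \<subseteq> ball x r \<inter> - K" by (meson openE)
    define m where "m = min e 1 / 2"
    have m: "0 < m" "m < e" "m < 1" using e by (auto simp: m_def)
    define p where "p = (1 - m) *\<^sub>R x"
    have "dist x p = m" using m nx by (simp add: p_def dist_norm algebra_simps)
    then have "p \<in> ball x e" using m by simp
    moreover have "norm p < 1" using m nx by (simp add: p_def)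
    ultimately have "p \<in> ball x r \<inter> ball 0 1" "p \<notin> K" using e by auto
    then show thesis using that[of p p] linked_refl[of p K w] eq by simp
  next
    case False
    have "isCont (side_point ?L i) s"
      using continuous_on_side_point[of UNIV] continuous_on_eq_continuous_at by blast
    moreover have "continuous_on UNIV (\<lambda>s. side_point ?L j (?t s))"
      by (rule continuous_on_compose2[OF continuous_on_side_point[of UNIV]])
        (cases "snd (w ! i) = snd (w ! j)"; auto intro!: continuous_intros)+
    then have "isCont (\<lambda>s. side_point ?L j (?t s)) s"
      using continuous_on_eq_continuous_at by blast
    ultimately have "\<forall>e>0. \<exists>d>0. \<forall>s'. \<bar>s' - s\<bar> < d \<longrightarrow> dist (side_point ?L i s') x < e"
      "\<forall>e>0. \<exists>d>0. \<forall>s'. \<bar>s' - s\<bar> < d \<longrightarrow> dist (side_point ?L j (?t s')) y < e"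
      unfolding continuous_at_eps_delta x y by (auto simp: dist_real_def)
    moreover have "open (ball x r \<inter> - K)" "x \<in> ball x r \<inter> - K" using K xy r by auto
    then obtain e1 where e1: "e1 > 0" "ball x e1 \<subseteq> ball x r \<inter> - K" by (meson openE)
    moreover have "open (ball y r \<inter> - K)" "y \<in> ball y r \<inter> - K" using K xy r by auto
    then obtain e2 where e2: "e2 > 0" "ball y e2 \<subseteq> ball y r \<inter> - K" by (meson openE)
    ultimately obtain d1 d2 where d: "d1 > 0" "d2 > 0"
      "\<And>s'. \<bar>s' - s\<bar> < d1 \<Longrightarrow> dist (side_point ?L i s') x < e1"
      "\<And>s'. \<bar>s' - s\<bar> < d2 \<Longrightarrow> dist (side_point ?L j (?t s')) y < e2" by metis
    \<comment> \<open>Moving off the ends of the side makes \<open>X\<close> and \<open>Y\<close>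
      interior points of their sides, so small balls about them avoid all other sides.\<close>
    obtain s' where s': "0 < s'" "s' < 1" "\<bar>s' - s\<bar> < min d1 d2"
      using interior_parameter_near[of s "min d1 d2"] ij d by auto
    define X where "X = side_point ?L i s'"
    define Y where "Y = side_point ?L j (?t s')"
    have nX: "norm X = 1" and nY: "norm Y = 1" by (auto simp: X_def Y_def)
    let ?arc = "\<lambda>k. side_point ?L k ` {0..1}"
    define others where "others = (\<lambda>i. \<Union>k\<in>{..<?L} - {i}. ?arc k)"
    have cl: "closed (others i)" for i unfolding others_def using compact_side by (intro closed_UN compact_imp_closed) auto
    have "X \<notin> others i"
      unfolding X_def others_def using s' ij by (intro side_point_notin_other_side)
    moreover have "Y \<notin> others j"
      unfolding Y_def others_def using s' ij by (intro side_point_notin_other_side) auto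
    moreover have "X \<in> ball x e1" "Y \<in> ball y e2" using d s' by (auto simp: X_def Y_def dist_commute)
    moreover have "open (ball x e1 \<inter> - others i)" "open (ball y e2 \<inter> - others j)"
      using cl by (intro open_Int open_ball open_Compl; blast)+
    ultimately have "open (ball x e1 \<inter> - others i)" "X \<in> ball x e1 \<inter> - others i"
      "open (ball y e2 \<inter> - others j)" "Y \<in> ball y e2 \<inter> - others j"
      by blast+
    then obtain r1 r2 where r12: "r1 > 0" "ball X r1 \<subseteq> ball x e1 \<inter> - others i"
      "r2 > 0" "ball Y r2 \<subseteq> ball y e2 \<inter> - others j" by (meson openE)
    define u where "u = min r1 r2"
    have u: "u > 0" "ball X u \<subseteq> ball x e1 \<inter> - others i" "ball Y u \<subseteq> ball y e2 \<inter> - others j"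
      using r12 by (auto simp: u_def)
    define m where "m = min u 1 / 2"
    have m: "0 < m" "m < u" "m < 1" using u by (auto simp: m_def)
    obtain a A where a: "norm a = 1" and A: "(\<forall>z. A z = a * z) \<or> (\<forall>z. A z = a * cnj z)"
      and Aside: "\<And>s. A (side_point ?L j (?t s)) = side_point ?L i s"
      using side_isometry[of ?L j "snd (w ! i) = snd (w ! j)" i] by blast
    have AY: "A Y = X" unfolding X_def Y_def by (rule Aside)
    have normA: "norm (A z) = norm z" for z using A a by (auto simp: norm_mult)
    have diffA: "A z - A z' = A (z - z')" for z z' using A by (auto simp: algebra_simps)
    have scaleA: "A (c *\<^sub>R z) = c *\<^sub>R A z" for c z using A by (auto simp: scaleR_conv_of_real)
    have contA: "continuous_on S A" for S
    proof -
      have "A = (\<lambda>z. a * z) \<or> A = (\<lambda>z. a * cnj z)" using A by auto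
      then show ?thesis by (auto intro!: continuous_intros)
    qed
    have distA: "dist (A z) (A z') = dist z z'" for z z' by (simp add: dist_norm diffA normA)
    have ballA: "A z \<in> ball X u \<longleftrightarrow> z \<in> ball Y u" for z
      using distA[of Y z] by (simp add: AY)
    define p where "p = (1 - m) *\<^sub>R X"
    define p' where "p' = (1 + m) *\<^sub>R X"
    define q where "q = (1 - m) *\<^sub>R Y"
    have Aq: "A q = p" by (simp add: q_def p_def scaleA AY)
    have np: "norm p < 1" "norm q < 1" "norm p' > 1" using m nX nY by (auto simp: p_def q_def p'_def)
    have "dist X p = m" "dist X p' = m" "dist Y q = m"
      using m nX nY by (simp_all add: p_def p'_def q_def dist_norm algebra_simps)
    then have pin: "p \<in> ball X u" "p' \<in> ball X u" "q \<in> ball Y u" using m by auto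
    have offK: "ball X u \<inter> K = {}" "ball Y u \<inter> K = {}" "ball X u \<subseteq> ball x r" "ball Y u \<subseteq> ball y r"
      using u e1 e2 by blast+
    then have pK: "p \<notin> K" "q \<notin> K" "p \<in> ball x r" "q \<in> ball y r" using pin by blast+
    have "closed_segment p p' \<subseteq> ball X u" using pin by (simp add: closed_segment_subset)
    then obtain l where l: "continuous_on UNIV l"
      "\<And>z. z \<in> - ball X u \<Longrightarrow> sgn (z - p) = cis (l z) * sgn (z - p')"
      using sgn_quotient_log_off_segment[of "- ball X u" p p'] by blast
    \<comment> \<open>\<open>p'\<close> is the counterpart of \<open>p\<close> just outside the
      disc, so \<open>c0\<close> is free of poles on the disc. The bump \<open>g\<close> has a
      single pole, at \<open>p\<close>, and equals 1 on the disc outside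
      \<open>ball X u\<close>.\<close>
    define c0 where "c0 = (\<lambda>z. cis (- l z) * inverse (sgn (z - p')))"
    define g where "g = (\<lambda>z. c0 z * sgn (z - p))"
    have c0cont: "continuous_on (cball 0 1) c0"
    proof -
      have "continuous_on (cball 0 1) (\<lambda>z. cis (- l z))"
        using continuous_on_subset[OF l(1)] by (intro continuous_intros continuous_on_cis) auto
      moreover have "continuous_on (cball 0 1) (\<lambda>z. sgn (z - p'))"
        using np by (intro continuous_on_sgn_diff) simp
      moreover have "\<forall>z\<in>cball 0 1. sgn (z - p') \<noteq> 0" using np by (auto simp: sgn_zero_iff)
      ultimately show ?thesis
        unfolding c0_def by (intro continuous_on_mult continuous_on_inverse)
    qed
    have c0norm: "norm (c0 z) = 1" if "z \<in> cball 0 1" for z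
      using that np by (auto simp: c0_def norm_mult norm_inverse norm_sgn)
    have g1: "g z = 1" if "z \<in> cball 0 1" "z \<notin> ball X u" for z
    proof -
      have "z \<noteq> p'" using that np by auto
      moreover have "sgn (z - p) = cis (l z) * sgn (z - p')" using l(2) that by simp
      moreover have "g z = (cis (- l z) * cis (l z)) * (inverse (sgn (z - p')) * sgn (z - p'))"
        using calculation unfolding g_def c0_def by simp
      ultimately show ?thesis by (simp add: sgn_zero_iff cis_mult)
    qed
    \<comment> \<open>\<open>e\<close> records whether \<open>A\<close> preserves orientation: a
      reflection inverts the angular factor and so reverses the sign of the transported
      pole.\<close>
    obtain e where e: "e = 1 \<or> e = -1" and eA: "\<And>z. sgn (A z) = a * sgn z powi e"
    proof -
      have sa: "sgn a = a" using a by (simp add: sgn_eq)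
      show thesis
      proof (cases "\<forall>z. A z = a * z")
        case True
        then show thesis using that[of 1] sa by (simp add: sgn_mult)
      next
        case False
        have "sgn (cnj z) = inverse (sgn z)" for z
        proof (cases "z = 0")
          case nz: False
          have "sgn (cnj z) * sgn z = (z * cnj z) / (of_real (norm z))\<^sup>2"
            by (simp add: sgn_eq power2_eq_square)
          also have "\<dots> = 1" using nz complex_norm_square[of z, symmetric] by simp
          finally show ?thesis using nz by (simp add: field_simps sgn_zero_iff)
        qed simp
        then show thesis using that[of "-1"] sa A False by (simp add: sgn_mult power_int_minus)
      qed
    qed
    \<comment> \<open>On side \<open>i\<close> the second factor is 1, on side \<open>j\<close> the
      first one, and the isometry \<open>A\<close> matches the remaining factors. On every other
      side both are 1.\<close>
    define f where "f = (\<lambda>z. g z * g (A z))"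
    have gside: "g z = 1" if "z \<in> ?arc k" "k < ?L" "k \<noteq> i" for z k
    proof -
      have "z \<in> others i" using that unfolding others_def by blast
      then have "z \<notin> ball X u" using u(2) by blast
      moreover have "z \<in> cball 0 1" using that by auto
      ultimately show ?thesis using g1 by blast
    qed
    have gAside: "g (A z) = 1" if "z \<in> ?arc k" "k < ?L" "k \<noteq> j" for z k
    proof -
      have "z \<in> others j" using that unfolding others_def by blast
      then have "z \<notin> ball Y u" using u(3) by blast
      moreover have "norm z = 1" using that by auto
      ultimately show ?thesis using g1[of "A z"] ballA[of z] normA[of z] by simp
    qed
    have "pole_map w K (\<lambda>z. point_pole p z + e * point_pole q z) f"
    proof (rule pole_mapI)
      show "finite {z. point_pole p z + e * point_pole q z \<noteq> 0}"
        by (rule finite_subset[of _ "{p,q}"]) (auto simp: point_pole_def)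
      show "{z. point_pole p z + e * point_pole q z \<noteq> 0} \<subseteq> ball 0 1 - K"
        using np pK by (auto simp: point_pole_def split: if_splits)
      show "glued_on w (sphere 0 1) f"
        unfolding glued_on_def
      proof (clarify)
        fix z z' assume zz: "(z, z') \<in> side_gluing w"
        then obtain k k' v where kk: "k < ?L" "k' < ?L" "fst (w ! k) = fst (w ! k')" "0 \<le> v" "v \<le> 1"
          and z: "z = side_point ?L k v"
          and z': "z' = side_point ?L k' (if snd (w ! k) = snd (w ! k') then v else 1 - v)"
          unfolding side_gluing_def by auto
        have arcs: "z \<in> ?arc k" "z' \<in> ?arc k'" using kk z z' by auto
        have key: "f (side_point ?L i v) = f (side_point ?L j (?t v))" if "0 \<le> v" "v \<le> 1" for v
        proof -
          have "side_point ?L i v \<in> ?arc i" "side_point ?L j (?t v) \<in> ?arc j" using that by auto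
          then show ?thesis using gside[of _ j] gAside[of _ i] False ij
            by (simp add: f_def Aside)
        qed
        show "f z = f z'"
        proof (cases "k = k'")
          case True then show ?thesis using z z' by simp
        next
          case ne: False
          show ?thesis
          proof (cases "k = i")
            case True
            then have "fst (w ! k') = fst (w ! i)" using kk(3) by simp
            then have "k' = j" using two[OF ij(1,2) kk(2) False ij(3)] ne True by blast
            then show ?thesis using True z z' key[of v] kk by simp
          next
            case ki: False
            show ?thesis
            proof (cases "k = j")
              case True
              then have "fst (w ! k') = fst (w ! i)" using kk(3) ij(3) by simp
              then have k': "k' = i" using two[OF ij(1,2) kk(2) False ij(3)] ne True by blast
              define v' where "v' = ?t v"
              have v': "0 \<le> v'" "v' \<le> 1" "v = ?t v'" using kk(4,5) by (auto simp: v'_def)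
              have "z = side_point ?L j (?t v')" unfolding z True v'(3)[symmetric] ..
              moreover have "z' = side_point ?L i v'"
                unfolding z' k' True v'_def by (cases "snd (w ! i) = snd (w ! j)") auto
              ultimately show ?thesis using key[OF v'(1,2)] by (simp only:)
            next
              case kj: False
              have "fst (w ! k) \<noteq> fst (w ! i)"
                using two[OF ij(1,2) kk(1) False ij(3)] ki kj by blast
              then have "k' \<noteq> i" "k' \<noteq> j" using kk(3) ij(3) by auto
              then show ?thesis
                using gside[OF arcs(1)] gside[OF arcs(2)] gAside[OF arcs(1)] gAside[OF arcs(2)]
                  kk ki kj by (simp add: f_def)
            qed
          qed
        qed
      qed
      show "continuous_on (cball 0 1) (\<lambda>z. c0 z * c0 (A z) * a)"
      proof (intro continuous_intros c0cont)
        show "continuous_on (cball 0 1) (\<lambda>x. c0 (A x))"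
          by (rule continuous_on_compose2[OF c0cont contA]) (auto simp: normA)
      qed
      show "(\<lambda>z. c0 z * c0 (A z) * a) ` cball 0 1 \<subseteq> sphere 0 1"
        using c0norm normA a by (auto simp: norm_mult)
      fix z assume z: "z \<in> sphere 0 1 \<union> K"
      have ne: "z \<noteq> p" "z \<noteq> q" using z np pK by auto
      have "sgn (A z - p) = a * sgn (z - q) powi e"
        using eA[of "z - q"] diffA[of z q] Aq by simp
      then show "f z = c0 z * c0 (A z) * a * pole_prod (\<lambda>z. point_pole p z + e * point_pole q z) z"
        unfolding pole_prod_two[OF ne] f_def g_def by (simp add: algebra_simps)
    qed
    moreover have "f z = 1" if "z \<in> K" for z
    proof -
      have "z \<notin> ball X u" "z \<notin> ball Y u" using that offK by blast+
      then show ?thesis using g1[of z] g1[of "A z"] ballA[of z] normA[of z] K that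
        by (auto simp: f_def)
    qed
    moreover have "p \<in> ball x r \<inter> ball 0 1" "q \<in> ball y r \<inter> ball 0 1" "p \<notin> K" "q \<notin> K"
      using pK np by auto
    ultimately show thesis using that[of p q] e unfolding linked_def by blast
  qed
qed

text \<open>A region is the preimage of an open and closed subset of the surface minus the image of \<open>K\<close>.
  The faces are defined as the classes of \<open>linked\<close>, which avoids connectedness arguments on the
  quotient space.\<close>

definition region :: "(nat \<times> bool) list \<Rightarrow> complex set \<Rightarrow> complex set \<Rightarrow> bool" where
  "region w K V \<longleftrightarrow> V \<subseteq> cball 0 1 - K \<and> openin (top_of_set (cball 0 1)) V \<and>
    closure V \<subseteq> V \<union> K \<and> saturated w V"

definition face :: "(nat \<times> bool) list \<Rightarrow> complex set \<Rightarrow> complex \<Rightarrow> complex set" where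
  "face w K p = {z \<in> cball 0 1 - K. \<exists>r>0. \<forall>q \<in> ball z r \<inter> ball 0 1. linked w K p q}"

lemma ball_near_cball_point:
  fixes z :: complex
  assumes "z \<in> cball 0 1" "r > 0"
  obtains q where "q \<in> ball z r \<inter> ball 0 1"
proof -
  define m where "m = min r 1 / 2"
  have m: "0 < m" "m < r" "m < 1" using assms by (auto simp: m_def)
  have z: "norm z \<le> 1" using assms by simp
  have "dist z ((1 - m) *\<^sub>R z) = m * norm z" using m by (simp add: dist_norm algebra_simps)
  also have "\<dots> < r" using z m mult_left_le[of "norm z" m] by linarith
  finally have "dist z ((1 - m) *\<^sub>R z) < r" .
  moreover have "norm ((1 - m) *\<^sub>R z) < 1"
  proof -
    have "norm ((1 - m) *\<^sub>R z) = (1 - m) * norm z" using m by simp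
    also have "\<dots> \<le> (1 - m) * 1" using z m by (intro mult_left_mono) auto
    also have "\<dots> < 1" using m by simp
    finally show ?thesis .
  qed
  ultimately show thesis using that[of "(1 - m) *\<^sub>R z"] by simp
qed

section \<open>Faces as regions, and cutting off a map outside a region\<close>

locale disc_closed_set =
  fixes w :: "(nat \<times> bool) list" and K :: "complex set"
  assumes two: "\<And>i j k. \<lbrakk>i < length w; j < length w; k < length w; i \<noteq> j;
      fst (w ! i) = fst (w ! j); fst (w ! k) = fst (w ! i)\<rbrakk> \<Longrightarrow> k = i \<or> k = j"
    and closed_K: "closed K" and K_subset: "K \<subseteq> cball 0 1" and K_saturated: "saturated w K"
begin

lemma near_linked:
  assumes "z \<in> cball 0 1 - K"
  obtains r where "r > 0" "ball z r \<inter> K = {}"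
    "\<And>q q'. q \<in> ball z r \<inter> ball 0 1 \<Longrightarrow> q' \<in> ball z r \<inter> ball 0 1 \<Longrightarrow> linked w K q q'"
proof -
  have "open (- K)" "z \<in> - K" using closed_K assms by auto
  then obtain r where r: "r > 0" "ball z r \<subseteq> - K" by (meson openE)
  show thesis
  proof
    fix q q' assume q: "q \<in> ball z r \<inter> ball 0 1" "q' \<in> ball z r \<inter> ball 0 1"
    show "linked w K q q'"
      by (rule linked_convex[of "ball z r \<inter> ball 0 1"]) (use q r K_subset in \<open>auto intro: convex_Int\<close>)
  qed (use r in auto)
qed

text \<open>One interior point linked to \<open>p\<close> suffices near \<open>z\<close>, since the
  interior points near \<open>z\<close> are linked to each other.\<close>

lemma face_mem:
  assumes "z \<in> cball 0 1" "r > 0" "ball z r \<inter> K = {}"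
    "\<And>q q'. q \<in> ball z r \<inter> ball 0 1 \<Longrightarrow> q' \<in> ball z r \<inter> ball 0 1 \<Longrightarrow> linked w K q q'"
    "q \<in> ball z r \<inter> ball 0 1" "linked w K p q"
  shows "z \<in> face w K p"
proof -
  have "z \<notin> K" using assms(2,3) centre_in_ball by blast
  moreover have "linked w K p q'" if "q' \<in> ball z r \<inter> ball 0 1" for q'
    using assms(4)[OF assms(5) that] assms(6) linked_trans by blast
  ultimately show ?thesis using assms(1,2) unfolding face_def by blast
qed

lemma face_ball: "q \<in> ball 0 1 \<Longrightarrow> q \<in> face w K p \<longleftrightarrow> linked w K p q"
proof
  assume "q \<in> ball 0 1" "q \<in> face w K p"
  then obtain r where "r > 0" "\<forall>q' \<in> ball q r \<inter> ball 0 1. linked w K p q'"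
    unfolding face_def by auto
  then show "linked w K p q" using \<open>q \<in> ball 0 1\<close> by auto
next
  assume q: "q \<in> ball 0 1" and l: "linked w K p q"
  then have "q \<in> cball 0 1 - K" unfolding linked_def by auto
  then obtain r where "r > 0" "ball q r \<inter> K = {}"
    "\<And>q1 q'. q1 \<in> ball q r \<inter> ball 0 1 \<Longrightarrow> q' \<in> ball q r \<inter> ball 0 1 \<Longrightarrow> linked w K q1 q'"
    using near_linked by blast
  then show "q \<in> face w K p" using face_mem[of q r q p] q l by auto
qed

text \<open>Every point of the disc off \<open>K\<close> has a neighbourhood whose interior points
  are mutually linked; this gives that the face is open, and closed off \<open>K\<close>. Saturation
  comes from carrying a pole across a side.\<close>

lemma region_face: "region w K (face w K p)"
  unfolding region_def
proof (intro conjI)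
  show sub: "face w K p \<subseteq> cball 0 1 - K" unfolding face_def by auto
  show "openin (top_of_set (cball 0 1)) (face w K p)"
    unfolding openin_contains_ball
  proof (intro conjI ballI)
    fix z assume z: "z \<in> face w K p"
    then obtain r where r: "r > 0" "ball z r \<inter> K = {}"
      "\<And>q q'. q \<in> ball z r \<inter> ball 0 1 \<Longrightarrow> q' \<in> ball z r \<inter> ball 0 1 \<Longrightarrow> linked w K q q'"
      using near_linked sub by blast
    obtain r' where r': "r' > 0" "\<forall>q \<in> ball z r' \<inter> ball 0 1. linked w K p q"
      using z unfolding face_def by blast
    show "\<exists>e>0. ball z e \<inter> cball 0 1 \<subseteq> face w K p"
    proof (intro exI[of _ "min r r' / 2"] conjI subsetI)
      fix y assume y: "y \<in> ball z (min r r' / 2) \<inter> cball 0 1"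
      have "ball y (min r r' / 2) \<subseteq> ball z (min r r')"
      proof
        fix v assume "v \<in> ball y (min r r' / 2)"
        then have "dist z v < min r r' / 2 + min r r' / 2"
          using y dist_triangle[of z v y] by auto
        then show "v \<in> ball z (min r r')" by simp
      qed
      then have "ball y (min r r' / 2) \<subseteq> ball z r'" "ball y (min r r' / 2) \<subseteq> ball z r" by auto
      moreover have "min r r' / 2 > 0" using r(1) r'(1) by simp
      moreover have "y \<in> ball z r" using y r(1) r'(1) by auto
      then have "y \<notin> K" using r(2) by blast
      ultimately show "y \<in> face w K p" using r'(2) y unfolding face_def by blast
    qed (use r r' in auto)
  qed (use sub in auto)
  show "closure (face w K p) \<subseteq> face w K p \<union> K"
  proof
    fix z assume z: "z \<in> closure (face w K p)"
    have "closure (face w K p) \<subseteq> cball 0 1" using sub by (intro closure_minimal) auto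
    then have zD: "z \<in> cball 0 1" using z by blast
    show "z \<in> face w K p \<union> K"
    proof (cases "z \<in> K")
      case False
      then obtain r where r: "r > 0" "ball z r \<inter> K = {}"
        "\<And>q q'. q \<in> ball z r \<inter> ball 0 1 \<Longrightarrow> q' \<in> ball z r \<inter> ball 0 1 \<Longrightarrow> linked w K q q'"
        using near_linked zD by blast
      obtain y where y: "y \<in> face w K p" "dist y z < r"
        using z r(1) unfolding closure_approachable by blast
      obtain r' where r': "r' > 0" "\<forall>q \<in> ball y r' \<inter> ball 0 1. linked w K p q"
        using y(1) unfolding face_def by blast
      obtain q where q: "q \<in> ball y (min r' (r - dist y z)) \<inter> ball 0 1"
      proof (rule ball_near_cball_point)
        show "y \<in> cball 0 1" using y sub by blast
        show "min r' (r - dist y z) > 0" using y r' by simp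
      qed
      have "dist z q < r" using q dist_triangle[of z q y] by (auto simp: dist_commute)
      then have "z \<in> face w K p" using q r r'(2) zD by (intro face_mem[of z r q p]) auto
      then show ?thesis by blast
    qed simp
  qed
  show "saturated w (face w K p)"
    unfolding saturated_def
  proof clarify
    fix x y assume xy: "(x, y) \<in> side_gluing w" and x: "x \<in> face w K p"
    have "(y, x) \<in> side_gluing w" using sym_side_gluing xy by (metis symD)
    then have nK: "x \<notin> K" "y \<notin> K" using x sub K_saturated unfolding saturated_def by blast+
    have D: "y \<in> cball 0 1" using side_gluing_on_sphere[OF xy] by auto
    obtain r where r: "r > 0" "\<forall>q \<in> ball x r \<inter> ball 0 1. linked w K p q"
      using x unfolding face_def by blast
    obtain r' where r': "r' > 0" "ball y r' \<inter> K = {}"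
      "\<And>q q'. q \<in> ball y r' \<inter> ball 0 1 \<Longrightarrow> q' \<in> ball y r' \<inter> ball 0 1 \<Longrightarrow> linked w K q q'"
      using near_linked D nK by blast
    obtain a b where ab: "a \<in> ball x (min r r') \<inter> ball 0 1" "b \<in> ball y (min r r') \<inter> ball 0 1"
      "linked w K a b"
    proof (rule linked_across_side[OF two closed_K K_subset xy nK, of "min r r'"])
      show "min r r' > 0" using r(1) r'(1) by simp
    qed
    moreover have "linked w K p a" using r(2) ab(1) by auto
    ultimately have "linked w K p b" using linked_trans by blast
    then show "y \<in> face w K p" using ab r' D by (intro face_mem[of y r' b p]) auto
  qed
qed

end

text \<open>The frontier of \<open>V\<close> lies in \<open>K\<close>, where \<open>f\<close> is 1,
  so \<open>f\<close> may be replaced by 1 outside \<open>V\<close> without a jump. Only the poles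
  in \<open>V\<close> survive, and the new map is indifferent to changes of \<open>K\<close> outside
  \<open>V\<close>.\<close>

lemma pole_map_localize:
  assumes f: "pole_map w K d f" and f1: "\<And>z. z \<in> K \<Longrightarrow> f z = 1"
    and V: "region w K V" and K: "closed K" "K \<subseteq> cball 0 1" and K': "K' \<inter> V = {}"
  shows "pole_map w K' (\<lambda>p. if p \<in> V then d p else 0) (\<lambda>z. if z \<in> V then f z else 1)"
proof -
  obtain c where c: "finite {p. d p \<noteq> 0}" "\<And>p. d p \<noteq> 0 \<Longrightarrow> p \<in> ball 0 1 \<and> p \<notin> K"
    "glued_on w (sphere 0 1) f" "continuous_on (cball 0 1) c"
    "\<And>z. z \<in> cball 0 1 \<Longrightarrow> norm (c z) = 1"
    "\<And>z. z \<in> sphere 0 1 \<union> K \<Longrightarrow> f z = c z * pole_prod d z"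
    using f by (rule pole_mapE) (rule that)
  have V': "V \<subseteq> cball 0 1 - K" "openin (top_of_set (cball 0 1)) V" "closure V \<subseteq> V \<union> K"
    "saturated w V" using V unfolding region_def by auto
  let ?d1 = "\<lambda>p. if p \<in> V then d p else 0"
  let ?d2 = "\<lambda>p. if p \<in> V then 0 else d p"
  have fin: "finite {p. ?d1 p \<noteq> 0}" "finite {p. ?d2 p \<noteq> 0}"
    by (rule finite_subset[OF _ c(1)]; auto)+
  have split: "pole_prod d z = pole_prod ?d1 z * pole_prod ?d2 z" if "d z = 0" for z
  proof -
    have "(\<lambda>p. ?d1 p + ?d2 p) = d" by auto
    then show ?thesis using pole_prod_add[OF fin, of z] that by auto
  qed
  have nz1: "pole_prod ?d1 z \<noteq> 0" if "?d1 z = 0" for z using norm_pole_prod[of ?d1 z] that by force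
  have clV: "closed (V \<union> K)"
  proof -
    have "closure (V \<union> K) \<subseteq> V \<union> K" using V'(3) K(1) by (auto simp: closure_Un)
    then show ?thesis using closure_subset_eq by blast
  qed
  have clD: "closed (cball 0 1 - V)"
    using V'(2) closedin_closed_trans[of "cball 0 1" "cball 0 1 - V"]
    by (metis closed_cball closedin_diff closedin_self)
  \<comment> \<open>\<open>h\<close> is the new map divided by the factor of the surviving poles.
    Inside \<open>V\<close> the poles outside \<open>V\<close> are absorbed into it; the two
    formulas agree on \<open>K\<close> because \<open>f\<close> is 1 there.\<close>
  define h where "h = (\<lambda>z. if z \<in> V then c z * pole_prod ?d2 z else inverse (pole_prod ?d1 z))"
  have hK: "c z * pole_prod ?d2 z = inverse (pole_prod ?d1 z)" if "z \<in> K" for z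
  proof -
    have dz: "d z = 0" using c(2)[of z] that by auto
    have "c z * (pole_prod ?d1 z * pole_prod ?d2 z) = 1"
      using f1[OF that] c(6)[of z] that split[OF dz] by simp
    then show ?thesis using nz1[of z] dz by (simp add: field_simps)
  qed
  have "continuous_on ((V \<union> K) \<union> (cball 0 1 - V)) h"
    unfolding h_def
  proof (rule continuous_on_cases)
    show "continuous_on (V \<union> K) (\<lambda>z. c z * pole_prod ?d2 z)"
    proof (intro continuous_intros continuous_on_pole_prod)
      show "continuous_on (V \<union> K) c"
        using V'(1) K by (intro continuous_on_subset[OF c(4)]) auto
    qed (use c(2) in \<open>auto split: if_splits\<close>)
    show "continuous_on (cball 0 1 - V) (\<lambda>z. inverse (pole_prod ?d1 z))"
    proof (intro continuous_intros continuous_on_pole_prod)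
      show "\<forall>x\<in>cball 0 1 - V. pole_prod ?d1 x \<noteq> 0" using nz1 by auto
    qed (auto split: if_splits)
  qed (use clV clD hK in auto)
  moreover have "(V \<union> K) \<union> (cball 0 1 - V) = cball 0 1" using V'(1) K by auto
  ultimately have hcont: "continuous_on (cball 0 1) h" by simp
  show ?thesis
  proof (rule pole_mapI[OF fin(1) _ _ hcont])
    show "{p. ?d1 p \<noteq> 0} \<subseteq> ball 0 1 - K'" using c(2) K' by auto
    show "glued_on w (sphere 0 1) (\<lambda>z. if z \<in> V then f z else 1)"
      unfolding glued_on_def
    proof clarify
      fix x y assume xy: "(x, y) \<in> side_gluing w"
      then have "(y, x) \<in> side_gluing w" using sym_side_gluing by (metis symD)
      then have "x \<in> V \<longleftrightarrow> y \<in> V" using xy V'(4) unfolding saturated_def by blast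
      moreover have "f x = f y" using c(3) xy side_gluing_on_sphere[OF xy] unfolding glued_on_def by auto
      ultimately show "(if x \<in> V then f x else 1) = (if y \<in> V then f y else 1)" by auto
    qed
    show "h ` cball 0 1 \<subseteq> sphere 0 1"
    proof clarify
      fix z :: complex assume z: "z \<in> cball 0 1"
      show "h z \<in> sphere 0 1"
        using c(5)[OF z] norm_pole_prod[of ?d1 z] norm_pole_prod[of ?d2 z]
        by (auto simp: h_def norm_mult norm_inverse)
    qed
    fix z assume z: "z \<in> sphere 0 1 \<union> K'"
    show "(if z \<in> V then f z else 1) = h z * pole_prod ?d1 z"
    proof (cases "z \<in> V")
      case True
      then have zs: "z \<in> sphere 0 1" using z K' by blast
      then have "d z = 0" using c(2)[of z] by force
      then show ?thesis using True c(6)[of z] zs split[of z] by (simp add: h_def)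
    next
      case False
      then show ?thesis using nz1[of z] by (simp add: h_def)
    qed
  qed
qed

subsection \<open>Extension of glued maps\<close>

text \<open>There is no obstruction, as the interval has smaller dimension than the disc whose
  frontier is the target circle.\<close>

lemma circle_valued_extension_interval:
  fixes g :: "real \<Rightarrow> complex"
  assumes "closed C" "C \<subseteq> {0..1}" "continuous_on C g" "g ` C \<subseteq> sphere 0 1"
  shows "\<exists>g'. continuous_on {0..1} g' \<and> g' ` {0..1} \<subseteq> sphere 0 1 \<and> (\<forall>s\<in>C. g' s = g s)"
proof -
  have "polytope {0..1::real}" using polytope_interval[of "0::real" 1] by (simp add: cbox_interval)
  moreover have "aff_dim {0..1::real} < aff_dim (cball (0::complex) 1)"
    using aff_dim_le_DIM[of "{0..1::real}"] by (simp add: aff_dim_cball)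
  ultimately obtain g' where "continuous_on (\<Union>{{0..1}}) g'" "g' \<in> \<Union>{{0..1}} \<rightarrow> rel_frontier (cball 0 1)"
    "\<And>x. x \<in> C \<Longrightarrow> g' x = g x"
    using assms extend_map_cell_complex_to_sphere[of "{{0..1::real}}" C "cball (0::complex) 1" g]
    by (auto simp: face_of_refl image_subset_iff_funcset)
  then show ?thesis by (auto simp: Pi_iff)
qed

lemma real_valued_extension_interval:
  fixes g :: "real \<Rightarrow> real"
  assumes "closed C" "C \<subseteq> {0..1}" "continuous_on C g"
  shows "\<exists>g'. continuous_on {0..1} g' \<and> g' ` {0..1} \<subseteq> UNIV \<and> (\<forall>s\<in>C. g' s = g s)"
proof -
  have "closedin (top_of_set {0..1}) C" using assms closed_subset by blast
  then obtain g' where "continuous_on {0..1} g'" "\<And>x. x \<in> C \<Longrightarrow> g' x = g x"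
    using Tietze_unbounded[OF assms(3)] by blast
  then show ?thesis by auto
qed

lemma sphere_ex_side_point:
  "norm z = 1 \<Longrightarrow> L > 0 \<Longrightarrow> \<exists>i s. i < L \<and> 0 \<le> s \<and> s \<le> 1 \<and> z = side_point L i s"
  by (elim sphere_eq_side_point) auto

definition corners :: "nat \<Rightarrow> complex set" where
  "corners L = (\<lambda>(i, s). side_point L i s) ` ({..<L} \<times> {0, 1})"

lemma corners_saturated:
  assumes xy: "(x, y) \<in> side_gluing w" and "x \<in> corners (length w)"
  shows "y \<in> corners (length w)"
proof -
  obtain i j s where ij: "i < length w" "j < length w" "0 \<le> s" "s \<le> 1" "x = side_point (length w) i s"
    "y = side_point (length w) j (if snd (w ! i) = snd (w ! j) then s else 1 - s)"
    using xy unfolding side_gluing_def by auto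
  obtain k t where kt: "k < length w" "t \<in> {0,1}" "x = side_point (length w) k t"
    using assms(2) unfolding corners_def by auto
  have "s \<in> {0,1}" using side_point_eqD[of "length w" i s k t] ij kt by auto
  then have "(if snd (w ! i) = snd (w ! j) then s else 1 - s) \<in> {0,1}" by auto
  then show ?thesis using ij(2,6) unfolding corners_def by blast
qed

text \<open>The map is extended over one side of each letter and copied to the partner sides. The
  target \<open>T\<close> is kept abstract so that the construction serves both the circle and the
  real line.\<close>

lemma glued_extension_to_circle:
  fixes f :: "complex \<Rightarrow> 'a::t2_space"
  assumes K: "closed K" "saturated w K" and L: "w \<noteq> []"
    and f: "continuous_on K f" "f ` K \<subseteq> T" "glued_on w K f" and t0: "t0 \<in> T"
    and ext: "\<And>C (g :: real \<Rightarrow> 'a). \<lbrakk>closed C; C \<subseteq> {0..1}; continuous_on C g; g ` C \<subseteq> T\<rbrakk> \<Longrightarrow>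
      \<exists>g'. continuous_on {0..1} g' \<and> g' ` {0..1} \<subseteq> T \<and> (\<forall>s\<in>C. g' s = g s)"
  obtains f' where "continuous_on (sphere 0 1 \<union> K) f'" "f' ` (sphere 0 1 \<union> K) \<subseteq> T"
    "\<And>z. z \<in> K \<Longrightarrow> f' z = f z" "glued_on w (sphere 0 1) f'"
proof -
  let ?L = "length w"
  have L0: "?L > 0" using L by simp
  define Q where "Q = corners ?L"
  have finQ: "finite Q" unfolding Q_def corners_def by auto
  \<comment> \<open>Corners are settled first, because gluing may identify many of them: those
    outside \<open>K\<close> all receive the same value \<open>t0\<close>.\<close>
  define K0 where "K0 = K \<union> Q"
  define f0 where "f0 = (\<lambda>z. if z \<in> K then f z else t0)"
  have clK0: "closed K0" using K(1) finQ by (simp add: K0_def finite_imp_closed closed_Un)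
  have sat0: "saturated w K0" using K(2) corners_saturated unfolding saturated_def K0_def Q_def by blast
  have "continuous_on (K \<union> (Q - K)) f0" unfolding f0_def
  proof (rule continuous_on_cases)
    show "closed (Q - K)" using finQ by (simp add: finite_imp_closed)
  qed (use K f in auto)
  then have cont0: "continuous_on K0 f0" by (simp add: K0_def)
  have im0: "f0 ` K0 \<subseteq> T" using f(2) t0 by (auto simp: f0_def)
  have glue0: "f0 x = f0 y" if xy: "(x, y) \<in> side_gluing w" for x y
  proof -
    have "(y, x) \<in> side_gluing w" using xy sym_side_gluing by (metis symD)
    then have "x \<in> K \<longleftrightarrow> y \<in> K" using xy K(2) unfolding saturated_def by blast
    then show ?thesis using f(3) xy unfolding glued_on_def f0_def by auto
  qed
  define C where "C = (\<lambda>k. {0..1} \<inter> side_point ?L k -` K0)"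
  have clC: "closed (C k)" for k
    unfolding C_def by (rule continuous_closed_preimage) (auto intro: continuous_on_side_point clK0)
  have "\<exists>g'. continuous_on {0..1} g' \<and> g' ` {0..1} \<subseteq> T \<and> (\<forall>s\<in>C k. g' s = f0 (side_point ?L k s))" for k
  proof (rule ext[OF clC])
    show "C k \<subseteq> {0..1}" unfolding C_def by auto
    show "continuous_on (C k) (\<lambda>s. f0 (side_point ?L k s))"
      by (rule continuous_on_compose2[OF cont0 continuous_on_side_point]) (auto simp: C_def)
    show "(\<lambda>s. f0 (side_point ?L k s)) ` C k \<subseteq> T" using im0 by (auto simp: C_def)
  qed
  then obtain G where G: "\<And>k. continuous_on {0..1} (G k)" "\<And>k s. s \<in> {0..1} \<Longrightarrow> G k s \<in> T"
    "\<And>k s. s \<in> C k \<Longrightarrow> G k s = f0 (side_point ?L k s)"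
    by (metis image_subset_iff)
  \<comment> \<open>The first side with a given letter is the one on which the extension is chosen;
    \<open>tau\<close> translates parameters to it.\<close>
  define rep where "rep = (\<lambda>i. LEAST k. fst (w ! k) = fst (w ! i))"
  have rep_le: "rep i \<le> i" for i unfolding rep_def by (rule Least_le) simp
  have rep_fst: "fst (w ! rep i) = fst (w ! i)" for i
    unfolding rep_def by (rule LeastI[of "\<lambda>k. fst (w ! k) = fst (w ! i)" i]) simp
  define tau where "tau = (\<lambda>i s. if snd (w ! i) = snd (w ! rep i) then s else 1 - (s::real))"
  define h where "h = (\<lambda>i s. G (rep i) (tau i s))"
  have tau01: "tau i s \<in> {0..1}" if "s \<in> {0..1}" for i s using that by (auto simp: tau_def)
  have hcont: "continuous_on {0..1} (h i)" for i
  proof -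
    have "continuous_on {0..1} (tau i)"
      unfolding tau_def by (cases "snd (w ! i) = snd (w ! rep i)") (auto intro!: continuous_intros)
    then show ?thesis unfolding h_def
      by (rule continuous_on_compose2[OF G(1)]) (use tau01 in auto)
  qed
  have h0: "h i s = f0 (side_point ?L i s)"
    if "i < ?L" "s \<in> {0..1}" "side_point ?L i s \<in> K0" for i s
  proof -
    have g: "(side_point ?L i s, side_point ?L (rep i) (tau i s)) \<in> side_gluing w"
      using that rep_le[of i] rep_fst[of i] unfolding side_gluing_def tau_def by fastforce
    then have "tau i s \<in> C (rep i)"
      using that tau01 sat0 unfolding C_def saturated_def by auto
    then show ?thesis using G(3) glue0[OF g] unfolding h_def by simp
  qed
  \<comment> \<open>The choice is harmless: a point with several parameters is a corner, hence in
    \<open>K0\<close>.\<close>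
  define f' where "f' = (\<lambda>z. if z \<in> K0 then f0 z else
    (let is = SOME is. fst is < ?L \<and> snd is \<in> {0..1} \<and> z = side_point ?L (fst is) (snd is)
      in h (fst is) (snd is)))"
  have f'side: "f' (side_point ?L i s) = h i s" if i: "i < ?L" "s \<in> {0..1}" for i s
  proof (cases "side_point ?L i s \<in> K0")
    case True
    then show ?thesis using h0 i by (simp add: f'_def)
  next
    case False
    let ?P = "\<lambda>is. fst is < ?L \<and> snd is \<in> {0..1} \<and> side_point ?L i s = side_point ?L (fst is) (snd is)"
    define js where "js = (SOME is. ?P is)"
    have js: "?P js" unfolding js_def by (rule someI[of ?P "(i, s)"]) (use i in auto)
    have "s \<notin> {0,1}"
    proof
      assume "s \<in> {0,1}"
      then have "side_point ?L i s \<in> Q" using i unfolding Q_def corners_def by blast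
      then show False using False by (simp add: K0_def)
    qed
    then have "i = fst js \<and> s = snd js"
      using side_point_eqD[of ?L i s "fst js" "snd js"] js i by auto
    then show ?thesis using False unfolding f'_def js_def[symmetric] by (simp add: Let_def)
  qed
  have sph: "sphere 0 1 = (\<Union>i\<in>{..<?L}. side_point ?L i ` {0..1})"
  proof (intro equalityI subsetI)
    fix z :: complex assume "z \<in> sphere 0 1"
    then have "norm z = 1" by simp
    then obtain i s where "i < ?L" "0 \<le> s" "s \<le> 1" "z = side_point ?L i s"
      using sphere_ex_side_point[OF _ L0, of z] by auto
    then have "i \<in> {..<?L}" "z \<in> side_point ?L i ` {0..1}" by auto
    then show "z \<in> (\<Union>i\<in>{..<?L}. side_point ?L i ` {0..1})" by blast
  qed auto
  have "continuous_on (side_point ?L i ` {0..1}) f'" if "i < ?L" for i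
  proof (rule continuous_on_compact_image)
    have "continuous_on {0..1} (\<lambda>p. f' (side_point ?L i p)) \<longleftrightarrow> continuous_on {0..1} (h i)"
      by (rule continuous_on_cong) (use f'side that in auto)
    then show "continuous_on {0..1} (\<lambda>p. f' (side_point ?L i p))" using hcont by blast
  qed (auto intro: continuous_on_side_point)
  then have "continuous_on (sphere 0 1) f'"
    unfolding sph using compact_side compact_imp_closed by (intro continuous_on_closed_Union) auto
  moreover have "continuous_on K f' \<longleftrightarrow> continuous_on K f"
    by (rule continuous_on_cong) (auto simp: f'_def K0_def f0_def)
  ultimately have 1: "continuous_on (sphere 0 1 \<union> K) f'"
    using f(1) K(1) by (intro continuous_on_closed_Un) auto
  have 2: "f' z = f z" if "z \<in> K" for z using that by (simp add: f'_def K0_def f0_def)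
  have 3: "f' ` (sphere 0 1 \<union> K) \<subseteq> T"
  proof clarify
    fix z assume z: "z \<in> sphere 0 1 \<union> K"
    show "f' z \<in> T"
    proof (cases "z \<in> K")
      case True then show ?thesis using 2 f(2) by auto
    next
      case False
      then have "norm z = 1" using z by auto
      then obtain i s where i_s: "i < ?L" "0 \<le> s" "s \<le> 1" "z = side_point ?L i s"
        using sphere_ex_side_point[OF _ L0, of z] by auto
      then have "f' z = G (rep i) (tau i s)" using f'side[of i s] by (simp add: h_def)
      moreover have "tau i s \<in> {0..1}" using tau01 i_s by simp
      ultimately show ?thesis using G(2) by simp
    qed
  qed
  have 4: "glued_on w (sphere 0 1) f'"
    unfolding glued_on_def
  proof clarify
    fix x y assume xy: "(x, y) \<in> side_gluing w"
    obtain i j s where ij: "i < ?L" "j < ?L" "fst (w ! i) = fst (w ! j)" "0 \<le> s" "s \<le> 1"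
      "x = side_point ?L i s"
      "y = side_point ?L j (if snd (w ! i) = snd (w ! j) then s else 1 - s)"
      using xy unfolding side_gluing_def by auto
    have rep: "rep i = rep j" using ij(3) unfolding rep_def by simp
    let ?t = "if snd (w ! i) = snd (w ! j) then s else 1 - s"
    have "tau i s = tau j ?t" unfolding tau_def rep by (cases "snd (w ! i)"; cases "snd (w ! j)"; auto)
    then have "h i s = h j ?t" unfolding h_def rep by simp
    then show "f' x = f' y" using f'side[of i s] f'side[of j ?t] ij by auto
  qed
  show thesis using that[OF 1 3 2 4] by blast
qed

lemma glued_real_extension:
  fixes l :: "complex \<Rightarrow> real"
  assumes "closed K" "saturated w K" "w \<noteq> []" "continuous_on K l" "glued_on w K l"
  obtains m :: "complex \<Rightarrow> real" where "continuous_on UNIV m" "\<And>z. z \<in> K \<Longrightarrow> m z = l z"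
    "glued_on w (sphere 0 1) m"
proof -
  obtain l' where l': "continuous_on (sphere 0 1 \<union> K) l'" 
    "\<And>z. z \<in> K \<Longrightarrow> l' z = l z" "glued_on w (sphere 0 1) l'"
  proof (rule glued_extension_to_circle[of K w l UNIV 0])
    show "\<exists>g'. continuous_on {0..1} g' \<and> g' ` {0..1} \<subseteq> UNIV \<and> (\<forall>s\<in>C. g' s = g s)"
      if "closed C" "C \<subseteq> {0..1}" "continuous_on C g" "g ` C \<subseteq> UNIV" for C and g :: "real \<Rightarrow> real"
      using real_valued_extension_interval that by blast
  qed (use assms in auto)
  obtain m where m: "continuous_on UNIV m" "\<And>z. z \<in> sphere 0 1 \<union> K \<Longrightarrow> m z = l' z"
    using real_Tietze_closed[OF _ l'(1)] assms(1) by (metis closed_Un closed_sphere)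
  have "glued_on w (sphere 0 1) m" using l'(3) m(2) unfolding glued_on_def by auto
  then show thesis using that[of m] m l'(2) by auto
qed

text \<open>If \<open>g\<close> winds \<open>d\<close> times around a small circle about
  \<open>p\<close>, then dividing by the \<open>d\<close>-th power of the angular factor leaves a
  map with a logarithm on that circle, which extends over the small disc.\<close>

lemma remove_puncture:
  fixes g :: "complex \<Rightarrow> complex"
  assumes P: "finite P" "p \<notin> P" "p \<in> ball 0 1" "r > 0"
    and g: "continuous_on (cball 0 1 - insert p P) g" "g ` (cball 0 1 - insert p P) \<subseteq> sphere 0 1"
  obtains d :: int and g' where "continuous_on (cball 0 1 - P) g'" "g' ` (cball 0 1 - P) \<subseteq> sphere 0 1"
    "\<And>z. z \<in> cball 0 1 - P \<Longrightarrow> z \<notin> ball p r \<Longrightarrow> g z = g' z * sgn (z - p) powi d"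
proof -
  have "open (ball 0 1 \<inter> ball p r \<inter> - P)" "p \<in> ball 0 1 \<inter> ball p r \<inter> - P"
    using P by (auto simp: finite_imp_closed intro!: open_Int)
  then obtain e where e: "e > 0" "ball p e \<subseteq> ball 0 1 \<inter> ball p r \<inter> - P" by (meson openE)
  define q where "q = e / 2"
  have q: "q > 0" "cball p q \<subseteq> ball 0 1 \<inter> ball p r \<inter> - P"
    using e by (auto simp: q_def subset_iff)
  define u where "u = (\<lambda>t. p + of_real q * cis (2*pi*t))"
  have ucont: "continuous_on S u" for S
    unfolding u_def by (intro continuous_intros continuous_on_cis)
  have usph: "u t \<in> sphere p q" for t using q by (simp add: u_def dist_norm norm_mult)
  have sphsub: "sphere p q \<subseteq> cball 0 1 - insert p P"
  proof
    fix z assume z: "z \<in> sphere p q"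
    then have "z \<in> cball p q" "z \<noteq> p" using q by auto
    then show "z \<in> cball 0 1 - insert p P" using q(2) ball_subset_cball by blast
  qed
  have "continuous_on {0..1} (\<lambda>t. g (u t))"
    by (rule continuous_on_compose2[OF g(1) ucont]) (use usph sphsub in blast)
  moreover have "(\<lambda>t. g (u t)) ` {0..1} \<subseteq> sphere 0 1" using g(2) usph sphsub by blast
  ultimately obtain l where l: "continuous_on {0..1} l" "\<And>t. t \<in> {0..1::real} \<Longrightarrow> g (u t) = cis (l t)"
    using circle_log_contractible[of "{0..1::real}" "\<lambda>t. g (u t)"] convex_imp_contractible[of "{0..1::real}"]
    by auto
  have u01: "u 1 = u 0" by (simp add: u_def cis.code)
  then have "cis (l 1) = cis (l 0)" using l(2)[of 0] l(2)[of 1] by simp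
  then obtain d :: int where d: "l 1 - l 0 = 2 * pi * d" unfolding cis_eq_iff by blast
  define tt where "tt = (\<lambda>z. Arg2pi (z - p) / (2*pi))"
  \<comment> \<open>The angle \<open>tt\<close> jumps by 1 at the start of the circle, and there
    \<open>l\<close> jumps by 2 pi d; the difference \<open>m\<close> is therefore continuous on the
    circle.\<close>
  define m where "m = (\<lambda>z. l (tt z) - 2 * pi * d * tt z)"
  have ttu: "tt (u t) = t" if "0 \<le> t" "t < 1" for t
  proof -
    have "Arg2pi (of_real q * cis (2*pi*t)) = 2*pi*t"
      by (rule Arg2pi_unique[of q]) (use q that in \<open>auto simp: cis_conv_exp mult.commute mult.left_commute\<close>)
    then show ?thesis by (simp add: tt_def u_def)
  qed
  have mu: "m (u t) = l t - 2 * pi * d * t" if "t \<in> {0..1}" for t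
  proof (cases "t = 1")
    case True
    then show ?thesis using u01 ttu[of 0] d by (simp add: m_def)
  next
    case False
    then show ?thesis using ttu[of t] that by (simp add: m_def)
  qed
  have uim: "u ` {0..1} = sphere p q"
  proof (intro equalityI subsetI)
    fix z assume z: "z \<in> sphere p q"
    have "z - p = of_real (norm (z - p)) * exp (\<i> * of_real (Arg2pi (z - p)))" by (rule Arg2pi_eq)
    also have "norm (z - p) = q" using z by (simp add: dist_norm norm_minus_commute)
    finally have "z = u (tt z)" by (simp add: u_def tt_def cis_conv_exp algebra_simps)
    moreover have "tt z \<in> {0..1}"
      using Arg2pi_ge_0[of "z - p"] Arg2pi_lt_2pi[of "z - p"] by (auto simp: tt_def)
    ultimately show "z \<in> u ` {0..1}" by blast
  qed (use usph in auto)
  have "continuous_on {0..1} (\<lambda>t. m (u t)) \<longleftrightarrow> continuous_on {0..1} (\<lambda>t. l t - 2 * pi * d * t)"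
    by (rule continuous_on_cong) (use mu in auto)
  then have "continuous_on {0..1} (\<lambda>t. m (u t))" using l(1) by (auto intro!: continuous_intros)
  then have mcont: "continuous_on (sphere p q) m"
    using continuous_on_compact_image[OF _ ucont, of "{0..1}" m] unfolding uim by auto
  obtain M where M: "continuous_on UNIV M" "\<And>z. z \<in> sphere p q \<Longrightarrow> M z = m z"
    using real_Tietze_closed[OF closed_sphere mcont] by blast
  have gm: "g z * sgn (z - p) powi (-d) = cis (M z)" if z: "z \<in> sphere p q" for z
  proof -
    obtain t where t: "t \<in> {0..1}" "z = u t" using uim z by blast
    have "sgn (of_real q :: complex) = 1" using q(1) by (simp add: sgn_eq)
    then have "sgn (z - p) = cis (2*pi*t)" by (simp add: t(2) u_def sgn_mult)
    then have "g z * sgn (z - p) powi (-d) = cis (l t) * cis (of_int (-d) * (2*pi*t))"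
      using l(2)[OF t(1)] by (simp only: t(2) cis_power_int)
    also have "\<dots> = cis (l t + of_int (-d) * (2*pi*t))" by (rule cis_mult)
    also have "l t + of_int (-d) * (2*pi*t) = M z"
      using mu[OF t(1)] M(2)[OF z] by (simp add: t(2))
    finally show ?thesis .
  qed
  define g' where "g' = (\<lambda>z. if z \<in> cball p q then cis (M z) else g z * sgn (z - p) powi (-d))"
  have cD: "cball 0 1 - P = cball p q \<union> ((cball 0 1 - P) \<inter> - ball p q)"
    using q(2) by (auto simp: subset_iff)
  show thesis
  proof
    have "continuous_on (cball p q \<union> ((cball 0 1 - P) \<inter> - ball p q)) g'"
      unfolding g'_def
    proof (rule continuous_on_cases_local)
      show "closedin (top_of_set (cball p q \<union> (cball 0 1 - P) \<inter> - ball p q)) (cball p q)"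
        by (rule closed_subset) auto
      show "closedin (top_of_set (cball p q \<union> (cball 0 1 - P) \<inter> - ball p q)) ((cball 0 1 - P) \<inter> - ball p q)"
        unfolding cD[symmetric] by (rule closedin_closed_Int) (simp add: closed_Compl)
      show "continuous_on (cball p q) (\<lambda>z. cis (M z))"
        using continuous_on_subset[OF M(1)] by (intro continuous_on_cis) auto
      have "p \<notin> (cball 0 1 - P) \<inter> - ball p q" using q by auto
      then show "continuous_on ((cball 0 1 - P) \<inter> - ball p q) (\<lambda>z. g z * sgn (z - p) powi (-d))"
        by (intro continuous_on_mult continuous_on_powi continuous_on_sgn_diff continuous_on_subset[OF g(1)])
          (auto simp: sgn_zero_iff)
      show "cis (M z) = g z * sgn (z - p) powi (-d)"
        if "z \<in> cball p q \<and> z \<notin> cball p q \<or> z \<in> (cball 0 1 - P) \<inter> - ball p q \<and> z \<in> cball p q" for z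
        using gm[of z] that by auto
    qed
    then show "continuous_on (cball 0 1 - P) g'" using cD by simp
    show "g' ` (cball 0 1 - P) \<subseteq> sphere 0 1"
    proof clarify
      fix z :: complex assume z: "z \<in> cball 0 1" "z \<notin> P"
      show "g' z \<in> sphere 0 1"
      proof (cases "z \<in> cball p q")
        case True then show ?thesis by (simp add: g'_def)
      next
        case False
        then have "z \<noteq> p" using q by auto
        then have "z \<in> cball 0 1 - insert p P" using z by blast
        then have "g z \<in> sphere 0 1" using g(2) by blast
        then have "norm (g z) = 1" by simp
        then show ?thesis using False \<open>z \<noteq> p\<close> by (simp add: g'_def norm_mult norm_power_int norm_sgn)
      qed
    qed
    fix z assume z: "z \<in> cball 0 1 - P" "z \<notin> ball p r"
    then have "z \<notin> cball p q" using q(2) by blast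
    moreover have "z \<noteq> p" using z P by auto
    ultimately show "g z = g' z * sgn (z - p) powi d"
      by (simp add: g'_def power_int_minus sgn_zero_iff)
  qed
qed

lemma factor_punctured_circle_map:
  fixes g :: "complex \<Rightarrow> complex"
  assumes "finite P" "P \<subseteq> ball 0 1" "closed Z" "Z \<inter> P = {}" "Z \<subseteq> cball 0 1"
    "continuous_on (cball 0 1 - P) g" "g ` (cball 0 1 - P) \<subseteq> sphere 0 1"
  shows "\<exists>d c. {p. d p \<noteq> 0} \<subseteq> P \<and> continuous_on (cball 0 1) c \<and> c ` cball 0 1 \<subseteq> sphere 0 1 \<and>
    (\<forall>z\<in>Z. g z = c z * pole_prod d z)"
  using assms
proof (induction P arbitrary: g rule: finite_induct)
  case empty
  then show ?case
    by (intro exI[of _ "\<lambda>_. 0"] exI[of _ g]) (auto simp: pole_prod_def)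
next
  case (insert p P)
  have "open (- Z)" "p \<in> - Z" using insert.prems by auto
  then obtain r where r: "r > 0" "ball p r \<subseteq> - Z" by (meson openE)
  obtain k :: int and g' where g': "continuous_on (cball 0 1 - P) g'"
    "g' ` (cball 0 1 - P) \<subseteq> sphere 0 1"
    "\<And>z. z \<in> cball 0 1 - P \<Longrightarrow> z \<notin> ball p r \<Longrightarrow> g z = g' z * sgn (z - p) powi k"
  proof (rule remove_puncture[of P p r g])
    show "p \<in> ball 0 1" using insert.prems by blast
  qed (use insert r in auto)
  obtain d c where dc: "{p. d p \<noteq> 0} \<subseteq> P" "continuous_on (cball 0 1) c"
    "c ` cball 0 1 \<subseteq> sphere 0 1" "\<forall>z\<in>Z. g' z = c z * pole_prod d z"
    using insert.IH[of g'] insert.prems g'(1,2) by blast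
  have fin: "finite {p. d p \<noteq> 0}" using dc(1) insert.hyps finite_subset by blast
  show ?case
  proof (intro exI[of _ "\<lambda>z. d z + k * point_pole p z"] exI[of _ c] conjI ballI dc)
    show "{z. d z + k * point_pole p z \<noteq> 0} \<subseteq> insert p P"
      using dc(1) by (auto simp: point_pole_def split: if_splits)
    fix z assume z: "z \<in> Z"
    then have zz: "z \<in> cball 0 1 - P" "z \<notin> ball p r" "z \<noteq> p" using insert.prems r by auto
    have "d z = 0" using dc(1) zz by blast
    then have "pole_prod (\<lambda>z. d z + k * point_pole p z) z = pole_prod d z * sgn (z - p) powi k"
      using pole_prod_add[OF fin finite_support_point_pole[of k p], of z] zz(3)
        pole_prod_scale[of "point_pole p" k z] finite_support_point_pole[of 1 p]
      by (simp add: pole_prod_point point_pole_def)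
    then show "g z = c z * pole_prod (\<lambda>z. d z + k * point_pole p z) z"
      using g'(3)[OF zz(1,2)] dc(4) z by simp
  qed
qed

text \<open>After extension to the boundary circle, the map extends to the plane minus finitely many
  points, and the punctures inside the disc become poles whose degrees are the local
  windings.\<close>

lemma pole_map_extension:
  fixes f :: "complex \<Rightarrow> complex"
  assumes K: "closed K" "K \<subseteq> cball 0 1" "saturated w K" "w \<noteq> []"
    and f: "continuous_on K f" "f ` K \<subseteq> sphere 0 1" "glued_on w K f"
  obtains d f' where "pole_map w K d f'" "\<And>z. z \<in> K \<Longrightarrow> f' z = f z"
proof -
  obtain f' where f': "continuous_on (sphere 0 1 \<union> K) f'" "f' ` (sphere 0 1 \<union> K) \<subseteq> sphere 0 1"
    "\<And>z. z \<in> K \<Longrightarrow> f' z = f z" "glued_on w (sphere 0 1) f'"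
  proof (rule glued_extension_to_circle[of K w f "sphere 0 1" 1])
    show "\<exists>g'. continuous_on {0..1} g' \<and> g' ` {0..1} \<subseteq> sphere 0 1 \<and> (\<forall>s\<in>C. g' s = g s)"
      if "closed C" "C \<subseteq> {0..1}" "continuous_on C g" "g ` C \<subseteq> sphere 0 1" for C and g :: "real \<Rightarrow> complex"
      using circle_valued_extension_interval that by blast
  qed (use K f in auto)
  let ?Z = "sphere 0 1 \<union> K"
  have "compact K" using K(1) bounded_subset[OF bounded_cball K(2)] compact_eq_bounded_closed by blast
  then have cZ: "compact ?Z" by (intro compact_Un) auto
  obtain P g where Pg: "finite P" "disjnt P ?Z" "continuous_on (- P) g"
    "g \<in> (- P) \<rightarrow> sphere 0 1" "\<And>x. x \<in> ?Z \<Longrightarrow> g x = f' x"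
  proof (rule extend_map_UNIV_to_sphere_cofinite[of 1 ?Z f' 0 UNIV])
    show "C \<inter> UNIV \<noteq> {}" if "C \<in> components (- ?Z)" for C using that in_components_nonempty by auto
  qed (use cZ f' in auto)
  \<comment> \<open>No puncture lies on the boundary circle, and those outside the disc do not
    affect the restriction to it.\<close>
  let ?P = "P \<inter> ball 0 1"
  have sub: "cball 0 1 - ?P \<subseteq> - P"
  proof
    fix z assume z: "z \<in> cball 0 1 - ?P"
    show "z \<in> - P"
    proof
      assume "z \<in> P"
      then have "z \<in> sphere 0 1" using z by auto
      then show False using Pg(2) \<open>z \<in> P\<close> unfolding disjnt_def by blast
    qed
  qed
  obtain d c where dc: "{p. d p \<noteq> 0} \<subseteq> ?P" "continuous_on (cball 0 1) c"
    "c ` cball 0 1 \<subseteq> sphere 0 1" "\<forall>z\<in>?Z. g z = c z * pole_prod d z"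
  proof -
    have "\<exists>d c. {p. d p \<noteq> 0} \<subseteq> ?P \<and> continuous_on (cball 0 1) c \<and> c ` cball 0 1 \<subseteq> sphere 0 1 \<and>
      (\<forall>z\<in>?Z. g z = c z * pole_prod d z)"
    proof (rule factor_punctured_circle_map)
      show "closed ?Z" using cZ compact_imp_closed by blast
      show "?Z \<inter> ?P = {}" using Pg(2) unfolding disjnt_def by blast
      show "continuous_on (cball 0 1 - ?P) g" using Pg(3) sub continuous_on_subset by blast
      show "g ` (cball 0 1 - ?P) \<subseteq> sphere 0 1" using Pg(4) sub by auto
    qed (use Pg(1) K(2) in auto)
    then show thesis using that by blast
  qed
  have "pole_map w K d f'"
  proof (rule pole_mapI[OF _ _ f'(4) dc(2,3)])
    show "finite {p. d p \<noteq> 0}" using dc(1) Pg(1) by (meson finite_Int finite_subset)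
    show "{p. d p \<noteq> 0} \<subseteq> ball 0 1 - K" using dc(1) Pg(2) unfolding disjnt_def by blast
    show "f' z = c z * pole_prod d z" if "z \<in> ?Z" for z using dc(4) Pg(5) that by auto
  qed
  then show thesis using that f'(3) by blast
qed

section \<open>Integer relations between circle-valued maps\<close>

text \<open>Gaussian elimination without division: rows are cross-multiplied by the pivot
  \<open>A i j0\<close>, so the solution remains integral.\<close>

lemma integer_dependency:
  fixes A :: "'i \<Rightarrow> 'j \<Rightarrow> int"
  assumes "finite I" "finite J" "card I < card J"
  shows "\<exists>a. (\<exists>j\<in>J. a j \<noteq> 0) \<and> (\<forall>i\<in>I. (\<Sum>j\<in>J. A i j * a j) = 0)"
  using assms
proof (induction I arbitrary: J A rule: finite_induct)
  case empty
  then show ?case by (intro exI[of _ "\<lambda>_. 1"]) (auto simp: card_gt_0_iff)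
next
  case (insert i I)
  show ?case
  proof (cases "\<forall>j\<in>J. A i j = 0")
    case True
    have "card I < card J" using insert by simp
    then obtain a where "\<exists>j\<in>J. a j \<noteq> 0" "\<forall>k\<in>I. (\<Sum>j\<in>J. A k j * a j) = 0"
      using insert.IH[of J A] insert.prems by blast
    then show ?thesis using True by (intro exI[of _ a]) auto
  next
    case False
    then obtain j0 where j0: "j0 \<in> J" "A i j0 \<noteq> 0" by blast
    let ?J = "J - {j0}"
    have "card I < card ?J" using insert j0 by simp
    then obtain b where b: "\<exists>j\<in>?J. b j \<noteq> 0"
      "\<forall>k\<in>I. (\<Sum>j\<in>?J. (A k j * A i j0 - A k j0 * A i j) * b j) = 0"
      using insert.IH[of ?J "\<lambda>k j. A k j * A i j0 - A k j0 * A i j"] insert.prems by blast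
    \<comment> \<open>Scaling the reduced solution by the pivot lets the entry at \<open>j0\<close>
      solve row \<open>i\<close> exactly over the integers.\<close>
    define a where "a = (\<lambda>j. if j = j0 then - (\<Sum>j\<in>?J. A i j * b j) else b j * A i j0)"
    have split: "(\<Sum>j\<in>J. A k j * a j) =
      A k j0 * (- (\<Sum>j\<in>?J. A i j * b j)) + (\<Sum>j\<in>?J. A k j * (b j * A i j0))" for k
    proof -
      have "(\<Sum>j\<in>J. A k j * a j) = A k j0 * a j0 + (\<Sum>j\<in>?J. A k j * a j)"
        using insert.prems(1) j0(1) by (rule sum.remove)
      also have "(\<Sum>j\<in>?J. A k j * a j) = (\<Sum>j\<in>?J. A k j * (b j * A i j0))"
        by (rule sum.cong) (auto simp: a_def)
      finally show ?thesis by (simp add: a_def)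
    qed
    have rowi: "(\<Sum>j\<in>J. A i j * a j) = 0"
      unfolding split by (simp add: sum_distrib_left algebra_simps)
    have rowk: "(\<Sum>j\<in>J. A k j * a j) = 0" if "k \<in> I" for k
    proof -
      have "(\<Sum>j\<in>J. A k j * a j) = (\<Sum>j\<in>?J. (A k j * A i j0 - A k j0 * A i j) * b j)"
        unfolding split by (simp add: sum_distrib_left sum_subtractf algebra_simps)
      then show ?thesis using b(2) that by simp
    qed
    have "\<exists>j\<in>J. a j \<noteq> 0" using b(1) j0 by (auto simp: a_def)
    then show ?thesis using rowi rowk by blast
  qed
qed

text \<open>\<open>g\<close> is 2 minus the Euler characteristic. The assumptions on windings are all that is used of
  the word of a surface: the total winding of a glued map along the boundary
  is even, and the windings along the \<open>g\<close> sides \<open>side i\<close> are integers that determine whether the map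
  has a glued logarithm.\<close>

locale surface_word =
  fixes w :: "(nat \<times> bool) list" and g :: nat and side :: "nat \<Rightarrow> nat"
  assumes nonempty: "w \<noteq> []"
    and two: "\<And>i j k. \<lbrakk>i < length w; j < length w; k < length w; i \<noteq> j;
      fst (w ! i) = fst (w ! j); fst (w ! k) = fst (w ! i)\<rbrakk> \<Longrightarrow> k = i \<or> k = j"
    and even_winding: "\<And>f l. \<lbrakk>glued_on w (sphere 0 1) f; continuous_on {0..1} l;
      \<And>t. t \<in> {0..1} \<Longrightarrow> f (cis (2*pi*t)) = cis (l t)\<rbrakk> \<Longrightarrow> \<exists>k::int. l 1 - l 0 = 4 * pi * k"
    and side_winding: "\<And>f l i. \<lbrakk>glued_on w (sphere 0 1) f; continuous_on {0..1} l;
      \<And>t. t \<in> {0..1} \<Longrightarrow> f (cis (2*pi*t)) = cis (l t); i < g\<rbrakk> \<Longrightarrow>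
      \<exists>k::int. l ((real (side i) + 1) / length w) - l (real (side i) / length w) = 2 * pi * k"
    and zero_winding: "\<And>f l. \<lbrakk>glued_on w (sphere 0 1) f; continuous_on {0..1} l;
      \<And>t. t \<in> {0..1} \<Longrightarrow> f (cis (2*pi*t)) = cis (l t);
      \<And>i. i < g \<Longrightarrow> l ((real (side i) + 1) / length w) = l (real (side i) / length w)\<rbrakk> \<Longrightarrow>
      l 1 = l 0 \<and> (\<forall>i j s. i < length w \<longrightarrow> j < length w \<longrightarrow> fst (w ! i) = fst (w ! j) \<longrightarrow> 0 \<le> s \<longrightarrow> s \<le> 1 \<longrightarrow>
        l ((real i + s) / length w) =
        l ((real j + (if snd (w ! i) = snd (w ! j) then s else 1 - s)) / length w))"

locale surface_closed_set = surface_word +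
  fixes K :: "complex set"
  assumes closed_K: "closed K" and K_subset: "K \<subseteq> cball 0 1" and K_saturated: "saturated w K"

sublocale surface_closed_set \<subseteq> disc_closed_set w K
  by unfold_locales (use two closed_K K_subset K_saturated in blast)+

context surface_closed_set
begin

lemma pole_map_degree_even:
  assumes "pole_map w K' d f"
  shows "even (\<Sum>p | d p \<noteq> 0. d p)"
proof -
  obtain l where l: "continuous_on {0..1} l"
    "\<And>t. t \<in> {0..1} \<Longrightarrow> f (cis (2*pi*t)) = cis (l t)"
    "l 1 - l 0 = 2 * pi * (\<Sum>p | d p \<noteq> 0. d p)"
    using pole_map_log_on_circle[OF assms] by blast
  have "glued_on w (sphere 0 1) f" using assms unfolding pole_map_def by blast
  then obtain k :: int where "l 1 - l 0 = 4 * pi * k" using even_winding l(1,2) by blast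
  then have "real_of_int (\<Sum>p | d p \<noteq> 0. d p) = real_of_int (2 * k)" using l(3) by simp
  then have "(\<Sum>p | d p \<noteq> 0. d p) = 2 * k" using of_int_eq_iff by blast
  then show ?thesis by simp
qed

text \<open>Dividing \<open>f\<close> by a glued extension of its logarithm makes it 1 on
  \<open>K\<close> without changing the poles. Cutting off outside \<open>V\<close> then leaves a
  map on the whole surface whose poles are those in \<open>V\<close>, and its total degree is
  even.\<close>

lemma region_degree_even:
  assumes f: "pole_map w K d f" and V: "region w K V"
    and m: "continuous_on K m" "glued_on w K m" "\<And>z. z \<in> K \<Longrightarrow> f z = cis (m z)"
  shows "even (\<Sum>p | (if p \<in> V then d p else 0) \<noteq> 0. if p \<in> V then d p else 0)"
proof -
  obtain M where M: "continuous_on UNIV M" "\<And>z. z \<in> K \<Longrightarrow> M z = m z" "glued_on w (sphere 0 1) M"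
    using glued_real_extension[OF closed_K K_saturated nonempty m(1,2)] by blast
  have "pole_map w K (\<lambda>_. 0) (\<lambda>z. cis (- M z))"
  proof (rule pole_mapI[where c="\<lambda>z. cis (- M z)"])
    show "glued_on w (sphere 0 1) (\<lambda>z. cis (- M z))" using M(3) unfolding glued_on_def by fastforce
    show "continuous_on (cball 0 1) (\<lambda>z. cis (- M z))"
      using continuous_on_subset[OF M(1)] by (intro continuous_on_cis continuous_intros) auto
  qed (auto simp: pole_prod_def)
  from pole_map_mult[OF f this]
  have "pole_map w K d (\<lambda>z. f z * cis (- M z))" by simp
  moreover have "f z * cis (- M z) = 1" if "z \<in> K" for z
    using m(3)[OF that] M(2)[OF that] by (simp add: cis_mult)
  ultimately have "pole_map w K (\<lambda>p. if p \<in> V then d p else 0) (\<lambda>z. if z \<in> V then f z * cis (- M z) else 1)"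
    using pole_map_localize[OF _ _ V closed_K K_subset, of _ _ K] V unfolding region_def by blast
  then show ?thesis by (rule pole_map_degree_even)
qed

lemma pole_map_extension_at:
  assumes f: "continuous_on K f" "f ` K \<subseteq> sphere 0 1" "glued_on w K f"
    and R: "\<And>p. p \<in> ball 0 1 - K \<Longrightarrow> \<exists>q\<in>R. linked w K p q"
  obtains d f' where "pole_map w K d f'" "\<And>z. z \<in> K \<Longrightarrow> f' z = f z" "\<And>p. d p \<noteq> 0 \<Longrightarrow> p \<in> R"
proof -
  obtain d f' where df: "pole_map w K d f'" "\<And>z. z \<in> K \<Longrightarrow> f' z = f z"
    using pole_map_extension[OF closed_K K_subset K_saturated nonempty f] by blast
  define P where "P = {p. d p \<noteq> 0}"
  have fin: "finite P" and PK: "P \<subseteq> ball 0 1 - K" using df(1) unfolding pole_map_def P_def by auto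
  have "\<exists>q e h. q \<in> R \<and> pole_map w K (\<lambda>z. point_pole p z + e * point_pole q z) h \<and> (\<forall>z\<in>K. h z = 1)"
    if "p \<in> P" for p
    using R[of p] that PK unfolding linked_def by blast
  then obtain q e h where qeh: "\<And>p. p \<in> P \<Longrightarrow> q p \<in> R"
    "\<And>p. p \<in> P \<Longrightarrow> pole_map w K (\<lambda>z. point_pole p z + e p * point_pole (q p) z) (h p)"
    "\<And>p z. p \<in> P \<Longrightarrow> z \<in> K \<Longrightarrow> h p z = 1" by metis
  \<comment> \<open>The power \<open>- d p\<close> of the linking map removes the pole at
    \<open>p\<close> and creates one at the representative \<open>q p\<close>, leaving the values on
    \<open>K\<close> unchanged.\<close>
  let ?d = "\<lambda>z. d z + (\<Sum>p\<in>P. (- d p) * (point_pole p z + e p * point_pole (q p) z))"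
  let ?f = "\<lambda>z. f' z * (\<Prod>p\<in>P. h p z powi (- d p))"
  have 1: "pole_map w K ?d ?f"
    by (rule pole_map_mult[OF df(1) pole_map_prod[OF fin]]) (use pole_map_powi qeh(2) in blast)
  have 2: "?f z = f z" if "z \<in> K" for z using df(2)[OF that] qeh(3) that by simp
  have 3: "z \<in> R" if "?d z \<noteq> 0" for z
  proof (rule ccontr)
    assume z: "z \<notin> R"
    have "(\<Sum>p\<in>P. (- d p) * (point_pole p z + e p * point_pole (q p) z)) = (\<Sum>p\<in>P. if p = z then - d z else 0)"
      by (rule sum.cong) (use qeh(1) z in \<open>auto simp: point_pole_def\<close>)
    also have "\<dots> = (if z \<in> P then - d z else 0)" using fin by simp
    also have "\<dots> = - d z" by (auto simp: P_def)
    finally show False using that by simp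
  qed
  show thesis using that[of ?d ?f] 1 2 3 by blast
qed

text \<open>Without poles the map has a logarithm on the disc. On the circle it differs from
  \<open>l\<close> by a constant, and vanishing windings make \<open>l\<close> compatible with the
  gluing.\<close>

lemma zero_divisor_log:
  assumes f: "pole_map w K (\<lambda>_. 0) f" and l: "continuous_on {0..1} l"
    "\<And>t. t \<in> {0..1} \<Longrightarrow> f (cis (2*pi*t)) = cis (l t)"
    "\<And>i. i < g \<Longrightarrow> l ((real (side i) + 1) / length w) = l (real (side i) / length w)"
  obtains m :: "complex \<Rightarrow> real" where "continuous_on (cball 0 1) m" "glued_on w (sphere 0 1) m"
    "\<And>z. z \<in> K \<Longrightarrow> f z = cis (m z)"
proof -
  obtain c where c: "glued_on w (sphere 0 1) f" "continuous_on (cball 0 1) c"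
    "\<And>z. z \<in> cball 0 1 \<Longrightarrow> norm (c z) = 1"
    "\<And>z. z \<in> sphere 0 1 \<union> K \<Longrightarrow> f z = c z"
    using pole_mapE[OF f] by (auto simp: pole_prod_def)
  obtain m where m: "continuous_on (cball 0 1) m" "\<And>z. z \<in> cball 0 1 \<Longrightarrow> c z = cis (m z)"
    using circle_log_contractible[OF c(2) convex_imp_contractible[OF convex_cball]] c(3)
    by (metis image_subsetI mem_sphere_0)
  have lg: "l ((real i + s) / length w) =
        l ((real j + (if snd (w ! i) = snd (w ! j) then s else 1 - s)) / length w)"
    if "i < length w" "j < length w" "fst (w ! i) = fst (w ! j)" "0 \<le> s" "s \<le> 1" for i j s
    using zero_winding[OF c(1) l] that by blast
  have mc: "continuous_on {0..1} (\<lambda>t. m (cis (2*pi*t)))"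
    by (rule continuous_on_compose2[OF m(1)]) (auto intro!: continuous_intros continuous_on_cis)
  have ml: "m (cis (2*pi*t)) - l t = m (cis (2*pi*t')) - l t'" if "t \<in> {0..1}" "t' \<in> {0..1}" for t t'
  proof (rule circle_log_diff_constant[OF _ mc l(1)])
    fix t :: real assume "t \<in> {0..1}"
    then show "cis (m (cis (2*pi*t))) = cis (l t)"
      using l(2)[of t] m(2)[of "cis (2*pi*t)"] c(4)[of "cis (2*pi*t)"] by simp
  qed (use that in auto)
  have "glued_on w (sphere 0 1) m"
    unfolding glued_on_def
  proof clarify
    fix x y assume xy: "(x, y) \<in> side_gluing w"
    obtain i j s where ij: "i < length w" "j < length w" "fst (w ! i) = fst (w ! j)" "0 \<le> s" "s \<le> 1"
      "x = side_point (length w) i s"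
      "y = side_point (length w) j (if snd (w ! i) = snd (w ! j) then s else 1 - s)"
      using xy unfolding side_gluing_def by auto
    let ?t = "if snd (w ! i) = snd (w ! j) then s else 1 - s"
    have t01: "(real k + v) / length w \<in> {0..1}" if "k < length w" "0 \<le> v" "v \<le> 1" for k v
      using that by (auto simp: divide_le_eq)
    have "x = cis (2*pi*((real i + s) / length w))" "y = cis (2*pi*((real j + ?t) / length w))"
      using ij by (auto simp: side_point_def)
    then have "m x - m y = l ((real i + s) / length w) - l ((real j + ?t) / length w)"
      using ml[OF t01[OF ij(1,4,5)] t01[of j ?t]] ij by auto
    then show "m x = m y" using lg[OF ij(1-5)] by simp
  qed
  moreover have "f z = cis (m z)" if "z \<in> K" for z using c(4)[of z] m(2)[of z] that K_subset by auto
  ultimately show thesis using that m(1) by blast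
qed

text \<open>The exponents must satisfy \<open>g\<close> equations for the side windings and one for
  the degree at each representative except \<open>p0\<close>. The degree at \<open>p0\<close> then
  vanishes by itself, since zero side windings force zero total winding; this saves one
  equation.\<close>

lemma circle_maps_dependent:
  fixes f :: "'j \<Rightarrow> complex \<Rightarrow> complex"
  assumes J: "finite J" "card J > g + (card R - 1)" and R: "finite R"
    "\<And>p. p \<in> ball 0 1 - K \<Longrightarrow> \<exists>q\<in>R. linked w K p q"
    and f: "\<And>j. j \<in> J \<Longrightarrow> continuous_on K (f j)" "\<And>j. j \<in> J \<Longrightarrow> f j ` K \<subseteq> sphere 0 1"
      "\<And>j. j \<in> J \<Longrightarrow> glued_on w K (f j)"
  obtains a :: "'j \<Rightarrow> int" and m :: "complex \<Rightarrow> real" where "\<exists>j\<in>J. a j \<noteq> 0"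
    "continuous_on (cball 0 1) m" "glued_on w (sphere 0 1) m"
    "\<And>z. z \<in> K \<Longrightarrow> (\<Prod>j\<in>J. f j z powi a j) = cis (m z)"
proof -
  have "\<exists>d f'. pole_map w K d f' \<and> (\<forall>z\<in>K. f' z = f j z) \<and> (\<forall>p. d p \<noteq> 0 \<longrightarrow> p \<in> R)" if "j \<in> J" for j
    using pole_map_extension_at[OF f(1)[OF that] f(2)[OF that] f(3)[OF that] R(2)] by metis
  then obtain d F where dF: "\<And>j. j \<in> J \<Longrightarrow> pole_map w K (d j) (F j)"
    "\<And>j z. j \<in> J \<Longrightarrow> z \<in> K \<Longrightarrow> F j z = f j z" "\<And>j p. j \<in> J \<Longrightarrow> d j p \<noteq> 0 \<Longrightarrow> p \<in> R" by metis
  have "\<exists>l. continuous_on {0..1} l \<and> (\<forall>t\<in>{0..1}. F j (cis (2*pi*t)) = cis (l t)) \<and>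
    l 1 - l 0 = 2 * pi * (\<Sum>p | d j p \<noteq> 0. d j p)" if "j \<in> J" for j
    using pole_map_log_on_circle[OF dF(1)[OF that]] by metis
  then obtain l where l: "\<And>j. j \<in> J \<Longrightarrow> continuous_on {0..1} (l j)"
    "\<And>j t. j \<in> J \<Longrightarrow> t \<in> {0..1} \<Longrightarrow> F j (cis (2*pi*t)) = cis (l j t)"
    "\<And>j. j \<in> J \<Longrightarrow> l j 1 - l j 0 = 2 * pi * (\<Sum>p | d j p \<noteq> 0. d j p)" by metis
  have "\<exists>k::int. l j ((real (side i) + 1) / length w) - l j (real (side i) / length w) = 2 * pi * k"
    if "j \<in> J" "i < g" for j i
  proof (rule side_winding[of "F j"])
    show "glued_on w (sphere 0 1) (F j)" using dF(1)[OF that(1)] unfolding pole_map_def by blast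
  qed (use l that in auto)
  then obtain k :: "'j \<Rightarrow> nat \<Rightarrow> int" where
    k: "\<And>j i. j \<in> J \<Longrightarrow> i < g \<Longrightarrow>
      l j ((real (side i) + 1) / length w) - l j (real (side i) / length w) = 2 * pi * k j i" by metis
  \<comment> \<open>If \<open>R\<close> is empty, \<open>p0\<close> is arbitrary, matching the
    truncated value 0 of \<open>card R - 1\<close>.\<close>
  obtain p0 where p0: "R \<noteq> {} \<longrightarrow> p0 \<in> R" by blast
  define I where "I = Inl ` {..<g} \<union> Inr ` (R - {p0})"
  have finI: "finite I" using R(1) by (simp add: I_def)
  have "card I \<le> card (Inl ` {..<g} :: (nat + complex) set) + card (Inr ` (R - {p0}) :: (nat + complex) set)"
    unfolding I_def by (rule card_Un_le)
  also have "\<dots> = g + card (R - {p0})" by (simp add: card_image)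
  also have "card (R - {p0}) = card R - 1" using p0 by (cases "R = {}") auto
  finally have "card I < card J" using J(2) by simp
  then obtain a where a: "\<exists>j\<in>J. a j \<noteq> 0"
    "\<forall>i\<in>I. (\<Sum>j\<in>J. (case i of Inl i \<Rightarrow> k j i | Inr p \<Rightarrow> d j p) * a j) = 0"
    using integer_dependency[OF finI J(1), of "\<lambda>i j. case i of Inl i \<Rightarrow> k j i | Inr p \<Rightarrow> d j p"] by blast
  have a1: "(\<Sum>j\<in>J. k j i * a j) = 0" if "i < g" for i
    using bspec[OF a(2), of "Inl i"] that by (simp add: I_def)
  have a2: "(\<Sum>j\<in>J. d j p * a j) = 0" if "p \<in> R" "p \<noteq> p0" for p
    using bspec[OF a(2), of "Inr p"] that by (simp add: I_def)
  define D where "D = (\<lambda>p. \<Sum>j\<in>J. a j * d j p)"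
  define H where "H = (\<lambda>z. \<Prod>j\<in>J. F j z powi a j)"
  define LL where "LL = (\<lambda>t. \<Sum>j\<in>J. of_int (a j) * l j t)"
  have DH: "pole_map w K D H"
    unfolding D_def H_def by (rule pole_map_prod[OF J(1)]) (use pole_map_powi dF(1) in blast)
  have LLc: "continuous_on {0..1} LL" unfolding LL_def using l(1) by (intro continuous_intros) auto
  have LLH: "H (cis (2*pi*t)) = cis (LL t)" if "t \<in> {0..1}" for t
    unfolding H_def LL_def cis_sum[OF J(1)] by (rule prod.cong) (use l(2) that in \<open>auto simp: cis_power_int\<close>)
  have w0: "LL ((real (side i) + 1) / length w) = LL (real (side i) / length w)" if "i < g" for i
  proof -
    have "LL ((real (side i) + 1) / length w) - LL (real (side i) / length w) =
      (\<Sum>j\<in>J. of_int (a j) * (l j ((real (side i) + 1) / length w) - l j (real (side i) / length w)))"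
      unfolding LL_def by (simp add: sum_subtractf algebra_simps)
    also have "\<dots> = (\<Sum>j\<in>J. of_int (a j) * (2 * pi * k j i))" using k that by (intro sum.cong) auto
    also have "\<dots> = 2 * pi * of_int (\<Sum>j\<in>J. k j i * a j)"
      by (simp add: sum_distrib_left algebra_simps)
    finally show ?thesis using a1[OF that] by simp
  qed
  have H_glued: "glued_on w (sphere 0 1) H" using DH unfolding pole_map_def by blast
  have LL01: "LL 1 = LL 0" using zero_winding[OF H_glued LLc LLH w0] by blast
  have D0: "D p = 0" if "p \<noteq> p0" for p
  proof (cases "p \<in> R")
    case True
    then show ?thesis using a2[OF True that] by (simp add: D_def mult.commute)
  next
    case False
    then have "d j p = 0" if "j \<in> J" for j using dF(3) that by blast
    then show ?thesis by (simp add: D_def)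
  qed
  obtain l' where l': "continuous_on {0..1} l'" "\<And>t. t \<in> {0..1} \<Longrightarrow> H (cis (2*pi*t)) = cis (l' t)"
    "l' 1 - l' 0 = 2 * pi * (\<Sum>p | D p \<noteq> 0. D p)" using pole_map_log_on_circle[OF DH] by blast
  have "l' 1 - LL 1 = l' 0 - LL 0"
    by (rule circle_log_diff_constant[of "{0..1}"]) (use l' LLc LLH in auto)
  then have "2 * pi * real_of_int (\<Sum>p | D p \<noteq> 0. D p) = 0" using LL01 l'(3) by linarith
  then have "real_of_int (\<Sum>p | D p \<noteq> 0. D p) = 0" by (simp only: mult_eq_0_iff) simp
  then have "(\<Sum>p | D p \<noteq> 0. D p) = 0" by (simp only: of_int_eq_0_iff)
  moreover have "(\<Sum>p | D p \<noteq> 0. D p) = D p0"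
  proof -
    have "(\<Sum>p | D p \<noteq> 0. D p) = (\<Sum>p\<in>{p0}. D p)"
      by (rule sum.mono_neutral_left) (use D0 in auto)
    then show ?thesis by simp
  qed
  ultimately have "D p = 0" for p using D0 by (cases "p = p0") auto
  then have "D = (\<lambda>_. 0)" by auto
  then have "pole_map w K (\<lambda>_. 0) H" using DH by simp
  then obtain m where m: "continuous_on (cball 0 1) m" "glued_on w (sphere 0 1) m"
    "\<And>z. z \<in> K \<Longrightarrow> H z = cis (m z)"
    using zero_divisor_log[OF _ LLc LLH w0] by blast
  have "(\<Prod>j\<in>J. f j z powi a j) = cis (m z)" if "z \<in> K" for z
    using m(3)[OF that] dF(2) that unfolding H_def by simp
  then show thesis using that[OF a(1) m(1,2)] by blast
qed

end

subsection \<open>The words of the closed surfaces\<close>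

text \<open>Along two glued sides \<open>l\<close> gives two logarithms of one function on the unit
  interval, so their difference is constant.\<close>

lemma glued_sides_log:
  assumes f: "glued_on w (sphere 0 1) f" and l: "continuous_on {0..1} l"
    "\<And>t. t \<in> {0..1} \<Longrightarrow> f (cis (2*pi*t)) = cis (l t)"
    and ij: "i < length w" "j < length w" "fst (w ! i) = fst (w ! j)" and s: "s \<in> {0..1}" "s' \<in> {0..1}"
  shows "l ((real i + s) / length w) -
      l ((real j + (if snd (w ! i) = snd (w ! j) then s else 1 - s)) / length w) =
    l ((real i + s') / length w) -
      l ((real j + (if snd (w ! i) = snd (w ! j) then s' else 1 - s')) / length w)"
    and "cis (l ((real i + s) / length w)) =
      cis (l ((real j + (if snd (w ! i) = snd (w ! j) then s else 1 - s)) / length w))"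
proof -
  let ?L = "length w"
  let ?t = "\<lambda>s. if snd (w ! i) = snd (w ! j) then s else 1 - (s::real)"
  have t01: "(real k + v) / ?L \<in> {0..1}" if "k < ?L" "v \<in> {0..1}" for k v
    using that by (auto simp: divide_le_eq)
  have tt: "?t s \<in> {0..1}" if "s \<in> {0..1}" for s using that by auto
  have eq: "cis (l ((real i + s) / ?L)) = cis (l ((real j + ?t s) / ?L))" if s: "s \<in> {0..1}" for s
  proof -
    have "(side_point ?L i s, side_point ?L j (?t s)) \<in> side_gluing w"
      using ij s unfolding side_gluing_def by fastforce
    then have fe: "f (side_point ?L i s) = f (side_point ?L j (?t s))"
      using f unfolding glued_on_def by auto
    have fk: "f (side_point ?L k v) = cis (l ((real k + v) / ?L))" if "k < ?L" "v \<in> {0..1}" for k v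
      using l(2)[OF t01[OF that]] by (simp add: side_point_def)
    have "cis (l ((real i + s) / ?L)) = f (side_point ?L i s)" using fk[OF ij(1) s] by (rule sym)
    also note fe
    also have "f (side_point ?L j (?t s)) = cis (l ((real j + ?t s) / ?L))" by (rule fk[OF ij(2) tt[OF s]])
    finally show ?thesis .
  qed
  then show "cis (l ((real i + s) / ?L)) = cis (l ((real j + ?t s) / ?L))" using s by blast
  have c1: "continuous_on {0..1} (\<lambda>s. l ((real i + s) / ?L))"
    by (rule continuous_on_compose2[OF l(1)])
      (use t01[OF ij(1)] in \<open>auto simp: divide_inverse intro!: continuous_intros\<close>)
  have "continuous_on {0..1} ?t"
    by (cases "snd (w ! i) = snd (w ! j)") (auto intro!: continuous_intros)
  then have "continuous_on {0..1} (\<lambda>s. (real j + ?t s) / ?L)"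
    unfolding divide_inverse by (intro continuous_intros)
  then have c2: "continuous_on {0..1} (\<lambda>s. l ((real j + ?t s) / ?L))"
    by (rule continuous_on_compose2[OF l(1)]) (use t01[OF ij(2) tt] in blast)
  show "l ((real i + s) / ?L) - l ((real j + ?t s) / ?L) = l ((real i + s') / ?L) - l ((real j + ?t s') / ?L)"
    using circle_log_diff_constant[OF _ c1 c2 eq s] by simp
qed

lemma glued_sides_same:
  assumes f: "glued_on w (sphere 0 1) f" and l: "continuous_on {0..1} l"
    "\<And>t. t \<in> {0..1} \<Longrightarrow> f (cis (2*pi*t)) = cis (l t)"
    and ij: "i < length w" "j < length w" "fst (w ! i) = fst (w ! j)" "snd (w ! i) = snd (w ! j)"
  shows "l ((real i + 1) / length w) - l (real i / length w) =
      l ((real j + 1) / length w) - l (real j / length w)"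
    "cis (l (real i / length w)) = cis (l (real j / length w))"
    "cis (l ((real i + 1) / length w)) = cis (l ((real j + 1) / length w))"
  using glued_sides_log(1)[OF f l ij(1-3), of 1 0] glued_sides_log(2)[OF f l ij(1-3), of 0 0]
    glued_sides_log(2)[OF f l ij(1-3), of 1 0]
  unfolding if_P[OF ij(4)] by auto

lemma glued_sides_opposite:
  assumes f: "glued_on w (sphere 0 1) f" and l: "continuous_on {0..1} l"
    "\<And>t. t \<in> {0..1} \<Longrightarrow> f (cis (2*pi*t)) = cis (l t)"
    and ij: "i < length w" "j < length w" "fst (w ! i) = fst (w ! j)" "snd (w ! i) \<noteq> snd (w ! j)"
  shows "l ((real i + 1) / length w) - l (real i / length w) =
      l (real j / length w) - l ((real j + 1) / length w)"
    "cis (l (real i / length w)) = cis (l ((real j + 1) / length w))"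
    "cis (l ((real i + 1) / length w)) = cis (l (real j / length w))"
  using glued_sides_log(1)[OF f l ij(1-3), of 1 0] glued_sides_log(2)[OF f l ij(1-3), of 0 0]
    glued_sides_log(2)[OF f l ij(1-3), of 1 0]
  unfolding if_not_P[OF ij(4)] by auto

text \<open>With no increment on any side, \<open>l\<close> takes the value \<open>l 0\<close> at
  every corner; hence the constant difference between glued sides is 0.\<close>

lemma zero_winding_all_sides:
  assumes f: "glued_on w (sphere 0 1) f" and l: "continuous_on {0..1} l"
    "\<And>t. t \<in> {0..1} \<Longrightarrow> f (cis (2*pi*t)) = cis (l t)" and "w \<noteq> []"
    and v: "\<And>k. k < length w \<Longrightarrow> l ((real k + 1) / length w) = l (real k / length w)"
  shows "l 1 = l 0 \<and> (\<forall>i j s. i < length w \<longrightarrow> j < length w \<longrightarrow> fst (w ! i) = fst (w ! j) \<longrightarrow> 0 \<le> s \<longrightarrow> s \<le> 1 \<longrightarrow>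
        l ((real i + s) / length w) =
        l ((real j + (if snd (w ! i) = snd (w ! j) then s else 1 - s)) / length w))"
proof (intro conjI allI impI)
  have c: "l (real k / length w) = l 0" if "k \<le> length w" for k
    using that
  proof (induction k)
    case (Suc k)
    then show ?case using v[of k] by (simp add: add.commute)
  qed simp
  show "l 1 = l 0" using c[of "length w"] assms(4) by simp
  fix i j s assume ij: "i < length w" "j < length w" "fst (w ! i) = fst (w ! j)" "0 \<le> s" "s \<le> (1::real)"
  have "l ((real j + (if snd (w ! i) = snd (w ! j) then 0 else 1 - 0)) / length w) = l 0"
    using c[of j] v[of j] ij(2) by auto
  then show "l ((real i + s) / length w) =
      l ((real j + (if snd (w ! i) = snd (w ! j) then s else 1 - s)) / length w)"
    using glued_sides_log(1)[OF f l ij(1-3), of s 0] c[of i] ij(1,4,5) by simp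
qed

lemma nth_concat_blocks:
  assumes "\<And>i. length (F i) = n" "i < h" "c < n"
  shows "concat (map F [0..<h]) ! (n * i + c) = F i ! c"
  using assms(2)
proof (induction h)
  case (Suc h)
  have len: "length (concat (map F [0..<h])) = n * h" for h
    using assms(1) by (induction h) auto
  show ?case
  proof (cases "i < h")
    case True
    then have "n * i + c < n * h"
      using assms(3) by (metis add_less_cancel_left less_le_trans mult_Suc_right mult_le_mono2 Suc_leI add.commute)
    then show ?thesis using Suc.IH[OF True] len[of h] by (simp add: nth_append)
  next
    case False
    then have "i = h" using Suc.prems by simp
    then show ?thesis using len[of h] by (simp add: nth_append)
  qed
qed simp

lemma length_concat_blocks: "(\<And>i. length (F i) = n) \<Longrightarrow> length (concat (map F [0..<h])) = n * h"
  by (induction h) auto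

text \<open>The two sides are traversed in opposite directions, so their increments cancel, and no
  side winding has to be prescribed.\<close>

lemma surface_word_sphere: "surface_word [(0, True), (0, False)] 0 id"
proof
  let ?w = "[(0::nat, True), (0, False)]"
  show "k = i \<or> k = j" if "i < length ?w" "j < length ?w" "k < length ?w" "i \<noteq> j" for i j k
    using that by auto
  fix f :: "complex \<Rightarrow> complex" and l :: "real \<Rightarrow> real"
  assume f: "glued_on ?w (sphere 0 1) f" "continuous_on {0..1} l"
    "\<And>t. t \<in> {0..1} \<Longrightarrow> f (cis (2*pi*t)) = cis (l t)"
  have "l (1/2) - l 0 = l (1/2) - l 1"
    using glued_sides_opposite(1)[OF f, of 0 1] by simp
  then have l01: "l 1 = l 0" by simp
  then show "\<exists>k::int. l 1 - l 0 = 4 * pi * k" by (intro exI[of _ 0]) simp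
  show "l 1 = l 0 \<and> (\<forall>i j s. i < length ?w \<longrightarrow> j < length ?w \<longrightarrow> fst (?w ! i) = fst (?w ! j) \<longrightarrow> 0 \<le> s \<longrightarrow> s \<le> 1 \<longrightarrow>
        l ((real i + s) / length ?w) =
        l ((real j + (if snd (?w ! i) = snd (?w ! j) then s else 1 - s)) / length ?w))"
  proof (intro conjI allI impI l01)
    fix i j s assume ij: "i < length ?w" "j < length ?w" "fst (?w ! i) = fst (?w ! j)" "0 \<le> s" "s \<le> (1::real)"
    have "i = 0 \<or> i = 1" "j = 0 \<or> j = 1" using ij by auto
    then show "l ((real i + s) / length ?w) =
        l ((real j + (if snd (?w ! i) = snd (?w ! j) then s else 1 - s)) / length ?w)"
      using glued_sides_log(1)[OF f ij(1-3), of s 0] ij(4,5) l01 by auto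
  qed
qed auto

text \<open>In a commutator word the side \<open>k\<close> carries the letter
  \<open>2 * (k div 4) + k mod 2\<close>. A letter fixes block and parity, which leaves two
  positions.\<close>

lemma block_letter_eq:
  fixes i j k :: nat
  assumes ij: "2 * (i div 4) + i mod 2 = 2 * (j div 4) + j mod 2"
    and ki: "2 * (k div 4) + k mod 2 = 2 * (i div 4) + i mod 2" and "i \<noteq> j"
  shows "k = i \<or> k = j"
proof -
  have split: "a = b \<and> r = s" if "2 * a + r = 2 * b + s" "r < 2" "s < 2" for a b r s :: nat
    using that by presburger
  have four: "c = a \<or> c = b"
    if "a < 4" "b < 4" "c < 4" "a mod 2 = b mod 2" "c mod 2 = a mod 2" "a \<noteq> b" for a b c :: nat
  proof -
    have "a \<in> {0,1,2,3}" "b \<in> {0,1,2,3}" "c \<in> {0,1,2,3}" using that(1-3) by auto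
    then show ?thesis using that(4-6) by auto
  qed
  have 1: "i div 4 = j div 4 \<and> i mod 2 = j mod 2" by (rule split[OF ij]) simp_all
  have 2: "k div 4 = i div 4 \<and> k mod 2 = i mod 2" by (rule split[OF ki]) simp_all
  have m: "(n mod 4) mod 2 = n mod 2" for n :: nat by (rule mod_mod_cancel) simp
  have ne: "i mod 4 \<noteq> j mod 4"
  proof
    assume "i mod 4 = j mod 4"
    then have "i div 4 * 4 + i mod 4 = j div 4 * 4 + j mod 4" using 1 by (simp only:)
    then show False using assms(3) by (simp only: div_mult_mod_eq)
  qed
  have "(i mod 4) mod 2 = (j mod 4) mod 2" "(k mod 4) mod 2 = (i mod 4) mod 2"
    unfolding m using 1 2 by blast+
  then have "k mod 4 = i mod 4 \<or> k mod 4 = j mod 4"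
    using four[OF _ _ _ _ _ ne, of "k mod 4"] by simp
  then show ?thesis
  proof
    assume "k mod 4 = i mod 4"
    then have "k div 4 * 4 + k mod 4 = i div 4 * 4 + i mod 4" using 2 by (simp only:)
    then have "k = i" by (simp only: div_mult_mod_eq)
    then show ?thesis ..
  next
    assume "k mod 4 = j mod 4"
    then have "k div 4 * 4 + k mod 4 = j div 4 * 4 + j mod 4" using 1 2 by (simp only:)
    then have "k = j" by (simp only: div_mult_mod_eq)
    then show ?thesis ..
  qed
qed

text \<open>The prescribed sides are the first occurrences of the letters. Each commutator
  contributes increment 0, so the total winding is 0, and the second occurrences have the negatives
  of the prescribed increments.\<close>

lemma surface_word_orientable_blocks:
  fixes w :: "(nat \<times> bool) list"
  assumes "h > 0" and L: "length w = 4 * h"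
    and nth: "\<And>q c. q < h \<Longrightarrow> c < 4 \<Longrightarrow> w ! (4 * q + c) = (2 * q + c mod 2, c < 2)"
  shows "surface_word w (2 * h) (\<lambda>i. 4 * (i div 2) + i mod 2)" (is "surface_word w _ ?side")
proof
  have fst_nth: "fst (w ! k) = 2 * (k div 4) + k mod 2" if "k < 4 * h" for k
  proof -
    have q: "k div 4 < h" using that by simp
    have "w ! (4 * (k div 4) + k mod 4) = (2 * (k div 4) + (k mod 4) mod 2, k mod 4 < 2)"
      by (rule nth[OF q]) simp
    moreover have "4 * (k div 4) + k mod 4 = k" by simp
    ultimately have "fst (w ! k) = 2 * (k div 4) + (k mod 4) mod 2" by (simp only: fst_conv)
    moreover have "(k mod 4) mod 2 = k mod 2" by (simp add: mod_mod_cancel)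
    ultimately show ?thesis by (simp only:)
  qed
  show "w \<noteq> []" using L assms by auto
  show "k = i \<or> k = j" if ijk: "i < length w" "j < length w" "k < length w" "i \<noteq> j"
    "fst (w ! i) = fst (w ! j)" "fst (w ! k) = fst (w ! i)" for i j k
  proof -
    have "2 * (i div 4) + i mod 2 = 2 * (j div 4) + j mod 2" "2 * (k div 4) + k mod 2 = 2 * (i div 4) + i mod 2"
      using ijk(5,6) fst_nth[of i] fst_nth[of j] fst_nth[of k] ijk(1-3) L by auto
    then show ?thesis using ijk(4) by (rule block_letter_eq)
  qed
  fix f :: "complex \<Rightarrow> complex" and l :: "real \<Rightarrow> real"
  assume f: "glued_on w (sphere 0 1) f" "continuous_on {0..1} l"
    "\<And>t. t \<in> {0..1} \<Longrightarrow> f (cis (2*pi*t)) = cis (l t)"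
  define c where "c = (\<lambda>k::nat. l (real k / length w))"
  have ck: "l (real k / length w) = c k" for k unfolding c_def ..
  have cS: "l ((real k + 1) / length w) = c (k + 1)" for k unfolding c_def of_nat_add of_nat_1 ..
  have nums: "4*q+2+1 = 4*q+3" "4*q+1+1 = 4*q+2" "4*q+3+1 = 4*q+4" for q :: nat by simp_all
  have A: "c (4*q+1) - c (4*q) = c (4*q+2) - c (4*q+3)" "cis (c (4*q)) = cis (c (4*q+3))"
    "cis (c (4*q+1)) = cis (c (4*q+2))" if q: "q < h" for q
  proof -
    have p: "4*q < length w" "4*q+2 < length w" using q L by auto
    have e: "fst (w ! (4*q)) = fst (w ! (4*q+2))" "snd (w ! (4*q)) \<noteq> snd (w ! (4*q+2))"
      using nth[OF q, of 0] nth[OF q, of 2] by simp_all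
    note g = glued_sides_opposite[OF f p e, unfolded ck cS nums]
    show "c (4*q+1) - c (4*q) = c (4*q+2) - c (4*q+3)" by (rule g(1))
    show "cis (c (4*q)) = cis (c (4*q+3))" by (rule g(2))
    show "cis (c (4*q+1)) = cis (c (4*q+2))" by (rule g(3))
  qed
  have B: "c (4*q+2) - c (4*q+1) = c (4*q+3) - c (4*q+4)" "cis (c (4*q+1)) = cis (c (4*q+4))"
    "cis (c (4*q+2)) = cis (c (4*q+3))" if q: "q < h" for q
  proof -
    have p: "4*q+1 < length w" "4*q+3 < length w" using q L by auto
    have e: "fst (w ! (4*q+1)) = fst (w ! (4*q+3))" "snd (w ! (4*q+1)) \<noteq> snd (w ! (4*q+3))"
      using nth[OF q, of 1] nth[OF q, of 3] by simp_all
    note g = glued_sides_opposite[OF f p e, unfolded ck cS nums]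
    show "c (4*q+2) - c (4*q+1) = c (4*q+3) - c (4*q+4)" by (rule g(1))
    show "cis (c (4*q+1)) = cis (c (4*q+4))" by (rule g(2))
    show "cis (c (4*q+2)) = cis (c (4*q+3))" by (rule g(3))
  qed
  have cases4: "\<exists>q<h. k = 4 * q \<or> k = 4*q+1 \<or> k = 4*q+2 \<or> k = 4*q+3" if "k < 4 * h" for k
  proof (intro exI[of _ "k div 4"] conjI)
    show "k div 4 < h" using that by simp
    have "4 * (k div 4) + k mod 4 = k" "k mod 4 < 4" by simp_all
    then show "k = 4 * (k div 4) \<or> k = 4 * (k div 4) + 1 \<or> k = 4 * (k div 4) + 2 \<or> k = 4 * (k div 4) + 3"
      by linarith
  qed
  \<comment> \<open>The gluings within a block identify all of its corners, so every side is a loop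
    on the surface and has an integral winding.\<close>
  have corner: "cis (c (k + 1)) = cis (c k)" if k: "k < 4 * h" for k
  proof -
    obtain q where q: "q < h" "k = 4 * q \<or> k = 4*q+1 \<or> k = 4*q+2 \<or> k = 4*q+3"
      using cases4[OF k] by blast
    show ?thesis using q(2)
      by (elim disjE; simp only: nums) (use A[OF q(1)] B[OF q(1)] in auto)
  qed
  have "c (4 * q) = c 0" if "q \<le> h" for q
    using that
  proof (induction q)
    case (Suc q)
    then have "q < h" by simp
    from A(1)[OF this] B(1)[OF this] have "c (4*q+4) = c (4*q)" by linarith
    then show ?case using Suc by (simp add: add.commute)
  qed simp
  from this[of h] have "l 1 = l 0" using assms(1) unfolding c_def L by simp
  then show "\<exists>k::int. l 1 - l 0 = 4 * pi * k" by (intro exI[of _ 0]) simp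
  have side: "?side i < 4 * h" if "i < 2 * h" for i
  proof -
    have "i div 2 < h" using that by linarith
    moreover have "i mod 2 < 2" by simp
    ultimately show ?thesis by linarith
  qed
  show "\<exists>k::int. l ((real (?side i) + 1) / length w) - l (real (?side i) / length w) = 2 * pi * k"
    if "i < 2 * h" for i
    using corner[OF side[OF that]] unfolding cis_eq_iff ck cS .
  assume z: "\<And>i. i < 2 * h \<Longrightarrow> l ((real (?side i) + 1) / length w) = l (real (?side i) / length w)"
  have z': "c (?side i + 1) = c (?side i)" if "i < 2 * h" for i
    using z[OF that] unfolding ck cS .
  show "l 1 = l 0 \<and> (\<forall>i j s. i < length w \<longrightarrow> j < length w \<longrightarrow> fst (w ! i) = fst (w ! j) \<longrightarrow> 0 \<le> s \<longrightarrow> s \<le> 1 \<longrightarrow>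
        l ((real i + s) / length w) =
        l ((real j + (if snd (w ! i) = snd (w ! j) then s else 1 - s)) / length w))"
  proof (rule zero_winding_all_sides[OF f])
    fix k assume "k < length w"
    then have k: "k < 4 * h" using L by simp
    obtain q where q: "q < h" "k = 4 * q \<or> k = 4*q+1 \<or> k = 4*q+2 \<or> k = 4*q+3"
      using cases4[OF k] by blast
    have a: "c (4*q+1) = c (4*q)" using z'[of "2*q"] q(1) by simp
    have b: "c (4*q+2) = c (4*q+1)" using z'[of "2*q+1"] q(1) by simp
    have "c (k + 1) = c k" using q(2)
      by (elim disjE; simp only: nums) (use A(1)[OF q(1)] B(1)[OF q(1)] a b in linarith)+
    then show "l ((real k + 1) / length w) = l (real k / length w)" unfolding ck cS .
  qed (use L assms in auto)
qed

lemma surface_word_orientable: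
  assumes "h > 0"
  shows "surface_word (concat (map (\<lambda>i. [(2 * i, True), (2 * i + 1, True), (2 * i, False), (2 * i + 1, False)])
    [0..<h])) (2 * h) (\<lambda>i. 4 * (i div 2) + i mod 2)"
proof (rule surface_word_orientable_blocks[OF assms])
  let ?F = "\<lambda>i. [(2 * i, True), (2 * i + 1, True), (2 * i, False), (2 * i + 1, False)]"
  show "length (concat (map ?F [0..<h])) = 4 * h" by (rule length_concat_blocks) simp
  fix q c :: nat assume "q < h" "c < 4"
  then have "concat (map ?F [0..<h]) ! (4 * q + c) = ?F q ! c" by (intro nth_concat_blocks) auto
  moreover have "c = 0 \<or> c = 1 \<or> c = 2 \<or> c = 3" using \<open>c < 4\<close> by linarith
  then have "?F q ! c = (2 * q + c mod 2, c < 2)" by auto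
  ultimately show "concat (map ?F [0..<h]) ! (4 * q + c) = (2 * q + c mod 2, c < 2)" by (rule trans)
qed

lemma pair_letter_eq:
  fixes i j k :: nat
  assumes ij: "i div 2 = j div 2" and ki: "k div 2 = i div 2" and "i \<noteq> j"
  shows "k = i \<or> k = j"
proof -
  have n: "n div 2 * 2 + n mod 2 = n" "n mod 2 < 2" for n :: nat by simp_all
  show ?thesis using n[of i] n[of j] n[of k] assms by linarith
qed

text \<open>Both sides of a square run in the same direction and have the same integral winding, so
  each block contributes an even winding and one prescribed side per block determines all.\<close>

lemma surface_word_nonorientable_blocks:
  fixes w :: "(nat \<times> bool) list"
  assumes "h > 0" and L: "length w = 2 * h"
    and nth: "\<And>q c. q < h \<Longrightarrow> c < 2 \<Longrightarrow> w ! (2 * q + c) = (q, True)"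
  shows "surface_word w h (\<lambda>i. 2 * i)" (is "surface_word w _ ?side")
proof
  have nth': "w ! k = (k div 2, True)" if "k < 2 * h" for k
  proof -
    have q: "k div 2 < h" using that by linarith
    have "w ! (2 * (k div 2) + k mod 2) = (k div 2, True)" by (rule nth[OF q]) simp
    moreover have "2 * (k div 2) + k mod 2 = k" by simp
    ultimately show ?thesis by simp
  qed
  show "w \<noteq> []" using L assms by auto
  show "k = i \<or> k = j" if ijk: "i < length w" "j < length w" "k < length w" "i \<noteq> j"
    "fst (w ! i) = fst (w ! j)" "fst (w ! k) = fst (w ! i)" for i j k
  proof -
    have "i div 2 = j div 2" "k div 2 = i div 2"
      using ijk(5,6) nth'[of i] nth'[of j] nth'[of k] ijk(1-3) L by auto
    then show ?thesis using ijk(4) by (rule pair_letter_eq)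
  qed
  fix f :: "complex \<Rightarrow> complex" and l :: "real \<Rightarrow> real"
  assume f: "glued_on w (sphere 0 1) f" "continuous_on {0..1} l"
    "\<And>t. t \<in> {0..1} \<Longrightarrow> f (cis (2*pi*t)) = cis (l t)"
  define c where "c = (\<lambda>k::nat. l (real k / length w))"
  have ck: "l (real k / length w) = c k" for k unfolding c_def ..
  have cS: "l ((real k + 1) / length w) = c (k + 1)" for k unfolding c_def of_nat_add of_nat_1 ..
  have nums: "2*q+1+1 = 2*q+2" for q :: nat by simp
  have A: "c (2*q+1) - c (2*q) = c (2*q+2) - c (2*q+1)" "cis (c (2*q)) = cis (c (2*q+1))" if q: "q < h" for q
  proof -
    have p: "2*q < length w" "2*q+1 < length w" using q L by auto
    have e: "fst (w ! (2*q)) = fst (w ! (2*q+1))" "snd (w ! (2*q)) = snd (w ! (2*q+1))"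
      using nth[OF q, of 0] nth[OF q, of 1] by simp_all
    note g = glued_sides_same[OF f p e, unfolded ck cS nums]
    show "c (2*q+1) - c (2*q) = c (2*q+2) - c (2*q+1)" by (rule g(1))
    show "cis (c (2*q)) = cis (c (2*q+1))" by (rule g(2))
  qed
  have w: "\<exists>k::int. c (2*q+1) - c (2*q) = 2 * pi * k" if "q < h" for q
    using A(2)[OF that, symmetric] unfolding cis_eq_iff .
  have "\<exists>k::int. c (2 * q) - c 0 = 4 * pi * k" if "q \<le> h" for q
    using that
  proof (induction q)
    case 0 then show ?case by (intro exI[of _ 0]) simp
  next
    case (Suc q)
    then have q: "q < h" "q \<le> h" by auto
    obtain k k' :: int where "c (2 * q) - c 0 = 4 * pi * k" "c (2*q+1) - c (2*q) = 2 * pi * k'"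
      using w[OF q(1)] Suc.IH[OF q(2)] by auto
    then have "c (2 * q + 2) - c 0 = 4 * pi * real_of_int (k + k')"
      using A(1)[OF q(1)] by (simp add: algebra_simps)
    moreover have "2 * Suc q = 2 * q + 2" by simp
    ultimately show ?case by metis
  qed
  from this[of h] show "\<exists>k::int. l 1 - l 0 = 4 * pi * k" using assms(1) unfolding c_def L by simp
  show "\<exists>k::int. l ((real (?side i) + 1) / length w) - l (real (?side i) / length w) = 2 * pi * k"
    if "i < h" for i
    using w[OF that] unfolding ck cS .
  assume z: "\<And>i. i < h \<Longrightarrow> l ((real (?side i) + 1) / length w) = l (real (?side i) / length w)"
  have z': "c (2 * i + 1) = c (2 * i)" if "i < h" for i
    using z[OF that] unfolding ck cS .
  show "l 1 = l 0 \<and> (\<forall>i j s. i < length w \<longrightarrow> j < length w \<longrightarrow> fst (w ! i) = fst (w ! j) \<longrightarrow> 0 \<le> s \<longrightarrow> s \<le> 1 \<longrightarrow>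
        l ((real i + s) / length w) =
        l ((real j + (if snd (w ! i) = snd (w ! j) then s else 1 - s)) / length w))"
  proof (rule zero_winding_all_sides[OF f])
    fix k assume "k < length w"
    then have k: "k < 2 * h" using L by simp
    define q where "q = k div 2"
    have q: "q < h" using k by (simp add: q_def)
    have "k = 2 * q \<or> k = 2*q+1" unfolding q_def by presburger
    then have "c (k + 1) = c k"
      by (elim disjE; simp only: nums) (use A(1)[OF q] z'[OF q] in linarith)+
    then show "l ((real k + 1) / length w) = l (real k / length w)" unfolding ck cS .
  qed (use L assms in auto)
qed

lemma surface_word_nonorientable:
  assumes "h > 0"
  shows "surface_word (concat (map (\<lambda>i. [(i, True), (i, True)]) [0..<h])) h (\<lambda>i. 2 * i)"
proof (rule surface_word_nonorientable_blocks[OF assms])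
  let ?F = "\<lambda>i. [(i, True), (i, True)]"
  show "length (concat (map ?F [0..<h])) = 2 * h" by (rule length_concat_blocks) simp
  fix q c :: nat assume "q < h" "c < 2"
  then have "concat (map ?F [0..<h]) ! (2 * q + c) = ?F q ! c" by (intro nth_concat_blocks) auto
  moreover have "c = 0 \<or> c = 1" using \<open>c < 2\<close> by linarith
  then have "?F q ! c = (q, True)" by auto
  ultimately show "concat (map ?F [0..<h]) ! (2 * q + c) = (q, True)" by (rule trans)
qed

subsection \<open>Bipartite graphs as topological spaces\<close>

definition edge_point :: "'n::finite \<times> 'n \<Rightarrow> real \<Rightarrow> real^'n" where
  "edge_point e t = (1 - t) *\<^sub>R axis (fst e) 1 + t *\<^sub>R axis (snd e) 1"

definition edge_segment :: "'n::finite \<times> 'n \<Rightarrow> (real^'n) set" where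
  "edge_segment e = edge_point e ` {0..1}"

text \<open>All vertices belong to \<open>subgraph B\<close>, also those not incident with \<open>B\<close>.\<close>

definition subgraph :: "('n::finite \<times> 'n) set \<Rightarrow> (real^'n) set" where
  "subgraph B = range (\<lambda>v. axis v 1) \<union> (\<Union>e\<in>B. edge_segment e)"

lemma edge_segment_eq: "edge_segment e = closed_segment (axis (fst e) 1) (axis (snd e) 1)"
  unfolding edge_segment_def edge_point_def closed_segment_def by auto

lemma continuous_on_edge_point: "continuous_on S (edge_point e)"
  unfolding edge_point_def by (intro continuous_intros)

lemma closed_edge_segment: "closed (edge_segment e)"
  unfolding edge_segment_eq by simp

lemma closed_subgraph: "closed (subgraph (B :: ('n::finite \<times> 'n) set))"
  unfolding subgraph_def
  by (intro closed_Un finite_imp_closed closed_UN) (auto simp: closed_edge_segment)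

lemma compact_subgraph: "compact (subgraph (B :: ('n::finite \<times> 'n) set))"
  unfolding subgraph_def edge_segment_eq
  by (rule compact_Un, rule finite_imp_compact, simp, rule compact_UN, auto)

lemma edge_point_0 [simp]: "edge_point e 0 = axis (fst e) 1"
  and edge_point_1 [simp]: "edge_point e 1 = axis (snd e) 1"
  by (simp_all add: edge_point_def)

lemma edge_point_nth:
  "edge_point e t $ v = (if v = fst e then 1 - t else 0) + (if v = snd e then t else 0)"
  by (simp add: edge_point_def axis_def)

lemma subgraph_vertex: "axis v 1 \<in> subgraph B"
  unfolding subgraph_def by blast

lemma subgraph_mono: "B \<subseteq> B' \<Longrightarrow> subgraph B \<subseteq> subgraph B'"
  unfolding subgraph_def by blast

lemma subgraph_insert: "subgraph (insert e B) = edge_segment e \<union> subgraph B"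
  unfolding subgraph_def by blast

text \<open>An edge is listed once, as the pair starting with its coloured end.\<close>

locale bipartite_edges =
  fixes E :: "('n::finite \<times> 'n) set" and col :: "'n \<Rightarrow> bool"
  assumes edge_colour: "\<And>a b. (a, b) \<in> E \<Longrightarrow> col a \<and> \<not> col b"
begin

lemma edge_ends_neq: "e \<in> E \<Longrightarrow> fst e \<noteq> snd e"
  using edge_colour[of "fst e" "snd e"] by auto

lemma edge_point_snd: "e \<in> E \<Longrightarrow> edge_point e t $ snd e = t"
  using edge_ends_neq[of e] by (simp add: edge_point_nth)

lemma open_edge_not_vertex:
  assumes "e \<in> E" "0 < t" "t < 1" shows "edge_point e t \<noteq> axis v 1"
proof
  assume eq: "edge_point e t = axis v 1"
  have "edge_point e t $ snd e = t" "edge_point e t $ fst e = 1 - t"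
    using edge_ends_neq[OF assms(1)] by (auto simp: edge_point_nth)
  then show False using assms(2,3) unfolding eq by (auto simp: axis_def split: if_splits)
qed

text \<open>The nonzero coordinates of an inner point of an edge are exactly its two ends, and the
  colours tell which end comes first, so the point determines the edge.\<close>

lemma open_edge_not_other:
  assumes "e \<in> E" "e' \<in> E" "e \<noteq> e'" "0 < t" "t < 1" shows "edge_point e t \<notin> edge_segment e'"
proof
  assume "edge_point e t \<in> edge_segment e'"
  then obtain s where s: "edge_point e t = edge_point e' s" unfolding edge_segment_def by blast
  have "edge_point e t $ snd e \<noteq> 0" "edge_point e t $ fst e \<noteq> 0"
    using edge_ends_neq[OF assms(1)] assms(4,5) by (auto simp: edge_point_nth)
  then have "snd e \<in> {fst e', snd e'}" "fst e \<in> {fst e', snd e'}"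
    unfolding s by (auto simp: edge_point_nth split: if_splits)
  moreover have "col (fst e)" "\<not> col (snd e)" "col (fst e')" "\<not> col (snd e')"
    using edge_colour[of "fst e" "snd e"] edge_colour[of "fst e'" "snd e'"] assms(1,2) by auto
  ultimately have "snd e = snd e'" "fst e = fst e'" by auto
  then show False using assms(3) by (simp add: prod_eq_iff)
qed

lemma open_edge_notin_subgraph:
  assumes "e \<in> E" "B \<subseteq> E" "e \<notin> B" "0 < t" "t < 1" shows "edge_point e t \<notin> subgraph B"
  using open_edge_not_vertex[OF assms(1,4,5)] open_edge_not_other[OF assms(1) _ _ assms(4,5)] assms(2,3)
  unfolding subgraph_def by blast

lemma edge_segment_Int_subgraph:
  assumes "e \<in> E" "B \<subseteq> E" "e \<notin> B" "x \<in> edge_segment e" "x \<in> subgraph B"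
  shows "x = axis (fst e) 1 \<or> x = axis (snd e) 1"
proof -
  obtain t where t: "t \<in> {0..1}" "x = edge_point e t" using assms(4) unfolding edge_segment_def by blast
  then have "t = 0 \<or> t = 1" using open_edge_notin_subgraph[OF assms(1-3), of t] assms(5) by force
  then show ?thesis using t by auto
qed

text \<open>Allows the edges outside \<open>B\<close> to be discarded one at a time: an inner point
  of an edge \<open>e\<close> is lost as soon as \<open>e\<close> alone is removed.\<close>

lemma subgraph_Int:
  assumes "x \<in> subgraph E" "B \<subseteq> E" "\<And>e. e \<in> E - B \<Longrightarrow> x \<in> subgraph (E - {e})"
  shows "x \<in> subgraph B"
proof (rule ccontr)
  assume x: "x \<notin> subgraph B"
  then obtain e where e: "e \<in> E - B" "x \<in> edge_segment e"
    using assms(1) unfolding subgraph_def by blast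
  then have "x = axis (fst e) 1 \<or> x = axis (snd e) 1"
    using edge_segment_Int_subgraph[of e "E - {e}" x] assms(3) by auto
  then show False using x subgraph_vertex by metis
qed

text \<open>The coordinate \<open>x $ snd e\<close> is the parameter along \<open>e\<close>; it is 0
  and 1 at the ends, so the map closes up to a loop of degree one.\<close>

definition edge_wind :: "'n \<times> 'n \<Rightarrow> real^'n \<Rightarrow> complex" where
  "edge_wind e x = (if x \<in> edge_segment e then cis (2 * pi * (x $ snd e)) else 1)"

lemma continuous_on_edge_paste:
  fixes f g :: "real^'n \<Rightarrow> 'a::topological_space"
  assumes e: "e \<in> E" and f: "continuous_on (edge_segment e) f" and g: "continuous_on (subgraph (E - {e})) g"
    and "f (axis (fst e) 1) = g (axis (fst e) 1)" "f (axis (snd e) 1) = g (axis (snd e) 1)"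
  shows "continuous_on (subgraph E) (\<lambda>x. if x \<in> edge_segment e then f x else g x)"
proof -
  have "continuous_on (edge_segment e \<union> subgraph (E - {e})) (\<lambda>x. if x \<in> edge_segment e then f x else g x)"
  proof (rule continuous_on_cases)
    show "\<forall>x. x \<in> edge_segment e \<and> x \<notin> edge_segment e \<or> x \<in> subgraph (E - {e}) \<and> x \<in> edge_segment e \<longrightarrow> f x = g x"
      using edge_segment_Int_subgraph[OF e, of "E - {e}"] assms(4,5) by blast
    show "closed (edge_segment e)" by (rule closed_edge_segment)
    show "closed (subgraph (E - {e}))" by (rule closed_subgraph)
  qed (rule f g)+
  moreover have "edge_segment e \<union> subgraph (E - {e}) = subgraph E"
    using subgraph_insert[of e "E - {e}"] e by (simp add: insert_absorb)
  ultimately show ?thesis by simp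
qed

lemma continuous_on_edge_wind: "e \<in> E \<Longrightarrow> continuous_on (subgraph E) (edge_wind e)"
  unfolding edge_wind_def
proof (rule continuous_on_edge_paste)
  assume e: "e \<in> E"
  show "continuous_on (edge_segment e) (\<lambda>x. cis (2 * pi * (x $ snd e)))"
    by (intro continuous_intros continuous_on_cis)
  show "cis (2 * pi * (axis (fst e) 1 $ snd e)) = 1" "cis (2 * pi * (axis (snd e) 1 $ snd e)) = 1"
    using edge_ends_neq[OF e] by (auto simp: axis_def complex_eq_iff)
qed auto

lemma norm_edge_wind: "norm (edge_wind e x) = 1"
  by (simp add: edge_wind_def)

lemma edge_wind_own: "e \<in> E \<Longrightarrow> t \<in> {0..1} \<Longrightarrow> edge_wind e (edge_point e t) = cis (2 * pi * t)"
  unfolding edge_wind_def by (auto simp: edge_point_snd edge_segment_def)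

lemma edge_wind_other:
  assumes "e \<in> E" "e' \<in> E" "e \<noteq> e'" "t \<in> {0..1}"
  shows "edge_wind e (edge_point e' t) = 1"
proof (cases "t = 0 \<or> t = 1")
  case True
  then obtain v where v: "edge_point e' t = axis v 1" by auto
  show ?thesis using v by (auto simp: edge_wind_def axis_def complex_eq_iff)
next
  case False
  then show ?thesis
    using open_edge_not_other[OF assms(2,1), of t] assms(3,4) by (auto simp: edge_wind_def)
qed

text \<open>A bipartite graph with at most three edges is a forest: if an edge is no leaf, it is the
  middle edge of a path of length three, whose end edges are leaves.\<close>

lemma leaf_exists:
  assumes "B \<subseteq> E" "B \<noteq> {}" "card B \<le> 3"
  obtains e v v' where "e \<in> B" "{v, v'} = {fst e, snd e}" "v \<noteq> v'"
    "\<And>e'. e' \<in> B - {e} \<Longrightarrow> v \<noteq> fst e' \<and> v \<noteq> snd e'"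
proof -
  have finB: "finite B" by simp
  obtain a b where ab: "(a, b) \<in> B" using assms(2) by auto
  have colB: "col x \<and> \<not> col y" if "(x, y) \<in> B" for x y using edge_colour that assms(1) by blast
  have nb: "a \<noteq> b" using colB[OF ab] by auto
  consider "\<forall>e'\<in>B - {(a,b)}. a \<noteq> fst e' \<and> a \<noteq> snd e'" | "\<forall>e'\<in>B - {(a,b)}. b \<noteq> fst e' \<and> b \<noteq> snd e'"
    | e2 e3 where "e2 \<in> B - {(a,b)}" "a = fst e2 \<or> a = snd e2" "e3 \<in> B - {(a,b)}" "b = fst e3 \<or> b = snd e3"
    by blast
  then show thesis
  proof cases
    case 1
    then show thesis using that[of "(a,b)" a b] ab nb by auto
  next
    case 2
    then show thesis using that[of "(a,b)" b a] ab nb by auto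
  next
    case 3
    obtain d c where e2: "e2 = (a, d)" and e3: "e3 = (c, b)"
      using 3 colB[OF ab] colB[of "fst e2" "snd e2"] colB[of "fst e3" "snd e3"] by (metis DiffD1 prod.collapse)
    have ne: "d \<noteq> b" "c \<noteq> a" using 3 e2 e3 by auto
    have "card {(a,b), (a,d), (c,b)} = 3" using ne by auto
    moreover have "{(a,b), (a,d), (c,b)} \<subseteq> B" using ab 3 e2 e3 by auto
    ultimately have B: "B = {(a,b), (a,d), (c,b)}"
      using card_seteq[OF finB, of "{(a,b), (a,d), (c,b)}"] assms(3) by simp
    have col: "col a" "\<not> col d" "col c" "\<not> col b" using colB B by auto
    have ad: "a \<noteq> d" "c \<noteq> d" using col by auto
    show thesis
      \<comment> \<open>\<open>d\<close> is a leaf: the colours exclude \<open>d = c\<close>, which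
        would close a triangle.\<close>
      by (rule that[of "(a,d)" d a]) (use B ne ad col in auto)
  qed
qed

text \<open>Few edges form a forest, so logarithms can be built by attaching leaf edges; each meets
  the rest in one vertex, where a constant shift makes the pieces agree.\<close>

lemma circle_log_small_subgraph:
  fixes f :: "real^'n \<Rightarrow> complex"
  assumes "B \<subseteq> E" "card B \<le> 3" "continuous_on (subgraph B) f" "f ` subgraph B \<subseteq> sphere 0 1"
  shows "\<exists>l::real^'n \<Rightarrow> real. continuous_on (subgraph B) l \<and> (\<forall>x\<in>subgraph B. f x = cis (l x))"
  using assms
proof (induction "card B" arbitrary: B)
  case 0
  then have "B = {}" by simp
  then have fin: "finite (subgraph B)" by (simp add: subgraph_def)
  have "f x = cis (Arg (f x))" if "x \<in> subgraph B" for x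
  proof -
    have "norm (f x) = 1" using 0 that by auto
    then show ?thesis using cis_Arg[of "f x"] by (metis norm_zero sgn_eq div_by_1 of_real_1 zero_neq_one)
  qed
  then show ?case using continuous_on_finite[OF fin] by (intro exI[of _ "\<lambda>x. Arg (f x)"]) auto
next
  case (Suc k)
  then have "B \<noteq> {}" by auto
  then obtain e v v' where e: "e \<in> B" "{v, v'} = {fst e, snd e}" "v \<noteq> v'"
    "\<And>e'. e' \<in> B - {e} \<Longrightarrow> v \<noteq> fst e' \<and> v \<noteq> snd e'"
    using leaf_exists[OF Suc.prems(1) _ Suc.prems(2)] by blast
  let ?B = "B - {e}"
  have eE: "e \<in> E" "?B \<subseteq> E" using e Suc.prems(1) by auto
  have "k = card ?B" using Suc.hyps(2) e(1) by simp
  moreover have sub: "subgraph ?B \<subseteq> subgraph B" by (rule subgraph_mono) auto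
  ultimately have "\<exists>l::real^'n \<Rightarrow> real. continuous_on (subgraph ?B) l \<and> (\<forall>x\<in>subgraph ?B. f x = cis (l x))"
    using Suc.prems Suc.hyps(2) by (intro Suc.hyps(1)) (auto intro: continuous_on_subset)
  then obtain l' :: "real^'n \<Rightarrow> real" where l': "continuous_on (subgraph ?B) l'" "\<And>x. x\<in>subgraph ?B \<Longrightarrow> f x = cis (l' x)"
    by blast
  have seg: "edge_segment e \<subseteq> subgraph B" using e(1) unfolding subgraph_def by blast
  have "contractible (edge_segment e)"
    unfolding edge_segment_eq by (simp add: convex_imp_contractible)
  then obtain le where le: "continuous_on (edge_segment e) le" "\<And>x. x \<in> edge_segment e \<Longrightarrow> f x = cis (le x)"
    using circle_log_contractible[of "edge_segment e" f] Suc.prems(3,4) seg continuous_on_subset by blast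
  let ?x = "axis v' 1 :: real^'n"
  have xin: "?x \<in> edge_segment e" "axis v 1 \<in> edge_segment e"
    using e(2) unfolding edge_segment_eq by (auto simp: doubleton_eq_iff)
  define c where "c = l' ?x - le ?x"
  have c1: "cis c = 1"
  proof -
    have "cis (l' ?x) = cis (le ?x)" using l'(2)[of ?x] le(2)[of ?x] xin subgraph_vertex by metis
    then show ?thesis by (simp add: c_def cis_divide[symmetric])
  qed
  \<comment> \<open>The leaf vertex \<open>v\<close> is left out, because \<open>subgraph ?B\<close>
    retains it as an isolated point, where \<open>l'\<close> need not match the logarithm on the
    edge.\<close>
  define R where "R = (\<lambda>a. axis a (1::real)) ` (- {v}) \<union> (\<Union>e'\<in>?B. edge_segment e')"
  have clR: "closed R" unfolding R_def
    by (intro closed_Un finite_imp_closed closed_UN) (auto simp: closed_edge_segment)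
  have Rsub: "R \<subseteq> subgraph ?B" unfolding R_def subgraph_def by blast
  have vR: "axis v 1 \<notin> R"
  proof
    assume "axis v 1 \<in> R"
    then consider a where "a \<noteq> v" "axis v (1::real) = axis a 1" | e' where "e' \<in> ?B" "axis v 1 \<in> edge_segment e'"
      unfolding R_def by blast
    then show False
    proof cases
      case 1 then show False by (simp add: axis_eq_axis)
    next
      case 2
      then obtain t where t: "axis v 1 = edge_point e' t" unfolding edge_segment_def by blast
      have "edge_point e' t $ v = 1" using t[symmetric] by (simp add: axis_def)
      then show False using e(4)[OF 2(1)] by (auto simp: edge_point_nth)
    qed
  qed
  have un: "subgraph B = edge_segment e \<union> R"
  proof -
    have "subgraph B = edge_segment e \<union> subgraph ?B"
      using subgraph_insert[of e ?B] e(1) by (simp add: insert_absorb)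
    moreover have "subgraph ?B \<subseteq> edge_segment e \<union> R"
      using xin(2) unfolding subgraph_def R_def by blast
    ultimately show ?thesis using Rsub by blast
  qed
  have meet: "x = ?x" if "x \<in> edge_segment e" "x \<in> R" for x
  proof -
    have "x = axis (fst e) 1 \<or> x = axis (snd e) 1"
      using edge_segment_Int_subgraph[OF eE _ that(1)] Rsub that(2) by blast
    then have "x = axis v 1 \<or> x = axis v' 1" using e(2) by (auto simp: doubleton_eq_iff)
    then show ?thesis using vR that(2) by blast
  qed
  show ?case
  proof (intro exI[of _ "\<lambda>x. if x \<in> edge_segment e then le x + c else l' x"] conjI ballI)
    show "continuous_on (subgraph B) (\<lambda>x. if x \<in> edge_segment e then le x + c else l' x)"
      unfolding un
    proof (rule continuous_on_cases)
      show "continuous_on (edge_segment e) (\<lambda>x. le x + c)" using le(1) by (intro continuous_intros)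
      show "continuous_on R l'" using l'(1) Rsub continuous_on_subset by blast
      show "\<forall>x. x \<in> edge_segment e \<and> x \<notin> edge_segment e \<or> x \<in> R \<and> x \<in> edge_segment e \<longrightarrow> le x + c = l' x"
        using meet by (auto simp: c_def)
      show "closed (edge_segment e)" by (rule closed_edge_segment)
    qed (rule clR)
    fix x assume x: "x \<in> subgraph B"
    show "f x = cis (if x \<in> edge_segment e then le x + c else l' x)"
    proof (cases "x \<in> edge_segment e")
      case True
      then show ?thesis using le(2) c1 by (simp add: cis_mult[symmetric])
    next
      case False
      then have "x \<in> subgraph ?B" using x un Rsub by blast
      then show ?thesis using False l'(2) by simp
    qed
  qed
qed

text \<open>A tree is grown by edges leaving the current vertex set. It is recorded through its
  number of edges and the rigidity of vertex functions, the form in which cycles are later shown to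
  be independent.\<close>

lemma spanning_tree:
  assumes conn: "\<And>W. W \<noteq> {} \<Longrightarrow> W \<noteq> UNIV \<Longrightarrow> \<exists>(a, b)\<in>E. a \<in> W \<longleftrightarrow> b \<notin> W"
  obtains T where "T \<subseteq> E" "card T + 1 = CARD('n)"
    "\<And>l :: 'n \<Rightarrow> real. (\<And>a b. (a, b) \<in> T \<Longrightarrow> l a = l b) \<Longrightarrow> \<forall>a b. l a = l b"
proof -
  have "\<exists>W T. card W = Suc k \<and> T \<subseteq> E \<inter> (W \<times> W) \<and> card T = k \<and>
      (\<forall>l :: 'n \<Rightarrow> real. (\<forall>(a, b)\<in>T. l a = l b) \<longrightarrow> (\<forall>a\<in>W. \<forall>b\<in>W. l a = l b))"
    if "Suc k \<le> CARD('n)" for k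
    using that
  proof (induction k)
    case 0
    show ?case by (intro exI[of _ "{undefined}"] exI[of _ "{}"]) auto
  next
    case (Suc k)
    then obtain W T where WT: "card W = Suc k" "T \<subseteq> E \<inter> (W \<times> W)" "card T = k"
      "\<And>l :: 'n \<Rightarrow> real. (\<forall>(a, b)\<in>T. l a = l b) \<Longrightarrow> (\<forall>a\<in>W. \<forall>b\<in>W. l a = l b)"
      by auto
    have "W \<noteq> {}" "W \<noteq> UNIV" using WT(1) Suc.prems by auto
    then obtain a b where ab: "(a, b) \<in> E" "a \<in> W \<longleftrightarrow> b \<notin> W" using conn by blast
    obtain x y where xy: "x \<in> W" "y \<notin> W" "{x, y} = {a, b}" using ab(2) by (cases "a \<in> W") auto
    have new: "(a, b) \<notin> T" using WT(2) ab(2) by blast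
    show ?case
    proof (intro exI[of _ "insert y W"] exI[of _ "insert (a,b) T"] conjI allI impI)
      show "card (insert y W) = Suc (Suc k)" using WT(1) xy(2) by simp
      show "insert (a, b) T \<subseteq> E \<inter> (insert y W \<times> insert y W)"
        using WT(2) ab(1) xy by (auto simp: doubleton_eq_iff)
      show "card (insert (a, b) T) = Suc k" using WT(3) new by simp
      fix l :: "'n \<Rightarrow> real" assume l: "\<forall>(a, b)\<in>insert (a, b) T. l a = l b"
      then have "\<forall>a\<in>W. \<forall>b\<in>W. l a = l b" using WT(4)[of l] by blast
      moreover have "l x = l y" using l xy(3) by (auto simp: doubleton_eq_iff)
      ultimately show "\<forall>a\<in>insert y W. \<forall>b\<in>insert y W. l a = l b" using xy(1) by (metis insert_iff)
    qed
  qed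
  from this[of "CARD('n) - 1"]
  obtain W T where WT: "card W = CARD('n)" "T \<subseteq> E \<inter> (W \<times> W)" "card T = CARD('n) - 1"
      "\<forall>l :: 'n \<Rightarrow> real. (\<forall>(a, b)\<in>T. l a = l b) \<longrightarrow> (\<forall>a\<in>W. \<forall>b\<in>W. l a = l b)"
    by auto
  have W: "W = UNIV" using WT(1) card_eq_UNIV_imp_eq_UNIV[of W] by simp
  show thesis
  proof
    show "T \<subseteq> E" using WT(2) by blast
    show "card T + 1 = CARD('n)" using WT(3) by (simp add: card_gt_0_iff Suc_leI)
    show "\<forall>a b. l a = l b" if "\<And>a b. (a, b) \<in> T \<Longrightarrow> l a = l b" for l :: "'n \<Rightarrow> real"
      using WT(4) that unfolding W by blast
  qed
qed

end

subsection \<open>Counting faces of an embedded graph\<close>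

text \<open>On the added part of \<open>K\<close> the representing product itself supplies the
  values.\<close>

lemma pole_map_enlarge:
  assumes "pole_map w K' d f" "K' \<subseteq> K" "\<And>p. d p \<noteq> 0 \<Longrightarrow> p \<notin> K"
  obtains f' where "pole_map w K d f'" "\<And>z. z \<in> K' \<Longrightarrow> f' z = f z"
proof -
  obtain c where c: "finite {p. d p \<noteq> 0}" "\<And>p. d p \<noteq> 0 \<Longrightarrow> p \<in> ball 0 1 \<and> p \<notin> K'"
    "glued_on w (sphere 0 1) f" "continuous_on (cball 0 1) c"
    "\<And>z. z \<in> cball 0 1 \<Longrightarrow> norm (c z) = 1"
    "\<And>z. z \<in> sphere 0 1 \<union> K' \<Longrightarrow> f z = c z * pole_prod d z"
    using assms(1) by (rule pole_mapE) (rule that)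
  let ?f = "\<lambda>z. c z * pole_prod d z"
  have "pole_map w K d ?f"
  proof (rule pole_mapI[OF c(1) _ _ c(4)])
    show "{p. d p \<noteq> 0} \<subseteq> ball 0 1 - K" using c(2) assms(3) by blast
    show "glued_on w (sphere 0 1) ?f" using c(3,6) unfolding glued_on_def by auto
    show "c ` cball 0 1 \<subseteq> sphere 0 1" using c(5) by auto
  qed simp
  then show thesis using that[of ?f] c(6) by auto
qed

text \<open>Dividing \<open>b\<close> and \<open>- a\<close> by their gcd gives coprime
  coefficients, which cannot both be even.\<close>

lemma coprime_relation:
  fixes a b :: int
  obtains x y where "x * a + y * b = 0" "odd x \<or> odd y"
proof (cases "a = 0 \<and> b = 0")
  case True
  then show thesis using that[of 1 0] by simp
next
  case False
  obtain a' b' where ab: "a = gcd a b * a'" "b = gcd a b * b'" "coprime a' b'"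
    using gcd_coprime_exists[of a b] False by (auto simp: mult.commute)
  have "b' * a + (- a') * b = 0" by (subst ab(1), subst ab(2)) (simp add: algebra_simps)
  moreover have "odd b' \<or> odd (- a')" using ab(3) by (auto dest: coprime_common_divisor)
  ultimately show thesis by (rule that)
qed

text \<open>\<open>u\<close> is the projection of the preimage \<open>K\<close> of the embedded graph onto the abstract graph.\<close>

locale embedded_graph = surface_word w g side + bipartite_edges E col
  for w g side and E :: "('n::finite \<times> 'n) set" and col +
  fixes K :: "complex set" and u :: "complex \<Rightarrow> real^'n"
  assumes closed_K: "closed K" and K_subset: "K \<subseteq> cball 0 1" and K_saturated: "saturated w K"
    and u_cont: "continuous_on K u" and u_onto: "u ` K = subgraph E"
    and u_glued: "\<And>x y. (x, y) \<in> side_gluing w \<Longrightarrow> x \<in> K \<Longrightarrow> u x = u y"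
    and u_fibre: "\<And>x y. x \<in> K \<Longrightarrow> y \<in> K \<Longrightarrow> u x = u y \<Longrightarrow> (x, y) \<in> (side_gluing w)\<^sup>*"
begin

definition pre :: "(real^'n) set \<Rightarrow> complex set" where
  "pre Y = {z \<in> K. u z \<in> Y}"

lemma pre_subset_K: "pre Y \<subseteq> K" by (auto simp: pre_def)

lemma pre_subgraph: "pre (subgraph E) = K" using u_onto by (auto simp: pre_def)

lemma image_pre: "Y \<subseteq> subgraph E \<Longrightarrow> u ` pre Y = Y" using u_onto by (auto simp: pre_def)

lemma pre_ex: "Y \<subseteq> subgraph E \<Longrightarrow> x \<in> Y \<Longrightarrow> \<exists>z\<in>pre Y. x = u z"
  using image_pre[of Y] by (metis imageE)

lemma saturated_pre: "saturated w (pre Y)"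
  using K_saturated u_glued unfolding saturated_def pre_def by fastforce

lemma closed_pre: "closed Y \<Longrightarrow> closed (pre Y)"
  unfolding pre_def using continuous_closed_preimage[OF u_cont closed_K] by (simp add: vimage_def Collect_conj_eq)

lemma closed_set_pre: "closed Y \<Longrightarrow> surface_closed_set w g side (pre Y)"
  using closed_pre saturated_pre pre_subset_K K_subset by unfold_locales (blast | assumption)+

lemma glued_on_comp: "glued_on w (pre Y) (\<lambda>z. f (u z))"
  unfolding glued_on_def pre_def using u_glued by fastforce

lemma continuous_on_comp: "continuous_on Y f \<Longrightarrow> continuous_on (pre Y) (\<lambda>z. f (u z))"
  by (rule continuous_on_compose2[OF _ continuous_on_subset[OF u_cont pre_subset_K]]) (auto simp: pre_def)

text \<open>The fibres of \<open>u\<close> are joined by chains of gluing steps, so \<open>h\<close>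
  is constant on them, and \<open>u\<close> is a quotient map by compactness. Functions on the
  polygon thus become functions on the graph even for a wild embedding.\<close>

lemma descend:
  fixes h :: "complex \<Rightarrow> 'a::t2_space"
  assumes Y: "closed Y" "Y \<subseteq> subgraph E" and h: "continuous_on (pre Y) h" "glued_on w (pre Y) h"
  obtains f where "continuous_on Y f" "\<And>z. z \<in> pre Y \<Longrightarrow> h z = f (u z)"
proof -
  have compact: "compact (pre Y)"
    using closed_pre[OF Y(1)] bounded_subset[OF bounded_cball] pre_subset_K K_subset
    by (meson compact_eq_bounded_closed subset_trans)
  have fib: "h x = h y" if x: "x \<in> pre Y" and y: "y \<in> pre Y" and "u x = u y" for x y
  proof -
    have "(x, y) \<in> (side_gluing w)\<^sup>*" using u_fibre that by (auto simp: pre_def)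
    then have "y \<in> pre Y \<and> h x = h y"
    proof (induction rule: rtrancl_induct)
      case (step a b)
      then have "b \<in> pre Y" using saturated_pre[of Y] unfolding saturated_def by blast
      then show ?case using step h(2) unfolding glued_on_def by auto
    qed (use x in simp)
    then show ?thesis by blast
  qed
  define f where "f = (\<lambda>y. h (SOME z. z \<in> pre Y \<and> u z = y))"
  have f: "f (u z) = h z" if "z \<in> pre Y" for z
  proof -
    have "(SOME z'. z' \<in> pre Y \<and> u z' = u z) \<in> pre Y \<and> u (SOME z'. z' \<in> pre Y \<and> u z' = u z) = u z"
      by (rule someI[of _ z]) (use that in simp)
    then show ?thesis using fib that unfolding f_def by blast
  qed
  have "continuous_on (pre Y) (\<lambda>z. f (u z)) \<longleftrightarrow> continuous_on (pre Y) h"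
    by (rule continuous_on_cong) (use f in auto)
  then have "continuous_on (u ` pre Y) f"
    using compact h(1) pre_subset_K u_cont continuous_on_subset
    by (intro continuous_on_compact_image) blast+
  then show thesis using that[of f] f image_pre[OF Y(2)] by simp
qed

definition unlinked :: "complex set \<Rightarrow> bool" where
  "unlinked R \<longleftrightarrow> R \<subseteq> ball 0 1 - K \<and> (\<forall>p\<in>R. \<forall>q\<in>R. p \<noteq> q \<longrightarrow> \<not> linked w K p q)"

text \<open>The edges bordering a face: those without which the face is no longer bounded by the graph.\<close>

definition face_edges :: "complex \<Rightarrow> ('n \<times> 'n) set" where
  "face_edges p = {e \<in> E. \<not> closure (face w K p) \<subseteq> face w K p \<union> pre (subgraph (E - {e}))}"

lemma surface_K: "surface_closed_set w g side K"
  using closed_set_pre[OF closed_subgraph[of E]] unfolding pre_subgraph .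

text \<open>A frontier point of the face survives the removal of each non-bordering edge separately,
  hence of all of them together. The face is therefore still a region for its own boundary.\<close>

lemma region_face_edges: "region w (pre (subgraph (face_edges p))) (face w K p)"
proof -
  interpret P: surface_closed_set w g side K by (rule surface_K)
  have r: "region w K (face w K p)" by (rule P.region_face)
  have "closure (face w K p) \<subseteq> face w K p \<union> pre (subgraph (face_edges p))"
  proof
    fix z assume z: "z \<in> closure (face w K p)"
    show "z \<in> face w K p \<union> pre (subgraph (face_edges p))"
    proof (cases "z \<in> face w K p")
      case False
      then have zK: "z \<in> K" using z r unfolding region_def by blast
      have "u z \<in> subgraph (face_edges p)"
      proof (rule subgraph_Int)
        show "u z \<in> subgraph E" using zK u_onto by blast
        show "face_edges p \<subseteq> E" by (auto simp: face_edges_def)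
        fix e assume "e \<in> E - face_edges p"
        then have "closure (face w K p) \<subseteq> face w K p \<union> pre (subgraph (E - {e}))"
          by (auto simp: face_edges_def)
        then show "u z \<in> subgraph (E - {e})" using z False by (auto simp: pre_def)
      qed
      then show ?thesis using zK by (simp add: pre_def)
    qed simp
  qed
  then show ?thesis using r pre_subset_K unfolding region_def by blast
qed

text \<open>Otherwise the boundary carries no essential circle-valued map, and a map with simple poles at
  \<open>p\<close> and \<open>q\<close> could be cut off outside the face of \<open>p\<close>, leaving a single pole of odd degree.\<close>

lemma face_has_four_edges:
  assumes p: "p \<in> ball 0 1 - K" and q: "q \<in> ball 0 1 - K" and nl: "\<not> linked w K p q"
  shows "4 \<le> card (face_edges p)"
proof (rule ccontr)
  assume "\<not> 4 \<le> card (face_edges p)"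
  then have B3: "card (face_edges p) \<le> 3" by simp
  let ?B = "face_edges p" and ?F = "face w K p"
  have BE: "?B \<subseteq> E" by (auto simp: face_edges_def)
  interpret P: surface_closed_set w g side K by (rule surface_K)
  interpret Q: surface_closed_set w g side "pre (subgraph ?B)" by (rule closed_set_pre[OF closed_subgraph])
  \<comment> \<open>With nothing to avoid, the whole open disc is convex and any two poles can be
    traded; this supplies a map with simple poles at \<open>p\<close> and \<open>q\<close>.\<close>
  have "linked w {} p q" by (rule linked_convex[of "ball 0 1"]) (use p q in auto)
  then obtain e f where ef: "pole_map w {} (\<lambda>z. point_pole p z + e * point_pole q z) f"
    unfolding linked_def by blast
  let ?d = "\<lambda>z. point_pole p z + e * point_pole q z"
  have off: "z \<notin> pre (subgraph ?B)" if "?d z \<noteq> 0" for z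
    using that p q pre_subset_K by (auto simp: point_pole_def split: if_splits)
  obtain f' where f': "pole_map w (pre (subgraph ?B)) ?d f'"
    using pole_map_enlarge[OF ef, of "pre (subgraph ?B)"] off by blast
  have Bsub: "subgraph ?B \<subseteq> subgraph E" by (rule subgraph_mono[OF BE])
  have fc: "continuous_on (pre (subgraph ?B)) f'"
    using pole_map_continuous[OF f' Q.K_subset] continuous_on_subset by blast
  have fg: "glued_on w (pre (subgraph ?B)) f'"
    using f' side_gluing_on_sphere unfolding pole_map_def glued_on_def by fastforce
  obtain h where h: "continuous_on (subgraph ?B) h" "\<And>z. z \<in> pre (subgraph ?B) \<Longrightarrow> f' z = h (u z)"
    using descend[OF closed_subgraph Bsub fc fg] by blast
  have "norm (h x) = 1" if x: "x \<in> subgraph ?B" for x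
  proof -
    obtain z where "z \<in> pre (subgraph ?B)" "x = u z" using pre_ex[OF Bsub x] by blast
    then show ?thesis using h(2) pole_map_norm[OF f' Q.K_subset, of z] by simp
  qed
  then have "h ` subgraph ?B \<subseteq> sphere 0 1" by auto
  then obtain l :: "real^'n \<Rightarrow> real" where l: "continuous_on (subgraph ?B) l" "\<forall>x\<in>subgraph ?B. h x = cis (l x)"
    using circle_log_small_subgraph[OF BE B3 h(1)] by blast
  have "even (\<Sum>z | (if z \<in> ?F then ?d z else 0) \<noteq> 0. if z \<in> ?F then ?d z else 0)"
  proof (rule Q.region_degree_even[OF f' region_face_edges])
    show "continuous_on (pre (subgraph ?B)) (\<lambda>z. l (u z))" by (rule continuous_on_comp[OF l(1)])
    show "glued_on w (pre (subgraph ?B)) (\<lambda>z. l (u z))" by (rule glued_on_comp)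
    show "f' z = cis (l (u z))" if "z \<in> pre (subgraph ?B)" for z
      using h(2)[OF that] l(2) that by (simp add: pre_def)
  qed
  moreover have "p \<in> ?F" using P.face_ball[of p p] p linked_refl by blast
  moreover have "q \<notin> ?F" using P.face_ball[of q p] q nl by blast
  ultimately have "even (\<Sum>z\<in>{p}. (1::int))"
  proof -
    assume ev: "even (\<Sum>z | (if z \<in> ?F then ?d z else 0) \<noteq> 0. if z \<in> ?F then ?d z else 0)"
      and pF: "p \<in> ?F" and qF: "q \<notin> ?F"
    \<comment> \<open>Exactly one of the two poles is in the face of \<open>p\<close>, so the degree
      there is 1.\<close>
    have "(if z \<in> ?F then ?d z else 0) = (if z = p then 1 else 0)" for z
      using pF qF by (auto simp: point_pole_def)
    then show ?thesis using ev by simp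
  qed
  then show False by simp
qed

text \<open>Deleting a bordering edge must enlarge the face. If it did not swallow the open edge,
  connectedness would keep the open edge entirely outside \<open>F'\<close>; links could then be
  localised to \<open>F'\<close>, the face would be the same as before, and its frontier would avoid
  the open edge.\<close>

lemma edge_interior_in_face:
  assumes e: "e \<in> face_edges p" and p: "p \<in> ball 0 1 - K"
  shows "K - pre (subgraph (E - {e})) \<subseteq> face w (pre (subgraph (E - {e}))) p"
proof (rule ccontr)
  define K' where "K' = pre (subgraph (E - {e}))"
  define F where "F = face w K p"
  define F' where "F' = face w K' p"
  assume "\<not> K - pre (subgraph (E - {e})) \<subseteq> face w (pre (subgraph (E - {e}))) p"
  then obtain z0 where z0: "z0 \<in> K - K'" "z0 \<notin> F'" unfolding K'_def F'_def by blast
  have eE: "e \<in> E" using e by (simp add: face_edges_def)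
  interpret P: surface_closed_set w g side K by (rule surface_K)
  interpret Q: surface_closed_set w g side K' unfolding K'_def by (rule closed_set_pre[OF closed_subgraph])
  have rF': "region w K' F'" unfolding F'_def by (rule Q.region_face)
  then have F'D: "F' \<subseteq> cball 0 1 - K'" "openin (top_of_set (cball 0 1)) F'" "closure F' \<subseteq> F' \<union> K'" "saturated w F'"
    unfolding region_def by auto
  have param: "\<exists>t. 0 < t \<and> t < 1 \<and> u z = edge_point e t" if "z \<in> K - K'" for z
  proof -
    have uz: "u z \<in> subgraph E" "u z \<notin> subgraph (E - {e})"
      using that u_onto unfolding K'_def pre_def by auto
    then have "u z \<in> edge_segment e" using subgraph_insert[of e "E - {e}"] eE by (auto simp: insert_absorb)
    then obtain t where t: "t \<in> {0..1}" "u z = edge_point e t" unfolding edge_segment_def by blast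
    then have "t \<noteq> 0" "t \<noteq> 1" using uz(2) subgraph_vertex by (metis edge_point_0, metis edge_point_1)
    then show ?thesis using t by (intro exI[of _ t]) auto
  qed
  have disj: "(K - K') \<inter> F' = {}"
  proof (rule ccontr)
    assume "(K - K') \<inter> F' \<noteq> {}"
    then obtain z1 where z1: "z1 \<in> K - K'" "z1 \<in> F'" by blast
    obtain t0 where t0: "0 < t0" "t0 < 1" "u z0 = edge_point e t0" using param z0 by blast
    obtain t1 where t1: "0 < t1" "t1 < 1" "u z1 = edge_point e t1" using param z1 by blast
    \<comment> \<open>The part of the open edge between the two points: connected, and disjoint from
      the remaining graph.\<close>
    define Y where "Y = edge_point e ` {min t0 t1..max t0 t1}"
    have YE: "Y \<subseteq> subgraph E" unfolding Y_def subgraph_def edge_segment_def using eE t0 t1 by force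
    have conY: "connected Y" unfolding Y_def
      by (intro connected_continuous_image continuous_on_edge_point connected_Icc)
    have clY: "closed Y" unfolding Y_def
      by (intro compact_imp_closed compact_continuous_image continuous_on_edge_point compact_Icc)
    have YK': "pre Y \<inter> K' = {}"
    proof -
      have "edge_point e t \<notin> subgraph (E - {e})" if "t \<in> {min t0 t1..max t0 t1}" for t
        using that t0 t1 by (intro open_edge_notin_subgraph eE) auto
      then show ?thesis unfolding K'_def pre_def Y_def by auto
    qed
    \<comment> \<open>The indicator of \<open>F'\<close> is continuous on \<open>pre Y\<close>,
      because \<open>F'\<close> is closed there. It descends to a two-valued continuous function on
      the connected set \<open>Y\<close>.\<close>
    define h :: "complex \<Rightarrow> real" where "h = (\<lambda>z. if z \<in> F' then 1 else 0)"
    have "continuous_on ((pre Y \<inter> closure F') \<union> (pre Y \<inter> (cball 0 1 - F'))) h"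
      unfolding h_def
    proof (rule continuous_on_cases)
      show "closed (pre Y \<inter> closure F')" using closed_pre[OF clY] by auto
      have "closed (cball 0 1 - F')"
        using F'D(2) closedin_closed_trans[of "cball 0 1" "cball 0 1 - F'"]
        by (metis closed_cball closedin_diff closedin_self)
      then show "closed (pre Y \<inter> (cball 0 1 - F'))" using closed_pre[OF clY] by blast
      show "\<forall>x. x \<in> pre Y \<inter> closure F' \<and> x \<notin> F' \<or> x \<in> pre Y \<inter> (cball 0 1 - F') \<and> x \<in> F' \<longrightarrow> (1::real) = 0"
        using F'D(3) YK' by blast
    qed auto
    moreover have "(pre Y \<inter> closure F') \<union> (pre Y \<inter> (cball 0 1 - F')) = pre Y"
      using closure_subset[of F'] pre_subset_K K_subset by blast
    ultimately have hc: "continuous_on (pre Y) h" by simp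
    have hg: "glued_on w (pre Y) h"
      unfolding glued_on_def
    proof clarify
      fix x y assume xy: "(x, y) \<in> side_gluing w"
      then have "(y, x) \<in> side_gluing w" using sym_side_gluing by (metis symD)
      then show "h x = h y" using xy F'D(4) unfolding saturated_def h_def by auto
    qed
    obtain f where f: "continuous_on Y f" "\<And>z. z \<in> pre Y \<Longrightarrow> h z = f (u z)"
      using descend[OF clY YE hc hg] by blast
    have "f ` Y \<subseteq> {0, 1}"
    proof
      fix v assume "v \<in> f ` Y"
      then obtain x where "x \<in> Y" "v = f x" by blast
      then obtain z where "z \<in> pre Y" "v = f (u z)" using pre_ex[OF YE, of x] by blast
      then show "v \<in> {0,1}" using f(2)[of z] by (cases "z \<in> F'") (simp_all add: h_def)
    qed
    then have "finite (f ` Y)" using finite_subset by blast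
    then have "f constant_on Y" by (rule continuous_finite_range_constant[OF conY f(1)])
    moreover have "u z0 \<in> Y" "u z1 \<in> Y" using t0 t1 unfolding Y_def by auto
    ultimately have "f (u z0) = f (u z1)" unfolding constant_on_def by auto
    moreover have "z0 \<in> pre Y" "z1 \<in> pre Y"
      using z0 z1 \<open>u z0 \<in> Y\<close> \<open>u z1 \<in> Y\<close> by (auto simp: pre_def)
    ultimately have "h z0 = h z1" using f(2) by simp
    then show False using z0(2) z1(2) by (simp add: h_def)
  qed
  have K'K: "K' \<subseteq> K" unfolding K'_def by (rule pre_subset_K)
  have pF': "p \<in> F'" using Q.face_ball[of p p] p linked_refl[of p K' w] K'K unfolding F'_def by blast
  have "F' \<subseteq> F"
  proof
    fix z assume z: "z \<in> F'"
    then obtain r where r: "r > 0" "\<forall>q \<in> ball z r \<inter> ball 0 1. linked w K' p q"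
      unfolding F'_def face_def by blast
    have "linked w K p q" if q: "q \<in> ball z r \<inter> ball 0 1" for q
    proof -
      have l: "linked w K' p q" using r(2) q by blast
      then have qF': "q \<in> F'" using Q.face_ball[of q p] q unfolding F'_def by blast
      obtain c f where cf: "c = 1 \<or> c = -1" "pole_map w K' (\<lambda>z. point_pole p z + c * point_pole q z) f" "\<forall>z\<in>K'. f z = 1"
        using l unfolding linked_def by blast
      let ?d = "\<lambda>z. point_pole p z + c * point_pole q z"
      have "K \<inter> F' = {}" using disj F'D(1) by blast
      \<comment> \<open>Replacing the map by 1 outside \<open>F'\<close> keeps both poles and makes
        it 1 on the restored edge too.\<close>
      then have "pole_map w K (\<lambda>z. if z \<in> F' then ?d z else 0) (\<lambda>z. if z \<in> F' then f z else 1)"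
        using pole_map_localize[OF cf(2) _ rF' Q.closed_K Q.K_subset, of K] cf(3) by blast
      moreover have "(\<lambda>z. if z \<in> F' then ?d z else 0) = ?d"
        using pF' qF' by (auto simp: point_pole_def)
      moreover have "\<forall>z\<in>K. (if z \<in> F' then f z else 1) = 1" using \<open>K \<inter> F' = {}\<close> by auto
      moreover have "q \<notin> K" using \<open>K \<inter> F' = {}\<close> qF' by blast
      ultimately show ?thesis using cf(1) p q unfolding linked_def by auto
    qed
    moreover have "z \<in> cball 0 1 - K" using z F'D(1) disj by blast
    ultimately show "z \<in> F" using r(1) unfolding F_def face_def by blast
  qed
  moreover have "F \<subseteq> F'"
  proof
    fix z assume "z \<in> F"
    then show "z \<in> F'" using linked_mono[OF _ K'K] K'K unfolding F_def F'_def face_def by blast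
  qed
  ultimately have "F = F'" by blast
  then have "closure F \<subseteq> F \<union> K'" using F'D(3) by simp
  then show False using e unfolding face_edges_def F_def K'_def by blast
qed

text \<open>The map is 1 at both ends of \<open>e\<close>, so its winding along \<open>e\<close> is
  an integer. The logarithm is normalised at \<open>fst e\<close> so that the value at
  \<open>snd e\<close> reads off this integer.\<close>

lemma edge_log:
  assumes e: "e \<in> E" and f: "pole_map w K d f" and f1: "\<And>z. z \<in> pre (subgraph (E - {e})) \<Longrightarrow> f z = 1"
  obtains l :: "real^'n \<Rightarrow> real" and a :: int where "continuous_on (edge_segment e) l"
    "\<And>z. z \<in> pre (edge_segment e) \<Longrightarrow> f z = cis (l (u z))"
    "l (axis (fst e) 1) = 0" "l (axis (snd e) 1) = 2 * pi * a"
proof -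
  let ?S = "edge_segment e"
  have sub: "?S \<subseteq> subgraph E" using e unfolding subgraph_def by blast
  have fc: "continuous_on (pre ?S) f"
    using pole_map_continuous[OF f K_subset] continuous_on_subset pre_subset_K by blast
  have fg: "glued_on w (pre ?S) f"
    using f side_gluing_on_sphere unfolding pole_map_def glued_on_def by fastforce
  obtain h where h: "continuous_on ?S h" "\<And>z. z \<in> pre ?S \<Longrightarrow> f z = h (u z)"
    using descend[OF closed_edge_segment sub fc fg] by blast
  have "norm (h x) = 1" if x: "x \<in> ?S" for x
  proof -
    obtain z where z: "z \<in> pre ?S" "x = u z" using pre_ex[OF sub x] by blast
    then have "z \<in> K" using pre_subset_K by blast
    then show ?thesis using h(2)[OF z(1)] z(2) pole_map_norm[OF f K_subset, of z] by simp
  qed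
  then have "h ` ?S \<subseteq> sphere 0 1" by auto
  moreover have "contractible ?S" unfolding edge_segment_eq by (simp add: convex_imp_contractible)
  ultimately obtain l where l: "continuous_on ?S l" "\<And>x. x \<in> ?S \<Longrightarrow> h x = cis (l x)"
    using circle_log_contractible[OF h(1)] by blast
  have ends: "axis (fst e) 1 \<in> ?S" "axis (snd e) 1 \<in> ?S" unfolding edge_segment_eq by auto
  have one: "h (axis v 1) = 1" if v: "axis v 1 \<in> ?S" for v
  proof -
    obtain z where z: "z \<in> pre ?S" "axis v 1 = u z" using pre_ex[OF sub v] by blast
    have "u z \<in> subgraph (E - {e})" using z(2) subgraph_vertex by metis
    then have "z \<in> pre (subgraph (E - {e}))" using z(1) by (simp add: pre_def)
    then show ?thesis using f1 h(2)[OF z(1)] z(2) by simp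
  qed
  let ?a = "l (axis (fst e) 1)"
  have c0: "cis ?a = 1" using one[OF ends(1)] l(2)[OF ends(1)] by simp
  have "cis (l (axis (snd e) 1)) = cis ?a" using one[OF ends(2)] l(2)[OF ends(2)] c0 by simp
  then obtain a :: int where a: "l (axis (snd e) 1) - ?a = 2 * pi * a" unfolding cis_eq_iff by blast
  show thesis
  proof (rule that[of "\<lambda>x. l x - ?a" a])
    show "continuous_on ?S (\<lambda>x. l x - ?a)" using l(1) by (intro continuous_intros)
    fix z assume z: "z \<in> pre ?S"
    then have "f z = cis (l (u z))" using h(2) l(2) by (simp add: pre_def)
    then show "f z = cis (l (u z) - ?a)" using c0 by (simp add: cis_divide[symmetric])
  qed (use a in auto)
qed

text \<open>Without \<open>e\<close> the three faces merge, so there are maps trading a pole at \<open>p1\<close> for one at \<open>p2\<close> and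
  at \<open>p3\<close> that differ from 1 only along \<open>e\<close>. A coprime combination of them has winding number zero
  along \<open>e\<close>, and its degree at \<open>p2\<close> or \<open>p3\<close> is odd.\<close>

lemma edge_not_on_three_faces:
  assumes p: "p1 \<in> ball 0 1 - K" "p2 \<in> ball 0 1 - K" "p3 \<in> ball 0 1 - K"
    and nl: "\<not> linked w K p1 p2" "\<not> linked w K p1 p3" "\<not> linked w K p2 p3"
    and e: "e \<in> face_edges p1" "e \<in> face_edges p2" "e \<in> face_edges p3"
  shows False
proof -
  define K' where "K' = pre (subgraph (E - {e}))"
  have K'K: "K' \<subseteq> K" unfolding K'_def by (rule pre_subset_K)
  have eE: "e \<in> E" using e by (simp add: face_edges_def)
  interpret P: surface_closed_set w g side K by (rule surface_K)
  have seg: "edge_segment e \<subseteq> subgraph E" using eE unfolding subgraph_def by blast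
  have "edge_point e (1/2) \<in> subgraph E" using seg unfolding edge_segment_def by auto
  \<comment> \<open>Any inner point of \<open>e\<close> would do. After deletion of \<open>e\<close>
    it lies in all three enlarged faces, so one nearby point links them.\<close>
  then obtain z0 where z0: "z0 \<in> K" "u z0 = edge_point e (1/2)" using u_onto by (metis imageE)
  have "edge_point e (1/2) \<notin> subgraph (E - {e})" by (rule open_edge_notin_subgraph[OF eE]) auto
  then have z0': "z0 \<in> K - K'" using z0 by (auto simp: K'_def pre_def)
  have near: "\<exists>r>0. \<forall>q \<in> ball z0 r \<inter> ball 0 1. linked w K' p q"
    if "p \<in> ball 0 1 - K" "e \<in> face_edges p" for p
    using edge_interior_in_face[OF that(2,1)] z0' unfolding K'_def face_def by blast
  obtain r1 where r1: "r1 > 0" "\<forall>q \<in> ball z0 r1 \<inter> ball 0 1. linked w K' p1 q" using near p e by blast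
  obtain r2 where r2: "r2 > 0" "\<forall>q \<in> ball z0 r2 \<inter> ball 0 1. linked w K' p2 q" using near p e by blast
  obtain r3 where r3: "r3 > 0" "\<forall>q \<in> ball z0 r3 \<inter> ball 0 1. linked w K' p3 q" using near p e by blast
  obtain q where q: "q \<in> ball z0 (min r1 (min r2 r3)) \<inter> ball 0 1"
  proof (rule ball_near_cball_point)
    show "z0 \<in> cball 0 1" using z0 K_subset by blast
    show "min r1 (min r2 r3) > 0" using r1 r2 r3 by simp
  qed
  have "linked w K' p1 q" "linked w K' p2 q" "linked w K' p3 q" using q r1 r2 r3 by auto
  then have l12: "linked w K' p1 p2" and l13: "linked w K' p1 p3"
    using linked_sym linked_trans by blast+
  obtain c2 g2 where g2: "c2 = 1 \<or> c2 = -1" "pole_map w K' (\<lambda>z. point_pole p1 z + c2 * point_pole p2 z) g2"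
    "\<forall>z\<in>K'. g2 z = 1" using l12 unfolding linked_def by blast
  obtain c3 g3 where g3: "c3 = 1 \<or> c3 = -1" "pole_map w K' (\<lambda>z. point_pole p1 z + c3 * point_pole p3 z) g3"
    "\<forall>z\<in>K'. g3 z = 1" using l13 unfolding linked_def by blast
  let ?d2 = "\<lambda>z. point_pole p1 z + c2 * point_pole p2 z"
  let ?d3 = "\<lambda>z. point_pole p1 z + c3 * point_pole p3 z"
  have off2: "z \<notin> K" if "?d2 z \<noteq> 0" for z using that p by (auto simp: point_pole_def split: if_splits)
  have off3: "z \<notin> K" if "?d3 z \<noteq> 0" for z using that p by (auto simp: point_pole_def split: if_splits)
  obtain f2 where f2: "pole_map w K ?d2 f2" "\<And>z. z \<in> K' \<Longrightarrow> f2 z = 1"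
    using pole_map_enlarge[OF g2(2) K'K off2] g2(3) by metis
  obtain f3 where f3: "pole_map w K ?d3 f3" "\<And>z. z \<in> K' \<Longrightarrow> f3 z = 1"
    using pole_map_enlarge[OF g3(2) K'K off3] g3(3) by metis
  obtain l2 :: "real^'n \<Rightarrow> real" and a2 :: int where l2: "continuous_on (edge_segment e) l2"
    "\<And>z. z \<in> pre (edge_segment e) \<Longrightarrow> f2 z = cis (l2 (u z))"
    "l2 (axis (fst e) 1) = 0" "l2 (axis (snd e) 1) = 2 * pi * a2"
    using edge_log[OF eE f2(1) f2(2)[unfolded K'_def]] by blast
  obtain l3 :: "real^'n \<Rightarrow> real" and a3 :: int where l3: "continuous_on (edge_segment e) l3"
    "\<And>z. z \<in> pre (edge_segment e) \<Longrightarrow> f3 z = cis (l3 (u z))"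
    "l3 (axis (fst e) 1) = 0" "l3 (axis (snd e) 1) = 2 * pi * a3"
    using edge_log[OF eE f3(1) f3(2)[unfolded K'_def]] by blast
  obtain x y :: int where xy: "x * a2 + y * a3 = 0" "odd x \<or> odd y" by (rule coprime_relation)
  let ?d = "\<lambda>z. x * ?d2 z + y * ?d3 z"
  let ?f = "\<lambda>z. f2 z powi x * f3 z powi y"
  have f: "pole_map w K ?d ?f"
    by (rule pole_map_mult[OF pole_map_powi[OF f2(1)] pole_map_powi[OF f3(1)]])
  \<comment> \<open>The choice of \<open>x\<close> and \<open>y\<close> makes this logarithm vanish
    at both ends of \<open>e\<close>, so that it can be continued by 0 over the rest of the
    graph.\<close>
  define m where "m = (\<lambda>v. if v \<in> edge_segment e then of_int x * l2 v + of_int y * l3 v else 0)"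
  have mc: "continuous_on (subgraph E) m"
    unfolding m_def
  proof (rule continuous_on_edge_paste[OF eE])
    show "continuous_on (edge_segment e) (\<lambda>v. of_int x * l2 v + of_int y * l3 v)"
      using l2(1) l3(1) by (intro continuous_intros)
    have "of_int x * l2 (axis (snd e) 1) + of_int y * l3 (axis (snd e) 1) = 2 * pi * of_int (x * a2 + y * a3)"
      using l2(4) l3(4) by (simp add: algebra_simps)
    then show "of_int x * l2 (axis (snd e) 1) + of_int y * l3 (axis (snd e) 1) = 0" using xy(1) by simp
  qed (use l2(3) l3(3) in auto)
  have fm: "?f z = cis (m (u z))" if z: "z \<in> K" for z
  proof (cases "u z \<in> edge_segment e")
    case True
    then have "z \<in> pre (edge_segment e)" using z by (simp add: pre_def)
    then show ?thesis using True l2(2)[of z] l3(2)[of z] by (simp add: m_def cis_power_int cis_mult)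
  next
    case False
    have "u z \<in> subgraph E" using z u_onto by blast
    then have "z \<in> K'" using False z eE subgraph_insert[of e "E - {e}"]
      by (auto simp: K'_def pre_def insert_absorb)
    then show ?thesis using f2(2) f3(2) False by (simp add: m_def)
  qed
  have mc': "continuous_on K (\<lambda>z. m (u z))" using continuous_on_comp[OF mc] by (simp add: pre_subgraph)
  have mg: "glued_on w K (\<lambda>z. m (u z))" using glued_on_comp[of "subgraph E" m] by (simp add: pre_subgraph)
  have ev: "even (\<Sum>z | (if z \<in> face w K q then ?d z else 0) \<noteq> 0. if z \<in> face w K q then ?d z else 0)" for q
    by (rule P.region_degree_even[OF f P.region_face mc' mg fm])
  have self: "q \<in> face w K q" if "q \<in> ball 0 1 - K" for q
    using P.face_ball[of q q] that linked_refl by blast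
  have "p1 \<notin> face w K p2" "p3 \<notin> face w K p2" "p1 \<notin> face w K p3" "p2 \<notin> face w K p3"
    using P.face_ball nl p linked_sym by blast+
  moreover have "p1 \<noteq> p2" "p1 \<noteq> p3" "p2 \<noteq> p3" using nl p linked_refl by blast+
  \<comment> \<open>The pole at \<open>p1\<close> is in neither face, so each of the other two faces
    sees just one coefficient.\<close>
  ultimately have "(\<lambda>z. if z \<in> face w K p2 then ?d z else 0) = (\<lambda>z. if z = p2 then x * c2 else 0)"
    "(\<lambda>z. if z \<in> face w K p3 then ?d z else 0) = (\<lambda>z. if z = p3 then y * c3 else 0)"
    using self[OF p(2)] self[OF p(3)] by (auto simp: point_pole_def fun_eq_iff)
  then have "even (\<Sum>z | (if z = p2 then x * c2 else 0) \<noteq> 0. if z = p2 then x * c2 else 0)"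
    "even (\<Sum>z | (if z = p3 then y * c3 else 0) \<noteq> 0. if z = p3 then y * c3 else 0)"
    using ev[of p2] ev[of p3] by (simp_all add: fun_eq_iff)
  moreover have "(\<Sum>z | (if z = v then k else 0) \<noteq> 0. if z = v then k else 0) = k" for v :: complex and k :: int
    by (cases "k = 0") auto
  ultimately have "even (x * c2)" "even (y * c3)" by metis+
  then show False using xy(2) g2(1) g3(1) by auto
qed

text \<open>Double counting of pairs of a face and a bordering edge: at least four for each face, at
  most two for each edge.\<close>

lemma unlinked_bound:
  assumes R: "unlinked R" "finite R" "card R \<ge> 2"
  shows "2 * card R \<le> card E"
proof -
  have RK: "R \<subseteq> ball 0 1 - K" and nl: "\<And>p q. p \<in> R \<Longrightarrow> q \<in> R \<Longrightarrow> p \<noteq> q \<Longrightarrow> \<not> linked w K p q"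
    using R(1) unfolding unlinked_def by auto
  have four: "4 \<le> card (face_edges p)" if p: "p \<in> R" for p
  proof -
    have "R \<noteq> {p}" using R(3) by auto
    then obtain q where "q \<in> R" "q \<noteq> p" using p by blast
    then show ?thesis using face_has_four_edges[of p q] nl[of p q] RK p by blast
  qed
  have two: "card {p \<in> R. e \<in> face_edges p} \<le> 2" if "e \<in> E" for e
  proof (rule ccontr)
    assume "\<not> ?thesis"
    then have "3 \<le> card {p \<in> R. e \<in> face_edges p}" by simp
    then obtain A where A: "A \<subseteq> {p \<in> R. e \<in> face_edges p}" "card A = 3"
      using obtain_subset_with_card_n by metis
    then obtain p1 p2 p3 where "A = {p1, p2, p3}" "p1 \<noteq> p2" "p1 \<noteq> p3" "p2 \<noteq> p3"
      by (auto simp: card_3_iff)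
    then have "p1 \<in> R" "p2 \<in> R" "p3 \<in> R" "e \<in> face_edges p1" "e \<in> face_edges p2" "e \<in> face_edges p3"
      using A(1) by auto
    moreover have "p1 \<in> ball 0 1 - K" "p2 \<in> ball 0 1 - K" "p3 \<in> ball 0 1 - K"
      using RK calculation by blast+
    ultimately show False
      using edge_not_on_three_faces[of p1 p2 p3 e] nl[of p1 p2] nl[of p1 p3] nl[of p2 p3]
        \<open>p1 \<noteq> p2\<close> \<open>p1 \<noteq> p3\<close> \<open>p2 \<noteq> p3\<close> by blast
  qed
  have fe: "face_edges p = {e \<in> E. e \<in> face_edges p}" for p by (auto simp: face_edges_def)
  have "4 * card R = (\<Sum>p\<in>R. 4)" by simp
  also have "\<dots> \<le> (\<Sum>p\<in>R. card (face_edges p))" using four by (intro sum_mono) auto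
  also have "\<dots> = (\<Sum>p\<in>R. card {e \<in> E. e \<in> face_edges p})" using fe by simp
  also have "\<dots> = (\<Sum>e\<in>E. card {p \<in> R. e \<in> face_edges p})"
    by (rule sum_multicount_gen[symmetric, THEN trans[OF _ refl]]) (use R(2) in auto)
  also have "\<dots> \<le> (\<Sum>e\<in>E. 2)" using two by (intro sum_mono) auto
  finally show ?thesis by simp
qed

text \<open>Otherwise some nontrivial product of windings along non-tree edges has a real logarithm
  \<open>h\<close>. It is constant along tree edges, hence equal at all vertices, yet it increases
  by \<open>2 * pi * a j\<close> along a non-tree edge \<open>j\<close> with nonzero
  exponent.\<close>

lemma independent_cycles_bound:
  assumes T: "T \<subseteq> E" "\<And>l :: 'n \<Rightarrow> real. (\<And>a b. (a, b) \<in> T \<Longrightarrow> l a = l b) \<Longrightarrow> \<forall>a b. l a = l b"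
    and R: "finite R" "\<And>p. p \<in> ball 0 1 - K \<Longrightarrow> \<exists>q\<in>R. linked w K p q"
  shows "card (E - T) \<le> g + (card R - 1)"
proof (rule ccontr)
  assume "\<not> ?thesis"
  then have gt: "card (E - T) > g + (card R - 1)" by simp
  interpret P: surface_closed_set w g side K by (rule surface_K)
  have fc: "continuous_on K (\<lambda>z. edge_wind j (u z))" if "j \<in> E - T" for j
    using continuous_on_comp[OF continuous_on_edge_wind[of j]] that by (simp add: pre_subgraph)
  have fg: "glued_on w K (\<lambda>z. edge_wind j (u z))" for j
    using glued_on_comp[of "subgraph E" "edge_wind j"] by (simp add: pre_subgraph)
  obtain a :: "'n \<times> 'n \<Rightarrow> int" and m :: "complex \<Rightarrow> real" where am: "\<exists>j\<in>E - T. a j \<noteq> 0"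
    "continuous_on (cball 0 1) m" "glued_on w (sphere 0 1) m"
    "\<And>z. z \<in> K \<Longrightarrow> (\<Prod>j\<in>E - T. edge_wind j (u z) powi a j) = cis (m z)"
  proof (rule P.circle_maps_dependent[of "E - T" R "\<lambda>j z. edge_wind j (u z)"])
    show "(\<lambda>z. edge_wind j (u z)) ` K \<subseteq> sphere 0 1" for j using norm_edge_wind[of j] by auto
  qed (use gt R fc fg in auto)
  have mK: "continuous_on (pre (subgraph E)) m" "glued_on w (pre (subgraph E)) m"
    using am(2,3) K_subset continuous_on_subset side_gluing_on_sphere
    unfolding pre_subgraph glued_on_def by (blast, fastforce)
  obtain h where h: "continuous_on (subgraph E) h" "\<And>z. z \<in> K \<Longrightarrow> m z = h (u z)"
    using descend[OF closed_subgraph subset_refl mK] unfolding pre_subgraph by blast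
  have prod: "(\<Prod>j\<in>E - T. edge_wind j x powi a j) = cis (h x)" if "x \<in> subgraph E" for x
  proof -
    obtain z where "z \<in> K" "x = u z" using u_onto \<open>x \<in> subgraph E\<close> by blast
    then show ?thesis using am(4) h(2) by simp
  qed
  have pt: "edge_point e t \<in> subgraph E" if "e \<in> E" "t \<in> {0..1}" for e t
    using that unfolding subgraph_def edge_segment_def by blast
  have hc: "continuous_on {0..1} (\<lambda>t. h (edge_point e t))" if "e \<in> E" for e
    by (rule continuous_on_compose2[OF h(1) continuous_on_edge_point]) (use pt[OF that] in blast)
  have treeedge: "h (axis p 1) = h (axis q 1)" if pq: "(p, q) \<in> T" for p q
  proof -
    have eE: "(p, q) \<in> E" using pq T(1) by blast
    have "cis (h (edge_point (p,q) t)) = cis 0" if t: "t \<in> {0..1}" for t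
    proof -
      have "edge_wind j (edge_point (p, q) t) powi a j = 1" if "j \<in> E - T" for j
      proof -
        have "j \<noteq> (p, q)" using that pq by blast
        then show ?thesis using edge_wind_other[of j "(p, q)" t] that eE t by auto
      qed
      then show ?thesis using prod[OF pt[OF eE t]] by simp
    qed
    then have "h (edge_point (p,q) 0) - 0 = h (edge_point (p,q) 1) - 0"
      by (intro circle_log_diff_constant[OF _ hc[OF eE], of "\<lambda>_. 0"]) auto
    then show ?thesis by simp
  qed
  have vert: "\<forall>p q. h (axis p 1) = h (axis q 1)"
    using T(2)[of "\<lambda>v. h (axis v 1)"] treeedge by blast
  obtain j where j: "j \<in> E - T" "a j \<noteq> 0" using am(1) by blast
  have "cis (h (edge_point j t)) = cis (of_int (a j) * (2 * pi * t))" if t: "t \<in> {0..1}" for t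
  proof -
    have "(\<Prod>i\<in>E - T. edge_wind i (edge_point j t) powi a i) = (\<Prod>i\<in>E - T. if i = j then cis (2 * pi * t) powi a j else 1)"
    proof (rule prod.cong)
      fix i assume "i \<in> E - T"
      then show "edge_wind i (edge_point j t) powi a i = (if i = j then cis (2 * pi * t) powi a j else 1)"
        using edge_wind_own[of j t] edge_wind_other[of i j t] t j by auto
    qed simp
    also have "\<dots> = cis (2 * pi * t) powi a j" using j by simp
    also have "\<dots> = cis (of_int (a j) * (2 * pi * t))" by (rule cis_power_int)
    finally show ?thesis using prod[OF pt[of j t]] j t by simp
  qed
  then have "h (edge_point j 1) - of_int (a j) * (2 * pi * 1) = h (edge_point j 0) - of_int (a j) * (2 * pi * 0)"
    by (intro circle_log_diff_constant[of "{0..1}"]) (use hc j in \<open>auto intro!: continuous_intros\<close>)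
  moreover have "h (edge_point j 1) = h (edge_point j 0)" using vert by simp
  ultimately show False using j(2) by simp
qed

text \<open>The cycle bound eliminates the number of faces through
  \<open>2 * card R \<le> card E\<close>. With fewer than two faces the cycle bound suffices, as
  there are at least three vertices.\<close>

lemma edge_bound:
  assumes n: "CARD('n) \<ge> 3"
    and conn: "\<And>W. W \<noteq> {} \<Longrightarrow> W \<noteq> UNIV \<Longrightarrow> \<exists>(a, b)\<in>E. a \<in> W \<longleftrightarrow> b \<notin> W"
  shows "card E + 4 \<le> 2 * (CARD('n) + g)"
proof -
  obtain T where T: "T \<subseteq> E" "card T + 1 = CARD('n)"
    "\<And>l :: 'n \<Rightarrow> real. (\<And>a b. (a, b) \<in> T \<Longrightarrow> l a = l b) \<Longrightarrow> \<forall>a b. l a = l b"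
    using spanning_tree[OF conn] by blast
  \<comment> \<open>The summand 1 covers sets with a single point. The bound replaces a proof that
    there are finitely many faces: a largest unlinked set exists, and by maximality it meets every
    face.\<close>
  have bound: "card R \<le> card E + 1" if "unlinked R" "finite R" for R
    using unlinked_bound[OF that] by (cases "card R \<ge> 2") auto
  define N where "N = {card R | R. unlinked R \<and> finite R}"
  have "N \<subseteq> {..card E + 1}" using bound by (auto simp: N_def)
  then have finN: "finite N" using finite_subset by blast
  have "unlinked {}" by (simp add: unlinked_def)
  then have "0 \<in> N" unfolding N_def by force
  then have "Max N \<in> N" using finN Max_in by blast
  then obtain R where R: "unlinked R" "finite R" "card R = Max N" unfolding N_def by auto
  have cover: "\<exists>q\<in>R. linked w K p q" if p: "p \<in> ball 0 1 - K" for p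
  proof (rule ccontr)
    assume no: "\<not> ?thesis"
    then have pR: "p \<notin> R" using linked_refl[OF p] by blast
    have "unlinked (insert p R)"
      using R(1) p no linked_sym unfolding unlinked_def by blast
    then have "card (insert p R) \<in> N" using R(2) unfolding N_def by blast
    then have "card (insert p R) \<le> Max N" using finN by simp
    then show False using pR R by simp
  qed
  have "card (E - T) \<le> g + (card R - 1)" by (rule independent_cycles_bound[OF T(1,3) R(2) cover])
  moreover have "card E = card (E - T) + card T"
    using card_Diff_subset[of T E] card_mono[of E T] T(1) by simp
  ultimately have le: "card E + 1 \<le> g + (card R - 1) + CARD('n)" using T(2) by linarith
  show ?thesis
  proof (cases "card R \<ge> 2")
    case True
    then have "2 * card R \<le> card E" by (rule unlinked_bound[OF R(1,2)])
    moreover obtain r where "card R = Suc r" using True by (cases "card R") auto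
    ultimately show ?thesis using le by simp
  next
    case False
    then have "card R - 1 = 0" by simp
    then show ?thesis using le n by simp
  qed
qed

end

subsection \<open>Pulling an embedding back to the polygon\<close>

text \<open>A point that is no corner has a unique side parameter, so consecutive gluing steps
  through it compose to a single step. Longer chains matter at corners only.\<close>

lemma gluing_rel_cases:
  assumes "(x, y) \<in> (side_gluing w)\<^sup>*"
  shows "x = y \<or> (x, y) \<in> side_gluing w \<or> y \<in> corners (length w)"
  using assms
proof (induction rule: rtrancl_induct)
  case (step y z)
  show ?case
  proof (cases "x = y")
    case True
    then show ?thesis using step by simp
  next
    case False
    show ?thesis
    proof (cases "y \<in> corners (length w)")
      case True
      then show ?thesis using corners_saturated[OF step(2)] by simp
    next
      case nc: False
      then have xy: "(x, y) \<in> side_gluing w" using step.IH False by blast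
      let ?L = "length w"
      obtain i j s where ij: "i < ?L" "j < ?L" "fst (w ! i) = fst (w ! j)" "0 \<le> s" "s \<le> 1" "x = side_point ?L i s"
        "y = side_point ?L j (if snd (w ! i) = snd (w ! j) then s else 1 - s)"
        using xy unfolding side_gluing_def by auto
      obtain k l t where kl: "k < ?L" "l < ?L" "fst (w ! k) = fst (w ! l)" "0 \<le> t" "t \<le> 1" "y = side_point ?L k t"
        "z = side_point ?L l (if snd (w ! k) = snd (w ! l) then t else 1 - t)"
        using step(2) unfolding side_gluing_def by auto
      let ?s = "if snd (w ! i) = snd (w ! j) then s else 1 - s"
      have s: "0 \<le> ?s" "?s \<le> 1" using ij by auto
      have "t \<notin> {0, 1}"
      proof
        assume "t \<in> {0,1}"
        then have "y \<in> corners ?L" using kl(1,6) unfolding corners_def by blast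
        then show False using nc by blast
      qed
      then have jk: "j = k" "?s = t"
        using side_point_eqD[of ?L j ?s k t] ij kl s by auto
      have "z = side_point ?L l (if snd (w ! i) = snd (w ! l) then s else 1 - s)"
        unfolding kl(7) jk(2)[symmetric] jk(1)[symmetric]
        by (cases "snd (w ! i)"; cases "snd (w ! j)"; cases "snd (w ! l)"; simp)
      moreover have "fst (w ! i) = fst (w ! l)" using ij(3) kl(3) jk(1) by simp
      ultimately have "(x, z) \<in> side_gluing w"
        using ij(1,4,5,6) kl(2) unfolding side_gluing_def by blast
      then show ?thesis by simp
    qed
  qed
qed simp

text \<open>One gluing step sends a closed set to finitely many compact pieces of sides, and longer
  chains add only corners, which are finite in number.\<close>

lemma closed_gluing_image:
  assumes "closed C" "C \<subseteq> cball 0 1"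
  shows "closed (gluing_rel w `` C)"
proof -
  let ?L = "length w"
  let ?t = "\<lambda>i j s. if snd (w ! i) = snd (w ! j) then s else 1 - (s::real)"
  define I where "I = {(i, j). i < ?L \<and> j < ?L \<and> fst (w ! i) = fst (w ! j)}"
  have finI: "finite I" unfolding I_def by (rule finite_subset[of _ "{..<?L} \<times> {..<?L}"]) auto
  define S where "S = (\<lambda>(i, j). (\<lambda>s. side_point ?L j (?t i j s)) ` ({0..1} \<inter> side_point ?L i -` C))"
  have "compact (S (i, j))" for i j
  proof -
    have "closed ({0..1} \<inter> side_point ?L i -` C)"
      by (rule continuous_closed_preimage) (auto intro: continuous_on_side_point assms)
    then have "compact ({0..1} \<inter> side_point ?L i -` C)"
      by (metis compact_Icc compact_Int_closed inf.left_idem)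
    moreover have "continuous_on A (?t i j)" for A
      by (cases "snd (w ! i) = snd (w ! j)") (auto intro!: continuous_intros)
    then have "continuous_on A (\<lambda>s. side_point ?L j (?t i j s))" for A
      by (rule continuous_on_compose2[OF continuous_on_side_point[of UNIV]]) auto
    ultimately show ?thesis unfolding S_def by (auto intro!: compact_continuous_image)
  qed
  then have "compact (\<Union>e\<in>I. S e)" using finI by (intro compact_UN) auto
  then have cS: "closed (\<Union>e\<in>I. S e)" by (rule compact_imp_closed)
  have "finite (corners ?L)" unfolding corners_def by auto
  then have cQ: "closed (corners ?L \<inter> gluing_rel w `` C)" by (intro finite_imp_closed) auto
  have SU: "(\<Union>e\<in>I. S e) = {y. \<exists>x\<in>C. (x, y) \<in> side_gluing w}"
  proof (intro equalityI subsetI)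
    fix y assume "y \<in> (\<Union>e\<in>I. S e)"
    then obtain i j s where "(i, j) \<in> I" "s \<in> {0..1}" "side_point ?L i s \<in> C" "y = side_point ?L j (?t i j s)"
      unfolding S_def by auto
    then show "y \<in> {y. \<exists>x\<in>C. (x, y) \<in> side_gluing w}"
      unfolding I_def side_gluing_def by fastforce
  next
    fix y assume "y \<in> {y. \<exists>x\<in>C. (x, y) \<in> side_gluing w}"
    then obtain i j s where "(i, j) \<in> I" "s \<in> {0..1}" "side_point ?L i s \<in> C" "y = side_point ?L j (?t i j s)"
      unfolding I_def side_gluing_def by auto
    then have "y \<in> S (i, j)" unfolding S_def by auto
    then show "y \<in> (\<Union>e\<in>I. S e)" using \<open>(i, j) \<in> I\<close> by blast
  qed
  have "gluing_rel w `` C = C \<union> (\<Union>e\<in>I. S e) \<union> (corners ?L \<inter> gluing_rel w `` C)"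
  proof (intro equalityI subsetI)
    fix y assume y: "y \<in> gluing_rel w `` C"
    then obtain x where "x \<in> C" "(x, y) \<in> (side_gluing w)\<^sup>*" unfolding gluing_rel_def by auto
    then show "y \<in> C \<union> (\<Union>e\<in>I. S e) \<union> (corners ?L \<inter> gluing_rel w `` C)"
      using gluing_rel_cases[of x y w] y unfolding SU by blast
  next
    fix y assume "y \<in> C \<union> (\<Union>e\<in>I. S e) \<union> (corners ?L \<inter> gluing_rel w `` C)"
    then consider "y \<in> C" | x where "x \<in> C" "(x, y) \<in> side_gluing w" | "y \<in> gluing_rel w `` C"
      unfolding SU by blast
    then show "y \<in> gluing_rel w `` C"
    proof cases
      case 1
      then have "(y, y) \<in> gluing_rel w" using assms(2) by (auto simp: gluing_rel_def)
      then show ?thesis using 1 by blast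
    next
      case 2
      then have "(x, y) \<in> gluing_rel w"
        using side_gluing_on_sphere[OF 2(2)] by (auto simp: gluing_rel_def)
      then show ?thesis using 2 by blast
    qed
  qed
  moreover have "closed (C \<union> (\<Union>e\<in>I. S e) \<union> (corners ?L \<inter> gluing_rel w `` C))"
    by (intro closed_Un assms(1) cS cQ)
  ultimately show ?thesis by simp
qed

text \<open>The projection is a closed map, and closed continuous images of normal Hausdorff spaces
  are Hausdorff. This makes the compact image of the graph closed in the surface.\<close>

lemma Hausdorff_polygon_surface: "Hausdorff_space (polygon_surface w)"
proof -
  let ?D = "top_of_set (cball (0::complex) 1)" and ?q = "\<lambda>z. gluing_rel w `` {z}"
  have q: "quotient_map ?D (polygon_surface w) ?q" by (rule quotient_map_polygon_surface)
  have "closed_map ?D (polygon_surface w) ?q"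
    unfolding closed_map_def
  proof (intro allI impI)
    fix C assume C: "closedin ?D C"
    then have C': "closed C" "C \<subseteq> cball 0 1"
      using closedin_closed_trans closed_cball closedin_subset by (blast, force)
    have sub: "?q ` C \<subseteq> topspace (polygon_surface w)"
      using C' unfolding topspace_polygon_surface by (auto intro: quotientI)
    have "{z \<in> topspace ?D. ?q z \<in> ?q ` C} = gluing_rel w `` C"
    proof (intro equalityI subsetI)
      fix z assume "z \<in> {z \<in> topspace ?D. ?q z \<in> ?q ` C}"
      then obtain x where "z \<in> cball 0 1" "x \<in> C" "?q z = ?q x" by auto
      then have "(x, z) \<in> gluing_rel w"
        using equiv_class_self[OF equiv_gluing_rel[of w], of z] by blast
      then show "z \<in> gluing_rel w `` C" using \<open>x \<in> C\<close> by blast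
    next
      fix z assume "z \<in> gluing_rel w `` C"
      then obtain x where x: "x \<in> C" "(x, z) \<in> gluing_rel w" by blast
      then have "?q x = ?q z" by (intro equiv_class_eq[OF equiv_gluing_rel])
      moreover have "z \<in> cball 0 1" using x by (auto simp: gluing_rel_def)
      ultimately show "z \<in> {z \<in> topspace ?D. ?q z \<in> ?q ` C}" using x(1) by auto
    qed
    moreover have "gluing_rel w `` C \<subseteq> cball 0 1" by (auto simp: gluing_rel_def)
    ultimately have "closedin ?D {z \<in> topspace ?D. ?q z \<in> ?q ` C}"
      using closed_gluing_image[OF C'] by (simp add: closed_subset)
    then show "closedin (polygon_surface w) (?q ` C)"
      using q sub unfolding quotient_map_closedin by blast
  qed
  moreover have "continuous_map ?D (polygon_surface w) ?q" by (rule quotient_imp_continuous_map[OF q])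
  moreover have "?q ` topspace ?D = topspace (polygon_surface w)" using q unfolding quotient_map_def by blast
  moreover have "normal_space ?D"
    by (intro metrizable_imp_normal_space metrizable_space_subtopology metrizable_space_euclidean)
  moreover have "Hausdorff_space ?D" by (simp add: Hausdorff_space_subtopology)
  ultimately show ?thesis using normal_Hausdorff_space_closed_continuous_map_image by blast
qed

text \<open>\<open>K\<close> is the preimage of the embedded graph and \<open>u\<close> the
  projection followed by the inverse of the embedding; from here on the topology of the quotient is
  replaced by conditions on the polygon.\<close>

lemma embedding_pullback:
  fixes X :: "(real^'n::finite) set"
  assumes X: "compact X" and f: "embedding_map (top_of_set X) (polygon_surface w) f"
  obtains K u where "closed K" "K \<subseteq> cball 0 1" "saturated w K" "continuous_on K u" "u ` K = X"
    "\<And>x y. (x, y) \<in> side_gluing w \<Longrightarrow> x \<in> K \<Longrightarrow> u x = u y"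
    "\<And>x y. x \<in> K \<Longrightarrow> y \<in> K \<Longrightarrow> u x = u y \<Longrightarrow> (x, y) \<in> (side_gluing w)\<^sup>*"
proof -
  let ?S = "polygon_surface w" and ?D = "top_of_set (cball (0::complex) 1)" and ?q = "\<lambda>z. gluing_rel w `` {z}"
  have qc: "continuous_map ?D ?S ?q"
    by (rule quotient_imp_continuous_map[OF quotient_map_polygon_surface])
  obtain g where "homeomorphic_maps (top_of_set X) (subtopology ?S (f ` X)) f g"
    using f unfolding embedding_map_def homeomorphic_map_maps by auto
  then have g: "continuous_map (top_of_set X) (subtopology ?S (f ` X)) f"
    "continuous_map (subtopology ?S (f ` X)) (top_of_set X) g" "\<And>x. x \<in> X \<Longrightarrow> g (f x) = x"
    unfolding homeomorphic_maps_def by auto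
  have fc: "continuous_map (top_of_set X) ?S f" using g(1) by (simp add: continuous_map_in_subtopology)
  have "compactin ?S (f ` X)"
    by (rule image_compactin[OF _ fc]) (use X in \<open>simp add: compactin_subtopology\<close>)
  then have clfX: "closedin ?S (f ` X)" by (rule compactin_imp_closedin[OF Hausdorff_polygon_surface])
  have fX: "f ` X \<subseteq> topspace ?S" using clfX by (rule closedin_subset)
  define K where "K = {z \<in> cball 0 1. ?q z \<in> f ` X}"
  define u where "u = (\<lambda>z. g (?q z))"
  have K1: "closedin ?D K" unfolding K_def using closedin_continuous_map_preimage[OF qc clfX] by simp
  have uK: "f (u z) = ?q z" "u z \<in> X" if "z \<in> K" for z
    using that g(3) unfolding K_def u_def by auto
  show thesis
  proof
    show "closed K" using K1 closedin_closed_trans closed_cball by blast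
    show "K \<subseteq> cball 0 1" by (auto simp: K_def)
    have qeq: "?q x = ?q y" if "(x, y) \<in> side_gluing w" for x y
    proof -
      have "(x, y) \<in> gluing_rel w" using that side_gluing_on_sphere[OF that] by (auto simp: gluing_rel_def)
      then show ?thesis by (rule equiv_class_eq[OF equiv_gluing_rel])
    qed
    show "saturated w K"
      unfolding saturated_def
    proof clarify
      fix x y assume xy: "(x, y) \<in> side_gluing w" and x: "x \<in> K"
      have "y \<in> cball 0 1" using side_gluing_on_sphere[OF xy] by auto
      then show "y \<in> K" using x qeq[OF xy] by (simp add: K_def)
    qed
    have "continuous_map (top_of_set K) (subtopology ?S (f ` X)) ?q"
    proof -
      have "continuous_map (subtopology ?D K) ?S ?q" using qc by (rule continuous_map_from_subtopology)
      moreover have "cball 0 1 \<inter> K = K" by (auto simp: K_def)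
      then have "subtopology ?D K = top_of_set K" by (simp add: subtopology_subtopology)
      ultimately show ?thesis by (auto simp: continuous_map_in_subtopology K_def)
    qed
    then have "continuous_map (top_of_set K) (top_of_set X) (g \<circ> ?q)" using g(2) by (rule continuous_map_compose)
    then show "continuous_on K u" unfolding u_def by (simp add: o_def)
    show "u ` K = X"
    proof (intro equalityI subsetI)
      fix x assume x: "x \<in> X"
      then have "f x \<in> cball 0 1 // gluing_rel w" using fX unfolding topspace_polygon_surface by blast
      then obtain z where "z \<in> cball 0 1" "f x = ?q z" by (auto elim: quotientE)
      then have "z \<in> K" "u z = x" using x g(3) by (auto simp: K_def u_def image_iff) (metis)
      then show "x \<in> u ` K" by blast
    qed (use uK in auto)
    show "u x = u y" if "(x, y) \<in> side_gluing w" for x y using qeq[OF that] by (simp add: u_def)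
    fix x y assume xy: "x \<in> K" "y \<in> K" "u x = u y"
    then have "?q x = ?q y" using uK(1) by metis
    moreover have "y \<in> ?q y" using xy(2) equiv_class_self[OF equiv_gluing_rel] by (auto simp: K_def)
    ultimately have "(x, y) \<in> gluing_rel w" by blast
    then show "(x, y) \<in> (side_gluing w)\<^sup>*" by (simp add: gluing_rel_def)
  qed
qed

subsection \<open>The second eigenvalue of the Laplacian\<close>

lemma symmetric_matrix_inner:
  fixes M :: "real^'n^'n"
  assumes "transpose M = M"
  shows "x \<bullet> (M *v y) = (M *v x) \<bullet> y"
  using dot_lmul_matrix[of x M y] transpose_matrix_vector[of M x] assms by simp

text \<open>First-order condition at a maximum. The test value is \<open>t = a / c\<close> for a
  positive \<open>c\<close> above \<open>b\<close>.\<close>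

lemma linear_le_quadratic_imp_zero:
  fixes a b :: real
  assumes "\<And>t. t * a \<le> t\<^sup>2 * b"
  shows "a = 0"
proof (rule ccontr)
  assume "a \<noteq> 0"
  define c where "c = \<bar>b\<bar> + 1"
  have c: "c > 0" "b < c" by (auto simp: c_def)
  have "(a / c) * a \<le> (a / c)\<^sup>2 * b" by (rule assms)
  then have "a\<^sup>2 / c * c\<^sup>2 \<le> (a / c)\<^sup>2 * b * c\<^sup>2"
    using c by (intro mult_right_mono) (auto simp: power2_eq_square)
  then have "a\<^sup>2 * c \<le> a\<^sup>2 * b" using c by (simp add: power_divide power2_eq_square)
  then show False using \<open>a \<noteq> 0\<close> c by simp
qed

text \<open>A maximiser of the Rayleigh quotient on an invariant subspace is an eigenvector.\<close>

lemma eigenvector_in_subspace: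
  fixes M :: "real^'n^'n"
  assumes sym: "transpose M = M" and U: "subspace U" "\<And>x. x \<in> U \<Longrightarrow> M *v x \<in> U" "x0 \<in> U" "x0 \<noteq> 0"
  obtains v c where "v \<in> U" "norm v = 1" "M *v v = c *\<^sub>R v"
proof -
  define S where "S = U \<inter> sphere 0 1"
  have "closed U" using U(1) closed_subspace by blast
  then have "compact S" unfolding S_def by (simp add: closed_Int_compact)
  moreover have "x0 /\<^sub>R norm x0 \<in> S" using U unfolding S_def by (auto intro: subspace_mul)
  moreover have "continuous_on S (\<lambda>x. x \<bullet> (M *v x))"
    by (intro continuous_intros matrix_vector_mult_linear_continuous_on)
  ultimately obtain v where v: "v \<in> S" "\<And>y. y \<in> S \<Longrightarrow> y \<bullet> (M *v y) \<le> v \<bullet> (M *v v)"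
    using continuous_attains_sup[of S "\<lambda>x. x \<bullet> (M *v x)"] by blast
  define c where "c = v \<bullet> (M *v v)"
  have vU: "v \<in> U" "norm v = 1" using v(1) by (auto simp: S_def)
  then have vv: "v \<bullet> v = 1" by (simp add: dot_square_norm)
  have ray: "x \<bullet> (M *v x) \<le> c * (x \<bullet> x)" if "x \<in> U" for x
  proof (cases "x = 0")
    case False
    let ?y = "x /\<^sub>R norm x"
    have "?y \<in> S" using that False U(1) unfolding S_def by (auto intro: subspace_mul)
    then have "?y \<bullet> (M *v ?y) \<le> c" unfolding c_def by (rule v(2))
    then have "(x \<bullet> (M *v x)) / (norm x)\<^sup>2 \<le> c"
      by (simp add: matrix_vector_mult_scaleR power2_eq_square divide_inverse mult.commute mult.left_commute)
    then show ?thesis using False by (simp add: divide_le_eq dot_square_norm)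
  qed simp
  \<comment> \<open>The residual \<open>w\<close> is orthogonal to \<open>v\<close>. Varying the
    maximiser in the direction \<open>w\<close> shows that it is orthogonal to \<open>M *v v\<close>
    as well, hence to itself.\<close>
  define w where "w = M *v v - c *\<^sub>R v"
  have wU: "w \<in> U" unfolding w_def using U vU by (simp add: subspace_diff subspace_mul)
  have "(M *v v) \<bullet> v = c" unfolding c_def by (rule inner_commute)
  then have wv: "w \<bullet> v = 0" by (simp add: w_def inner_diff_left vv)
  have "w \<bullet> (M *v v) = 0"
  proof -
    have "t * (2 * (w \<bullet> (M *v v))) \<le> t\<^sup>2 * (c * (w \<bullet> w) - w \<bullet> (M *v w))" for t
    proof -
      have "v + t *\<^sub>R w \<in> U" using vU wU U(1) by (simp add: subspace_add subspace_mul)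
      then have "(v + t *\<^sub>R w) \<bullet> (M *v (v + t *\<^sub>R w)) \<le> c * ((v + t *\<^sub>R w) \<bullet> (v + t *\<^sub>R w))" by (rule ray)
      moreover have "v \<bullet> (M *v w) = w \<bullet> (M *v v)"
        using symmetric_matrix_inner[OF sym, of v w] by (simp add: inner_commute)
      moreover have "v \<bullet> w = 0" using wv by (simp add: inner_commute)
      ultimately show ?thesis
        using wv vv c_def[symmetric]
        by (simp add: matrix_vector_right_distrib matrix_vector_mult_scaleR inner_add_left inner_add_right
          power2_eq_square algebra_simps)
    qed
    then have "2 * (w \<bullet> (M *v v)) = 0" by (rule linear_le_quadratic_imp_zero)
    then show ?thesis by simp
  qed
  then have "w \<bullet> (M *v v - c *\<^sub>R v) = 0" using wv by (simp add: inner_diff_right)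
  then have "w \<bullet> w = 0" by (simp only: w_def)
  then have "M *v v = c *\<^sub>R v" by (simp add: w_def)
  then show thesis using that vU by blast
qed

text \<open>The orthogonal complement of a set of eigenvectors is invariant by symmetry and so
  contains another eigenvector until the dimension is exhausted.\<close>

lemma orthonormal_eigenbasis:
  fixes M :: "real^'n^'n"
  assumes sym: "transpose M = M"
  obtains e :: "'n \<Rightarrow> real^'n" and ev :: "'n \<Rightarrow> real"
  where "\<And>i j. e i \<bullet> e j = (if i = j then 1 else 0)" "\<And>i. M *v e i = ev i *\<^sub>R e i"
    "\<And>x. (\<Sum>i\<in>UNIV. (x \<bullet> e i) *\<^sub>R e i) = x"
proof -
  define good where "good = (\<lambda>B::(real^'n) set. finite B \<and> pairwise orthogonal B \<and>
    (\<forall>b\<in>B. norm b = 1 \<and> (\<exists>c. M *v b = c *\<^sub>R b)))"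
  have indep: "independent B" if "good B" for B
    using that unfolding good_def by (intro pairwise_orthogonal_independent) auto
  have bound: "card B \<le> CARD('n)" if "good B" for B
    using independent_bound[OF indep[OF that]] by simp
  have "\<exists>B. good B \<and> card B = k" if "k \<le> CARD('n)" for k
    using that
  proof (induction k)
    case 0
    show ?case by (intro exI[of _ "{}"]) (simp add: good_def)
  next
    case (Suc k)
    then obtain B where B: "good B" "card B = k" by auto
    have "dim B = k" using indep[OF B(1)] B(2) dim_eq_card_independent by blast
    then have "dim B < DIM(real^'n)" using Suc.prems by simp
    then obtain x0 where x0: "x0 \<noteq> 0" "\<And>y. y \<in> span B \<Longrightarrow> orthogonal x0 y"
      using orthogonal_to_subspace_exists[of B] by blast
    define U where "U = {x. \<forall>b\<in>B. x \<bullet> b = 0}"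
    have "subspace U" unfolding U_def subspace_def by (auto simp: inner_add_left)
    moreover have "M *v x \<in> U" if "x \<in> U" for x
    proof -
      have "(M *v x) \<bullet> b = 0" if b: "b \<in> B" for b
      proof -
        obtain c where "M *v b = c *\<^sub>R b" using B(1) b unfolding good_def by blast
        then show ?thesis
          using symmetric_matrix_inner[OF sym, of x b] \<open>x \<in> U\<close> b unfolding U_def by simp
      qed
      then show ?thesis by (simp add: U_def)
    qed
    moreover have "x0 \<in> U" using x0(2) span_base unfolding U_def orthogonal_def by blast
    ultimately obtain v c where v: "v \<in> U" "norm v = 1" "M *v v = c *\<^sub>R v"
      using eigenvector_in_subspace[OF sym, of U x0] x0(1) by blast
    have "v \<notin> B"
    proof
      assume "v \<in> B"
      then have "v \<bullet> v = 0" using v(1) unfolding U_def by blast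
      then show False using v(2) by simp
    qed
    then have "card (insert v B) = Suc k" using B unfolding good_def by simp
    moreover have "good (insert v B)"
      using B(1) v unfolding good_def U_def by (auto simp: pairwise_insert orthogonal_def inner_commute)
    ultimately show ?case by blast
  qed
  then obtain B where B: "good B" "card B = CARD('n)" by blast
  have finB: "finite B" and orth: "pairwise orthogonal B" and n1: "\<And>b. b \<in> B \<Longrightarrow> norm b = 1"
    using B(1) unfolding good_def by auto
  obtain e where e: "bij_betw e (UNIV::'n set) B"
    using finite_same_card_bij[of "UNIV::'n set" B] finB B(2) by auto
  have eB: "e i \<in> B" for i using e by (auto simp: bij_betw_def)
  have inj: "e i = e j \<longleftrightarrow> i = j" for i j using e by (auto simp: bij_betw_def inj_on_def)
  have "\<exists>c. M *v e i = c *\<^sub>R e i" for i using B(1) eB unfolding good_def by blast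
  then obtain ev where ev: "\<And>i. M *v e i = ev i *\<^sub>R e i" by metis
  have sp: "UNIV \<subseteq> span B"
    by (rule card_ge_dim_independent) (use indep[OF B(1)] B(2) in auto)
  show thesis
  proof
    show "e i \<bullet> e j = (if i = j then 1 else 0)" for i j
      using orth n1[OF eB[of i]] eB inj[of i j] by (auto simp: pairwise_def orthogonal_def dot_square_norm)
    show "M *v e i = ev i *\<^sub>R e i" for i by (rule ev)
    fix x
    have "(\<Sum>i\<in>UNIV. (x \<bullet> e i) *\<^sub>R e i) = (\<Sum>b\<in>B. (x \<bullet> b) *\<^sub>R b)"
      by (rule sum.reindex_bij_betw[OF e])
    also have "\<dots> = x" by (rule orthonormal_basis_expand[OF orth n1 subsetD[OF sp UNIV_I] finB])
    finally show "(\<Sum>i\<in>UNIV. (x \<bullet> e i) *\<^sub>R e i) = x" .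
  qed
qed

text \<open>Diagonalisation is carried out over the polynomial ring, where \<open>det P\<close> is
  nonzero and can be cancelled from the determinant of \<open>X ** P = P ** D\<close>.\<close>

lemma characteristic_poly_eigenbasis:
  fixes M :: "real^'n^'n" and e :: "'n \<Rightarrow> real^'n"
  assumes e: "\<And>i j. e i \<bullet> e j = (if i = j then 1 else 0)" and ev: "\<And>i. M *v e i = ev i *\<^sub>R e i"
  shows "characteristic_poly M = (\<Prod>i\<in>UNIV. [:- ev i, 1:])"
proof -
  define P :: "real poly^'n^'n" where "P = (\<chi> i j. [:e j $ i:])"
  define X :: "real poly^'n^'n" where "X = mat [:0, 1:] - (\<chi> i j. [:M $ i $ j:])"
  define D :: "real poly^'n^'n" where "D = (\<chi> i j. if i = j then [:- ev i, 1:] else 0)"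
  have const_sum: "(\<Sum>k\<in>A. [:f k:]) = [:\<Sum>k\<in>A. f k:]" for f :: "'n \<Rightarrow> real" and A
    by (induction A rule: infinite_finite_induct) auto
  have "transpose P ** P = mat 1"
  proof -
    have "(transpose P ** P) $ i $ j = mat 1 $ i $ j" for i j
    proof -
      have "(transpose P ** P) $ i $ j = [:\<Sum>k\<in>UNIV. e i $ k * e j $ k:]"
        by (simp add: matrix_matrix_mult_def transpose_def P_def const_sum mult.commute)
      also have "(\<Sum>k\<in>UNIV. e i $ k * e j $ k) = (if i = j then 1 else 0)"
        using e[of i j] by (simp add: inner_vec_def)
      finally show ?thesis by (simp add: mat_def one_pCons)
    qed
    then show ?thesis by (simp add: vec_eq_iff)
  qed
  then have "det (transpose P) * det P = 1" by (metis det_I det_mul)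
  then have P0: "det P \<noteq> 0" by auto
  have "X ** P = P ** D"
  proof -
    have "(X ** P) $ i $ j = (P ** D) $ i $ j" for i j
    proof -
      have "(X ** P) $ i $ j = (\<Sum>k\<in>UNIV. X $ i $ k * P $ k $ j)"
        by (simp add: matrix_matrix_mult_def)
      also have "\<dots> = (\<Sum>k\<in>UNIV. (if i = k then [:0, 1:] * [:e j $ k:] else 0) - [:M $ i $ k * e j $ k:])"
        by (rule sum.cong) (auto simp: X_def P_def mat_def left_diff_distrib)
      also have "\<dots> = (\<Sum>k\<in>UNIV. (if i = k then [:0, 1:] * [:e j $ k:] else 0)) - (\<Sum>k\<in>UNIV. [:M $ i $ k * e j $ k:])"
        by (rule sum_subtractf)
      also have "\<dots> = [:0, 1:] * [:e j $ i:] - [:\<Sum>k\<in>UNIV. M $ i $ k * e j $ k:]"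
        by (simp add: const_sum)
      also have "(\<Sum>k\<in>UNIV. M $ i $ k * e j $ k) = ev j * e j $ i"
        using arg_cong[OF ev[of j], of "\<lambda>v. v $ i"] by (simp add: matrix_vector_mult_def)
      also have "[:0, 1:] * [:e j $ i:] - [:ev j * e j $ i:] = [:e j $ i:] * [:- ev j, 1:]" by simp
      also have "\<dots> = (P ** D) $ i $ j"
        unfolding P_def D_def matrix_matrix_mult_def by (simp add: if_distrib[of "\<lambda>x. _ * x"] cong: if_cong)
      finally show ?thesis .
    qed
    then show ?thesis by (simp add: vec_eq_iff)
  qed
  then have "det X * det P = det D * det P" by (metis det_mul mult.commute)
  then have "det X = det D" using P0 by simp
  also have "\<dots> = (\<Prod>i\<in>UNIV. D $ i $ i)" by (rule det_diagonal) (simp add: D_def)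
  finally show ?thesis by (simp add: characteristic_poly_def X_def D_def)
qed

lemma sorted_second_le:
  fixes f :: "'n::finite \<Rightarrow> real"
  assumes "i \<noteq> j" "f i \<le> c" "f j \<le> c"
  shows "sorted_list_of_multiset (image_mset f (mset_set UNIV)) ! 1 \<le> c"
proof (rule ccontr)
  define xs where "xs = sorted_list_of_multiset (image_mset f (mset_set UNIV))"
  assume "\<not> sorted_list_of_multiset (image_mset f (mset_set UNIV)) ! 1 \<le> c"
  then have gt: "xs ! 1 > c" by (simp add: xs_def)
  have srt: "sorted xs" and ms: "mset xs = image_mset f (mset_set UNIV)" by (simp_all add: xs_def)
  have "{k. k < length xs \<and> xs ! k \<le> c} \<subseteq> {0}"
  proof
    fix k assume k: "k \<in> {k. k < length xs \<and> xs ! k \<le> c}"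
    show "k \<in> {0}"
    proof (rule ccontr)
      assume "k \<notin> {0}"
      then have "xs ! 1 \<le> xs ! k" using k srt by (intro sorted_nth_mono) auto
      then show False using k gt by simp
    qed
  qed
  then have "card {k. k < length xs \<and> xs ! k \<le> c} \<le> card {0::nat}" by (intro card_mono) auto
  then have "length (filter (\<lambda>x. x \<le> c) xs) \<le> 1" by (simp add: length_filter_conv_card)
  moreover have "length (filter (\<lambda>x. x \<le> c) xs) = size (filter_mset (\<lambda>x. x \<le> c) (mset xs))"
    by (metis mset_filter size_mset)
  moreover have "\<dots> = card {k. f k \<le> c}"
    unfolding ms by (simp add: filter_mset_image_mset)
  moreover have "card {i, j} \<le> card {k. f k \<le> c}" using assms by (intro card_mono) auto
  ultimately show False using assms(1) by simp
qed

text \<open>The upper bound of Courant and Fischer. On the plane spanned by \<open>x\<close> and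
  \<open>y\<close> the quadratic form is at most \<open>c\<close> times the squared norm. If only
  one eigenvalue were at most \<open>c\<close>, a nonzero vector of the plane orthogonal to its
  eigenvector would violate this.\<close>

lemma second_eigenvalue_le:
  fixes M :: "real^'n^'n"
  assumes sym: "transpose M = M" and y: "M *v y = 0" "y \<noteq> 0"
    and x: "x \<noteq> 0" "x \<bullet> y = 0" "x \<bullet> (M *v x) \<le> c * (x \<bullet> x)" and c: "c \<ge> 0"
  shows "sorted_eigenvalues M ! 1 \<le> c"
proof -
  obtain e ev where e: "\<And>i j. e i \<bullet> e j = (if i = j then 1 else 0)" "\<And>i::'n. M *v e i = ev i *\<^sub>R e i"
    "\<And>x. (\<Sum>i\<in>UNIV. (x \<bullet> e i) *\<^sub>R e i) = x"
    using orthonormal_eigenbasis[OF sym] by blast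
  have "proots (characteristic_poly M) = (\<Sum>i\<in>UNIV. {# ev i #})"
    unfolding characteristic_poly_eigenbasis[OF e(1,2)] by (subst proots_prod) auto
  also have "\<dots> = image_mset ev (mset_set UNIV)"
    by (simp add: sum_unfold_sum_mset)
  finally have pr: "proots (characteristic_poly M) = image_mset ev (mset_set UNIV)" .
  have "\<exists>i j. i \<noteq> j \<and> ev i \<le> c \<and> ev j \<le> c"
  proof (rule ccontr)
    assume no: "\<not> ?thesis"
    have "\<exists>i0. \<forall>i. i \<noteq> i0 \<longrightarrow> ev i > c"
    proof (cases "\<exists>i0. ev i0 \<le> c")
      case True
      then obtain i0 where "ev i0 \<le> c" by blast
      then have "\<forall>i. i \<noteq> i0 \<longrightarrow> ev i > c" using no by (meson not_le)
      then show ?thesis by blast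
    next
      case False
      then show ?thesis by (meson not_le)
    qed
    then obtain i0 where i0: "\<And>i. i \<noteq> i0 \<Longrightarrow> ev i > c" by blast
    \<comment> \<open>One linear condition in a plane has a nontrivial solution.\<close>
    obtain a b where ab: "a * (y \<bullet> e i0) + b * (x \<bullet> e i0) = 0" "a \<noteq> 0 \<or> b \<noteq> 0"
    proof (cases "x \<bullet> e i0 = 0")
      case True
      then show thesis using that[of 0 1] by simp
    next
      case False
      then show thesis using that[of "x \<bullet> e i0" "- (y \<bullet> e i0)"] by simp
    qed
    define z where "z = a *\<^sub>R y + b *\<^sub>R x"
    have z0: "z \<bullet> e i0 = 0" using ab(1) by (simp add: z_def inner_add_left)
    have yx: "y \<bullet> x = 0" using x(2) by (simp add: inner_commute)
    have zz: "z \<bullet> z = a\<^sup>2 * (y \<bullet> y) + b\<^sup>2 * (x \<bullet> x)"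
      using x(2) yx by (simp add: z_def inner_add_left inner_add_right power2_eq_square)
    have "z \<bullet> z > 0"
    proof -
      have "y \<bullet> y > 0" "x \<bullet> x > 0" using x(1) y(2) by auto
      then show ?thesis unfolding zz using ab(2) by (auto intro: add_pos_nonneg add_nonneg_pos)
    qed
    then have zn: "z \<noteq> 0" by auto
    have yMx: "y \<bullet> (M *v x) = 0" using symmetric_matrix_inner[OF sym, of y x] y(1) by simp
    have "z \<bullet> (M *v z) = b\<^sup>2 * (x \<bullet> (M *v x))"
      by (simp add: z_def matrix_vector_right_distrib matrix_vector_mult_scaleR y(1) inner_add_left yMx power2_eq_square)
    also have "\<dots> \<le> b\<^sup>2 * (c * (x \<bullet> x))" using x(3) by (intro mult_left_mono) auto
    also have "\<dots> \<le> c * (z \<bullet> z)" unfolding zz using c by (simp add: algebra_simps)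
    finally have upper: "z \<bullet> (M *v z) \<le> c * (z \<bullet> z)" .
    have expand: "z \<bullet> v = (\<Sum>i\<in>UNIV. (z \<bullet> e i) * (e i \<bullet> v))" for v
      using arg_cong[OF e(3)[of z], of "\<lambda>t. t \<bullet> v"] by (simp add: inner_sum_left)
    have "e i \<bullet> (M *v z) = ev i * (z \<bullet> e i)" for i
      using symmetric_matrix_inner[OF sym, of "e i" z] e(2)[of i] by (simp add: inner_commute)
    then have zMz: "z \<bullet> (M *v z) = (\<Sum>i\<in>UNIV. ev i * (z \<bullet> e i)\<^sup>2)"
      unfolding expand[of "M *v z"] by (simp add: power2_eq_square algebra_simps)
    have zz2: "c * (z \<bullet> z) = (\<Sum>i\<in>UNIV. c * (z \<bullet> e i)\<^sup>2)"
      unfolding expand[of z] by (simp add: sum_distrib_left power2_eq_square inner_commute)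
    have "\<exists>i. z \<bullet> e i \<noteq> 0"
    proof (rule ccontr)
      assume "\<nexists>i. z \<bullet> e i \<noteq> 0"
      then have "(\<Sum>i\<in>UNIV. (z \<bullet> e i) *\<^sub>R e i) = 0" by simp
      then show False using e(3)[of z] zn by simp
    qed
    then obtain i1 where i1: "z \<bullet> e i1 \<noteq> 0" by blast
    then have "i1 \<noteq> i0" using z0 by auto
    have "(\<Sum>i\<in>UNIV. c * (z \<bullet> e i)\<^sup>2) < (\<Sum>i\<in>UNIV. ev i * (z \<bullet> e i)\<^sup>2)"
    proof (rule sum_strict_mono_ex1)
      show "\<forall>i\<in>UNIV. c * (z \<bullet> e i)\<^sup>2 \<le> ev i * (z \<bullet> e i)\<^sup>2"
      proof
        fix i show "c * (z \<bullet> e i)\<^sup>2 \<le> ev i * (z \<bullet> e i)\<^sup>2"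
          using z0 i0[of i] by (cases "i = i0") (auto intro: mult_right_mono)
      qed
      show "\<exists>i\<in>UNIV. c * (z \<bullet> e i)\<^sup>2 < ev i * (z \<bullet> e i)\<^sup>2"
        using i1 i0[OF \<open>i1 \<noteq> i0\<close>] by (intro bexI[of _ i1]) auto
    qed simp
    then show False using upper zMz zz2 by simp
  qed
  then obtain i j where "i \<noteq> j" "ev i \<le> c" "ev j \<le> c" by blast
  then show ?thesis unfolding sorted_eigenvalues_def pr by (rule sorted_second_le)
qed

section \<open>Test vectors for the Laplacian\<close>

lemma laplacian_nth:
  "laplacian adj $ i $ j = (if i = j then real (card {v. adj i v}) else 0) - (if adj i j then 1 else 0)"
  by (simp add: laplacian_def degree_matrix_def adjacency_matrix_def)

lemma transpose_laplacian: "symp adj \<Longrightarrow> transpose (laplacian adj) = laplacian adj"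
  by (auto simp: vec_eq_iff transpose_def laplacian_nth dest: sympD)

text \<open>A set closed under adjacency is a union of components; the whole vertex set gives the
  all-ones vector.\<close>

lemma laplacian_indicator:
  assumes "symp adj" "\<And>a b. adj a b \<Longrightarrow> a \<in> W \<longleftrightarrow> b \<in> W"
  shows "laplacian adj *v (\<chi> i. if i \<in> W then 1 else 0) = 0"
proof -
  have "(laplacian adj *v (\<chi> i. if i \<in> W then 1 else 0)) $ i = 0" for i
  proof -
    have "(laplacian adj *v (\<chi> i. if i \<in> W then 1 else 0)) $ i =
      (\<Sum>j\<in>UNIV. laplacian adj $ i $ j * (if j \<in> W then 1 else 0))"
      by (simp add: matrix_vector_mult_def)
    also have "\<dots> = (\<Sum>j\<in>UNIV. (if i = j then (if i \<in> W then real (card {v. adj i v}) else 0) else 0) -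
      (if adj i j \<and> j \<in> W then 1 else 0))"
      by (rule sum.cong) (auto simp: laplacian_nth)
    also have "\<dots> = (\<Sum>j\<in>UNIV. (if i = j then (if i \<in> W then real (card {v. adj i v}) else 0) else 0)) -
      (\<Sum>j\<in>UNIV. if adj i j \<and> j \<in> W then 1 else 0)"
      by (rule sum_subtractf)
    also have "\<dots> = (if i \<in> W then real (card {v. adj i v}) else 0) - real (card {j. adj i j \<and> j \<in> W})"
      by (simp add: sum.If_cases)
    also have "\<dots> = 0"
    proof (cases "i \<in> W")
      case True
      then have "{j. adj i j \<and> j \<in> W} = {v. adj i v}" using assms(2) by auto
      then show ?thesis using True by simp
    next
      case False
      then have "{j. adj i j \<and> j \<in> W} = {}" using assms(2) by auto
      then show ?thesis using False by simp
    qed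
    finally show ?thesis .
  qed
  then show ?thesis by (simp add: vec_eq_iff)
qed

lemma algebraic_connectivity_le:
  fixes adj :: "'n::finite \<Rightarrow> 'n \<Rightarrow> bool"
  assumes "symp adj" "x \<noteq> 0" "x \<bullet> 1 = 0" "x \<bullet> (laplacian adj *v x) \<le> c * (x \<bullet> x)" "c \<ge> 0"
  shows "algebraic_connectivity adj \<le> c"
  unfolding algebraic_connectivity_def
proof (rule second_eigenvalue_le[OF transpose_laplacian])
  have one: "(1 :: real^'n) = (\<chi> i. if i \<in> UNIV then 1 else 0)" by (simp add: vec_eq_iff)
  show "laplacian adj *v 1 = 0" unfolding one by (rule laplacian_indicator) (use assms in auto)
qed (use assms in auto)

lemma algebraic_connectivity_disconnected:
  fixes adj :: "'n::finite \<Rightarrow> 'n \<Rightarrow> bool"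
  assumes "symp adj" "\<And>a b. adj a b \<Longrightarrow> a \<in> W \<longleftrightarrow> b \<in> W" "W \<noteq> {}" "W \<noteq> UNIV"
  shows "algebraic_connectivity adj \<le> 0"
proof -
  let ?y = "\<chi> i. if i \<in> W then 1 else (0 :: real)"
  \<comment> \<open>Subtracting the mean makes the kernel vector orthogonal to the all-ones vector;
    it stays nonzero because \<open>W\<close> is proper and nonempty.\<close>
  define t where "t = real (card W) / CARD('n)"
  define x where "x = ?y - t *\<^sub>R (1 :: real^'n)"
  have one: "(1 :: real^'n) = (\<chi> i. if i \<in> UNIV then 1 else 0)" by (simp add: vec_eq_iff)
  have L1: "laplacian adj *v 1 = 0" unfolding one by (rule laplacian_indicator) (use assms in auto)
  have "laplacian adj *v x = 0"
    using laplacian_indicator[OF assms(1,2)] L1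
    by (simp add: x_def matrix_vector_mult_diff_distrib matrix_vector_mult_scaleR)
  then have "x \<bullet> (laplacian adj *v x) \<le> 0 * (x \<bullet> x)" by simp
  moreover have "x \<bullet> 1 = 0"
  proof -
    have "?y \<bullet> 1 = real (card W)" by (simp add: inner_vec_def sum.If_cases)
    moreover have "(1 :: real^'n) \<bullet> 1 = CARD('n)" by (simp add: inner_vec_def)
    ultimately show ?thesis by (simp add: x_def t_def inner_diff_left)
  qed
  moreover have "x \<noteq> 0"
  proof
    assume x0: "x = 0"
    obtain a b where "a \<in> W" "b \<notin> W" using assms(3,4) by blast
    moreover have "x $ a = 0" "x $ b = 0" using x0 by auto
    ultimately show False by (simp add: x_def)
  qed
  ultimately show ?thesis using assms(1) by (intro algebraic_connectivity_le[of adj x 0]) auto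
qed

text \<open>The form at the difference of two unit vectors is the sum of the two diagonal entries
  minus twice the mixed entry, and the latter vanishes for nonadjacent vertices.\<close>

lemma algebraic_connectivity_nonadjacent:
  fixes adj :: "'n::finite \<Rightarrow> 'n \<Rightarrow> bool"
  assumes "symp adj" "irreflp adj" "u \<noteq> v" "\<not> adj u v"
  shows "algebraic_connectivity adj \<le> (real (card {b. adj u b}) + real (card {b. adj v b})) / 2"
proof -
  define x :: "real^'n" where "x = axis u 1 - axis v 1"
  have vu: "\<not> adj v u" "\<not> adj u u" "\<not> adj v v"
    using assms by (auto dest: sympD irreflpD)
  have ax: "axis a 1 \<bullet> z = z $ a" for a and z :: "real^'n" by (simp add: inner_axis')
  have Lx: "(laplacian adj *v x) $ i = laplacian adj $ i $ u - laplacian adj $ i $ v" for i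
    by (simp add: x_def matrix_vector_mult_diff_distrib matrix_vector_mul_component inner_axis)
  have "x \<bullet> (laplacian adj *v x) = real (card {b. adj u b}) + real (card {b. adj v b})"
    using vu assms(3,4) by (simp add: inner_diff_left ax Lx laplacian_nth x_def[THEN arg_cong, of "\<lambda>y. y \<bullet> (laplacian adj *v x)"])
  moreover have "x \<bullet> x = 2" using assms(3) by (simp add: x_def inner_diff_left ax) (simp add: axis_def)
  moreover have "x \<bullet> 1 = 0" by (simp add: x_def inner_diff_left ax)
  moreover have "x \<noteq> 0" using \<open>x \<bullet> x = 2\<close> by auto
  ultimately show ?thesis using assms(1) by (intro algebraic_connectivity_le[of adj x]) auto
qed

text \<open>The two smallest values average at most the mean: the sum is at least \<open>f u\<close>
  plus \<open>card A - 1\<close> copies of \<open>f v\<close>, and part of the weight of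
  \<open>f v\<close> may be shifted to the smaller \<open>f u\<close>.\<close>

lemma two_small_values:
  fixes f :: "'a \<Rightarrow> real"
  assumes "finite A" "card A \<ge> 2"
  obtains u v where "u \<in> A" "v \<in> A" "u \<noteq> v" "card A * (f u + f v) \<le> 2 * (\<Sum>a\<in>A. f a)"
proof -
  have "A \<noteq> {}" using assms(2) by auto
  then obtain u where u: "u \<in> A" "\<And>a. a \<in> A \<Longrightarrow> f u \<le> f a"
    using arg_min_if_finite(1)[OF assms(1)] arg_min_least[OF assms(1)] by metis
  let ?A = "A - {u}"
  have cA: "card ?A = card A - 1" using u(1) by simp
  have "?A \<noteq> {}"
  proof
    assume "?A = {}"
    then have "card ?A = 0" by (simp only: card.empty)
    then have "card A - 1 = 0" using cA by simp
    then show False using assms(2) by simp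
  qed
  moreover have "finite ?A" using assms(1) by simp
  ultimately obtain v where v: "v \<in> ?A" "\<And>a. a \<in> ?A \<Longrightarrow> f v \<le> f a"
    using arg_min_if_finite(1)[of ?A f] arg_min_least[of ?A _ f] by blast
  have "real (card A - 1) * f v = (\<Sum>a\<in>?A. f v)" using cA by simp
  also have "\<dots> \<le> (\<Sum>a\<in>?A. f a)" using v(2) by (rule sum_mono)
  finally have "f u + real (card A - 1) * f v \<le> (\<Sum>a\<in>A. f a)"
    using sum.remove[OF assms(1) u(1), of f] by simp
  moreover have "real (card A - 1) = real (card A) - 1" using assms(2) by (simp add: of_nat_diff)
  moreover have "(real (card A) - 2) * f u \<le> (real (card A) - 2) * f v"
    using u(2) v(1) assms(2) by (intro mult_left_mono) auto
  ultimately have "card A * (f u + f v) \<le> 2 * (\<Sum>a\<in>A. f a)" by (simp add: algebra_simps)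
  then show thesis using that[of u v] u(1) v(1) by blast
qed

subsection \<open>The bound on the algebraic connectivity\<close>

lemma graph_realization_eq_subgraph:
  assumes "symp adj" "\<And>a b. adj a b \<Longrightarrow> col a \<noteq> col b"
  shows "graph_realization adj = subgraph {(a, b). adj a b \<and> col a}"
proof -
  have "\<exists>(a, b)\<in>{(a, b). adj a b \<and> col a}. closed_segment (axis u 1) (axis v (1::real)) = edge_segment (a, b)"
    if "adj u v" for u v
  proof (cases "col u")
    case True
    then show ?thesis using that by (intro bexI[of _ "(u, v)"]) (auto simp: edge_segment_eq)
  next
    case False
    then have "adj v u" "col v" using that assms by (auto dest: sympD)
    then show ?thesis
      by (intro bexI[of _ "(v, u)"]) (auto simp: edge_segment_eq closed_segment_commute)
  qed
  then have "(\<Union>(u, v) \<in> {(u, v). adj u v}. closed_segment (axis u 1) (axis v (1::real))) =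
      (\<Union>e\<in>{(a, b). adj a b \<and> col a}. edge_segment e)"
    by (fastforce simp: edge_segment_eq)
  then show ?thesis unfolding graph_realization_def subgraph_def by simp
qed

lemma embedded_bipartite_edge_bound:
  fixes adj :: "'n::finite \<Rightarrow> 'n \<Rightarrow> bool"
  assumes adj: "symp adj" and col: "\<And>a b. adj a b \<Longrightarrow> col a \<noteq> col b"
    and n: "CARD('n) \<ge> 3"
    and conn: "\<And>W. W \<noteq> {} \<Longrightarrow> W \<noteq> UNIV \<Longrightarrow> \<exists>a b. adj a b \<and> a \<in> W \<and> b \<notin> W"
    and w: "surface_word w g side" and emb: "embeds_in adj (polygon_surface w)"
  shows "card {(a, b). adj a b \<and> col a} + 4 \<le> 2 * (CARD('n) + g)"
proof -
  define E where "E = {(a, b). adj a b \<and> col a}"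
  have X: "graph_realization adj = subgraph E"
    unfolding E_def by (rule graph_realization_eq_subgraph[OF adj col])
  obtain f where f: "embedding_map (top_of_set (subgraph E)) (polygon_surface w) f"
    using emb unfolding embeds_in_def X by blast
  obtain K u where Ku: "closed K" "K \<subseteq> cball 0 1" "saturated w K" "continuous_on K u" "u ` K = subgraph E"
    "\<And>x y. (x, y) \<in> side_gluing w \<Longrightarrow> x \<in> K \<Longrightarrow> u x = u y"
    "\<And>x y. x \<in> K \<Longrightarrow> y \<in> K \<Longrightarrow> u x = u y \<Longrightarrow> (x, y) \<in> (side_gluing w)\<^sup>*"
    using embedding_pullback[OF compact_subgraph f] by blast
  interpret surface_word w g side by (rule w)
  interpret embedded_graph w g side E col K u
  proof unfold_locales
    show "col a \<and> \<not> col b" if "(a, b) \<in> E" for a b using that col[of a b] by (auto simp: E_def)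
  qed (fact Ku)+
  have "\<exists>(a, b)\<in>E. a \<in> W \<longleftrightarrow> b \<notin> W" if W: "W \<noteq> {}" "W \<noteq> UNIV" for W
  proof -
    obtain a b where ab: "adj a b" "a \<in> W" "b \<notin> W" using conn[OF W] by blast
    show ?thesis
    proof (cases "col a")
      case True
      then show ?thesis using ab by (intro bexI[of _ "(a, b)"]) (auto simp: E_def)
    next
      case False
      then have "(b, a) \<in> E" using ab(1) col[OF ab(1)] adj by (auto simp: E_def dest: sympD)
      then show ?thesis using ab by (intro bexI[of _ "(b, a)"]) auto
    qed
  qed
  then show ?thesis using edge_bound[OF n] unfolding E_def by blast
qed

text \<open>Every edge has exactly one end in each colour class, so either class counts all edges
  once.\<close>

lemma sum_degrees_colour_class:
  fixes adj :: "'n::finite \<Rightarrow> 'n \<Rightarrow> bool"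
  assumes "symp adj" "\<And>a b. adj a b \<Longrightarrow> col a \<noteq> col b"
  shows "(\<Sum>a | col a = t. card {b. adj a b}) = card {(a, b). adj a b \<and> col a}"
proof -
  have "(\<Sum>a | col a = t. card {b. adj a b}) = card (SIGMA a:{a. col a = t}. {b. adj a b})"
    by (simp add: card_SigmaI)
  also have "\<dots> = card {(a, b). adj a b \<and> col a}"
  proof (cases t)
    case True
    then have "(SIGMA a:{a. col a = t}. {b. adj a b}) = {(a, b). adj a b \<and> col a}" by auto
    then show ?thesis by simp
  next
    case False
    have "bij_betw prod.swap (SIGMA a:{a. col a = t}. {b. adj a b}) {(a, b). adj a b \<and> col a}"
      by (rule bij_betw_byWitness[where f'=prod.swap]) (use False assms in \<open>auto dest: sympD\<close>)
    then show ?thesis by (rule bij_betw_same_card)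
  qed
  finally show ?thesis .
qed

text \<open>Two vertices of a colour class are never adjacent. In the larger class, with at least
  half of the vertices, two of them have degree sum at most twice the mean degree, that is, at most
  4 m / n for m edges.\<close>

lemma algebraic_connectivity_bipartite_le:
  fixes adj :: "'n::finite \<Rightarrow> 'n \<Rightarrow> bool"
  assumes adj: "symp adj" "irreflp adj" and col: "\<And>a b. adj a b \<Longrightarrow> col a \<noteq> col b" and n: "CARD('n) \<ge> 3"
  shows "algebraic_connectivity adj \<le> 2 * card {(a, b). adj a b \<and> col a} / CARD('n)"
proof -
  let ?m = "card {(a, b). adj a b \<and> col a}"
  have "card {a. col a = True} + card {a. col a = False} = CARD('n)"
    by (subst card_Un_disjoint[symmetric]) (auto intro: arg_cong[where f=card])
  then have "CARD('n) \<le> 2 * card {a. col a = True} \<or> CARD('n) \<le> 2 * card {a. col a = False}" by linarith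
  then obtain t where t: "CARD('n) \<le> 2 * card {a. col a = t}" by blast
  define A where "A = {a. col a = t}"
  have A: "CARD('n) \<le> 2 * card A" "card A \<ge> 2" using t n by (auto simp: A_def)
  obtain u v where uv: "u \<in> A" "v \<in> A" "u \<noteq> v"
    "card A * (real (card {b. adj u b}) + real (card {b. adj v b})) \<le> 2 * (\<Sum>a\<in>A. real (card {b. adj a b}))"
    using two_small_values[of A "\<lambda>a. real (card {b. adj a b})"] A(2) by auto
  have sum: "(\<Sum>a\<in>A. real (card {b. adj a b})) = real ?m"
    using sum_degrees_colour_class[OF adj(1) col, where t=t]
    unfolding A_def of_nat_sum[symmetric] by simp
  define D where "D = real (card {b. adj u b}) + real (card {b. adj v b})"
  have D0: "D \<ge> 0" by (simp add: D_def)
  have "\<not> adj u v" using uv(1,2) col[of u v] by (auto simp: A_def)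
  then have "algebraic_connectivity adj \<le> D / 2"
    unfolding D_def using algebraic_connectivity_nonadjacent[OF adj uv(3)] by simp
  also have "\<dots> \<le> 2 * ?m / CARD('n)"
  proof -
    have "real CARD('n) * D \<le> 2 * real (card A) * D"
      using A(1) D0 by (intro mult_right_mono) (simp_all add: of_nat_le_iff[symmetric, where 'a=real] del: of_nat_le_iff)
    also have "\<dots> \<le> 4 * ?m" using uv(4) sum by (simp add: D_def)
    finally show ?thesis using n by (simp add: field_simps)
  qed
  finally show ?thesis .
qed

lemma euler_characteristic_surface_word:
  assumes "has_euler_characteristic adj x"
  obtains w g side where "surface_word w g side" "embeds_in adj (polygon_surface w)" "x = 2 - int g"
proof -
  consider h where "embeds_in adj (orientable_surface h)" "x = 2 - 2 * int h"
    | k where "k \<ge> 1" "embeds_in adj (nonorientable_surface k)" "x = 2 - int k"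
    using assms unfolding has_euler_characteristic_def has_orientable_genus_def has_nonorientable_genus_def
    by blast
  then show thesis
  proof cases
    case 1
    show thesis
    proof (cases "h = 0")
      case True
      then show thesis using that[OF surface_word_sphere] 1 by (simp add: orientable_surface_def)
    next
      case False
      then show thesis using that[OF surface_word_orientable[of h]] 1 by (simp add: orientable_surface_def)
    qed
  next
    case 2
    then show thesis using that[OF surface_word_nonorientable[of k]] by (simp add: nonorientable_surface_def)
  qed
qed

lemma chromatic_number_2_bipartite:
  fixes adj :: "'n::finite \<Rightarrow> 'n \<Rightarrow> bool"
  assumes "irreflp adj" "chromatic_number adj = 2"
  obtains col :: "'n \<Rightarrow> bool" where "\<And>a b. adj a b \<Longrightarrow> col a \<noteq> col b"
proof -
  let ?P = "\<lambda>k. \<exists>c :: 'n \<Rightarrow> nat. (\<forall>v. c v < k) \<and> (\<forall>u v. adj u v \<longrightarrow> c u \<noteq> c v)"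
  \<comment> \<open>An injective colouring exists by finiteness, so the least number of colours is
    attained and \<open>LEAST\<close> can be unfolded.\<close>
  obtain c :: "'n \<Rightarrow> nat" and k where c: "bij_betw c UNIV {..<k}"
    using ex_bij_betw_finite_nat[of "UNIV :: 'n set"] by (auto simp: atLeast0LessThan)
  have "?P k"
  proof (intro exI[of _ c] conjI allI impI)
    show "c v < k" for v using c by (auto simp: bij_betw_def)
    show "c u \<noteq> c v" if "adj u v" for u v
      using that assms(1) c by (auto simp: bij_betw_def inj_on_def dest: irreflpD)
  qed
  then have "?P (LEAST k. ?P k)" by (rule LeastI)
  then have "?P 2" using assms(2) unfolding chromatic_number_def by simp
  then obtain d :: "'n \<Rightarrow> nat" where d: "\<And>v. d v < 2" "\<And>u v. adj u v \<Longrightarrow> d u \<noteq> d v" by blast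
  show thesis
  proof (rule that[of "\<lambda>v. d v = 0"])
    show "(d a = 0) \<noteq> (d b = 0)" if "adj a b" for a b using d(1)[of a] d(1)[of b] d(2)[OF that] by auto
  qed
qed

theorem theorem6p2:
  fixes adj :: "'n::finite \<Rightarrow> 'n \<Rightarrow> bool" and x :: int
  assumes "symp adj" and "irreflp adj"
    and "CARD('n) \<ge> 3"
    and "chromatic_number adj = 2"
    and "has_euler_characteristic adj x"
  shows "algebraic_connectivity adj \<le> 4 * ((real CARD('n) - real_of_int x) / real CARD('n))"
proof -
  obtain col :: "'n \<Rightarrow> bool" where col: "\<And>a b. adj a b \<Longrightarrow> col a \<noteq> col b"
    by (rule chromatic_number_2_bipartite[OF assms(2,4)]) (rule that)
  obtain w g side where w: "surface_word w g side" "embeds_in adj (polygon_surface w)" "x = 2 - int g"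
    by (rule euler_characteristic_surface_word[OF assms(5)]) (rule that)
  have xr: "real_of_int x = 2 - real g" using w(3) by simp
  show ?thesis
  proof (cases "\<exists>W. W \<noteq> {} \<and> W \<noteq> UNIV \<and> (\<forall>a b. adj a b \<longrightarrow> (a \<in> W \<longleftrightarrow> b \<in> W))")
    case True
    then obtain W where "W \<noteq> {}" "W \<noteq> UNIV" "\<And>a b. adj a b \<Longrightarrow> (a \<in> W \<longleftrightarrow> b \<in> W)" by blast
    then have "algebraic_connectivity adj \<le> 0"
      using algebraic_connectivity_disconnected[OF assms(1), of W] by blast
    \<comment> \<open>The right-hand side is positive because \<open>x\<close> is at most 2 and
      there are at least three vertices.\<close>
    also have "0 \<le> 4 * ((real CARD('n) - real_of_int x) / real CARD('n))"
      using assms(3) xr by (simp add: field_simps)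
    finally show ?thesis .
  next
    case False
    let ?m = "card {(a, b). adj a b \<and> col a}"
    have conn: "\<exists>a b. adj a b \<and> a \<in> W \<and> b \<notin> W" if "W \<noteq> {}" "W \<noteq> UNIV" for W
      using False that assms(1) by (metis sympD)
    have "?m + 4 \<le> 2 * (CARD('n) + g)"
      by (rule embedded_bipartite_edge_bound[OF assms(1) col assms(3) conn w(1,2)])
    then have "real (?m + 4) \<le> real (2 * (CARD('n) + g))" by (simp only: of_nat_le_iff)
    then have m: "2 * real ?m \<le> 4 * (real CARD('n) - real_of_int x)" using xr by simp
    have "algebraic_connectivity adj \<le> 2 * ?m / CARD('n)"
      by (rule algebraic_connectivity_bipartite_le[OF assms(1,2) col assms(3)])
    also have "\<dots> \<le> 4 * (real CARD('n) - real_of_int x) / CARD('n)"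
      using m by (intro divide_right_mono) auto
    finally show ?thesis by simp
  qed
qed

end
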